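(* Let $X$ be a smooth manifold and let $\mathcal U=\{U_i\}$ be an open covering of $X$ all of whose nonempty finite intersections are contractible. For every $k\ge0$ there is an isomorphism $$\widehat{\mathbf H}^k_{\mathrm{smooth}}(X)\ \cong\ \widehat{\mathbf H}^k_{\mathrm{grundle}}(X)$$ induced by sending a smooth hyperspark $A=(A^{p,q})_{p+q=k}$ of degree $k$ to the grundle of degree $k$ whose components $A^{p,q}$ with $(p,q)\ne(k,0)$ are those of $A$ and for which $g=e^{2\pi i A^{k,0}}$.
   Context: $\mathcal E^q$ is the sheaf of smooth differential $q$-forms on $X$ and $\mathcal E_{S^1}$ the sheaf of smooth $S^1$-valued functions. $C^p(\mathcal U,\mathcal S)$ denotes Čech $p$-cochains of $\mathcal U$ with coefficients in the sheaf $\mathcal S$ and $\delta$ the Čech coboundary (written multiplicatively for $\mathcal E_{S^1}$). On $\bigoplus_{p,q\ge0}C^p(\mathcal U,\mathcal E^q)$ the total differential is $D=(-1)^q\delta+d$. Global forms $\mathcal E^q(X)$ are identified with $\ker\delta\subset C^0(\mathcal U,\mathcal E^q)$; $C^p(\mathcal U,\mathbf Z)\subset C^p(\mathcal U,\mathcal E^0)$ denotes (locally) constant integer cochains. A smooth hyperspark of degree $k$ is $A\in\bigoplus_{p+q=k}C^p(\mathcal U,\mathcal E^q)$ with $DA=\phi-R$ for some $\phi\in\mathcal E^{k+1}(X)$ and $R\in C^{k+1}(\mathcal U,\mathbf Z)$. Two smooth hypersparks $A,\overline A$ are smoothly equivalent if $A-\overline A=DB+S$ with $B\in\bigoplus_{p+q=k-1}C^p(\mathcal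 U,\mathcal E^q)$ and $S\in C^k(\mathcal U,\mathbf Z)$. $\widehat{\mathbf H}^k_{\mathrm{smooth}}(X)$ is the group of smooth equivalence classes. A grundle of degree $k$ is a pair $(A,g)$ with $g\in C^k(\mathcal U,\mathcal E_{S^1})$, $\delta g=1$, and $A=(A^{p,q})\in\bigoplus_{p+q=k,\,(p,q)\ne(k,0)}C^p(\mathcal U,\mathcal E^q)$ satisfying, for $k\ge1$: $dA^{0,k}=\phi$ for some $\phi\in\mathcal E^{k+1}(X)$; $dA^{p,k-p}+(-1)^{k-p+1}\delta A^{p-1,k-p+1}=0$ for $1\le p\le k-1$; and $\frac1{2\pi i}\frac{dg}{g}-\delta A^{k-1,1}=0$. For $k=0$ a grundle is just a smooth function $g:X\to S^1$. Grundles form a group (addition of the $A$'s, multiplication of the $g$'s). Two grundles $(A,g)$ and $(\overline A,\overline g)$ of degree $k\ge 1$ are gauge equivalent if there exist $h\in C^{k-1}(\mathcal U,\mathcal E_{S^1})$ with $g\overline g^{-1}=\delta h$ and $B\in\bigoplus_{p+q=k-1,\,q\ne0}C^p(\mathcal U,\mathcal E^q)$ such that: if $k\ge2$, $A^{0,k}-\overline A^{0,k}=dB^{0,k-1}$, $A^{p,k-p}-\overline A^{p,k-p}=dB^{p,k-p-1}+(-1)^{k-p}\delta B^{p-1,k-p}$ for $1\le p\le k-2$, and $A^{k-1,1}-\overline A^{k-1,1}=\frac1{2\pi i}\frac{dh}{h}-\delta B^{k-2,1}$; if $k=1$, $A^{0,1}-\overline A^{0,1}=\frac1{2\pi i}\frac{dh}{h}$.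 In degree $0$, gauge equivalence is equality. $\widehat{\mathbf H}^k_{\mathrm{grundle}}(X)$ is the group of gauge equivalence classes of degree $k$ grundles. *)

theory Defs
  imports
    "HOL-Analysis.Analysis"
    "HOL-Algebra.Coset"
    "HOL-Library.Function_Algebras"
begin

text \<open>Sums, differences and \<open>0\<close> of forms, cochains and families of cochains below are
  the pointwise ones of \<^theory>\<open>HOL-Library.Function_Algebras\<close>.\<close>

section \<open>Smooth functions on open subsets of \<open>\<real>\<^sup>n\<close>\<close>

text \<open>\<open>\<real>\<^sup>n\<close> is \<^term>\<open>Euclidean_space n\<close>, i.e. the functions of type \<^typ>\<open>nat \<Rightarrow> real\<close>
  that vanish at all indices \<open>\<ge> n\<close>; the case \<open>n = 0\<close> is included.\<close>

definition partial :: "nat \<Rightarrow> ((nat \<Rightarrow> real) \<Rightarrow> real) \<Rightarrow> (nat \<Rightarrow> real) \<Rightarrow> real" where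
  "partial i f u = deriv (\<lambda>t. f (u(i := t))) (u i)"

primrec Ck_on :: "nat \<Rightarrow> (nat \<Rightarrow> real) set \<Rightarrow> nat \<Rightarrow> ((nat \<Rightarrow> real) \<Rightarrow> real) \<Rightarrow> bool" where
  "Ck_on n S 0 f \<longleftrightarrow>
     continuous_map (subtopology (Euclidean_space n) S) euclideanreal f"
| "Ck_on n S (Suc m) f \<longleftrightarrow>
     continuous_map (subtopology (Euclidean_space n) S) euclideanreal f \<and>
     (\<forall>i<n. (\<forall>u\<in>S. (\<lambda>t. f (u(i := t))) differentiable at (u i)) \<and> Ck_on n S m (partial i f))"

definition Cinf_on :: "nat \<Rightarrow> (nat \<Rightarrow> real) set \<Rightarrow> ((nat \<Rightarrow> real) \<Rightarrow> real) \<Rightarrow> bool" where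
  "Cinf_on n S f \<longleftrightarrow> (\<forall>m. Ck_on n S m f)"


section \<open>Smooth manifolds\<close>

text \<open>A chart is a domain together with a coordinate map; the values of the coordinate map
  outside the domain are irrelevant.\<close>

type_synonym 'a chart = "'a set \<times> ('a \<Rightarrow> nat \<Rightarrow> real)"

record 'a mfd =
  mdim :: nat
  mtop :: "'a topology"
  matlas :: "'a chart set"

text \<open>The atlas need not be maximal: the notions below are unchanged when it is enlarged to
  the maximal one.\<close>

definition smooth_manifold :: "'a mfd \<Rightarrow> bool" where
  "smooth_manifold M \<longleftrightarrow>
     Hausdorff_space (mtop M) \<and> second_countable (mtop M) \<and>
     (\<Union>(W, c)\<in>matlas M. W) = topspace (mtop M) \<and>
     (\<forall>(W, c)\<in>matlas M.
        openin (mtop M) W \<and> openin (Euclidean_space (mdim M)) (c ` W) \<and>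
        homeomorphic_map (subtopology (mtop M) W)
          (subtopology (Euclidean_space (mdim M)) (c ` W)) c) \<and>
     (\<forall>(W, c)\<in>matlas M. \<forall>(W', c')\<in>matlas M. \<forall>i<mdim M.
        Cinf_on (mdim M) (c ` (W \<inter> W')) (\<lambda>u. c' (inv_into W c u) i))"

definition smooth_on :: "'a mfd \<Rightarrow> 'a set \<Rightarrow> ('a \<Rightarrow> real) \<Rightarrow> bool" where
  "smooth_on M V f \<longleftrightarrow>
     (\<forall>(W, c)\<in>matlas M. Cinf_on (mdim M) (c ` (V \<inter> W)) (\<lambda>u. f (inv_into W c u)))"

definition smooth_near :: "'a mfd \<Rightarrow> 'a \<Rightarrow> ('a \<Rightarrow> real) \<Rightarrow> bool" where
  "smooth_near M x f \<longleftrightarrow> (\<exists>V. openin (mtop M) V \<and> x \<in> V \<and> smooth_on M V f)"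


section \<open>Tangent vectors\<close>

text \<open>Tangent vectors at \<open>x\<close> are the derivations of germs at \<open>x\<close> of smooth functions,
  extended by \<open>0\<close> to functions that are not smooth near \<open>x\<close>.\<close>

type_synonym 'a tvec = "('a \<Rightarrow> real) \<Rightarrow> real"

definition tangent_space :: "'a mfd \<Rightarrow> 'a \<Rightarrow> 'a tvec set" where
  "tangent_space M x =
     {v. (\<forall>f. \<not> smooth_near M x f \<longrightarrow> v f = 0) \<and>
         (\<forall>f g V. smooth_near M x f \<and> smooth_near M x g \<and>
            openin (mtop M) V \<and> x \<in> V \<and> (\<forall>y\<in>V. f y = g y) \<longrightarrow> v f = v g) \<and>
         (\<forall>f g a b. smooth_near M x f \<and> smooth_near M x g \<longrightarrow>
            v (\<lambda>y. a * f y + b * g y) = a * v f + b * v g) \<and>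
         (\<forall>f g. smooth_near M x f \<and> smooth_near M x g \<longrightarrow>
            v (\<lambda>y. f y * g y) = f x * v g + g x * v f)}"

text \<open>The coordinate vector \<open>\<partial>/\<partial>c\<^sub>i\<close> at \<open>x\<close>, for \<open>x\<close> in the domain of the chart.\<close>

definition coord_vec :: "'a mfd \<Rightarrow> 'a chart \<Rightarrow> nat \<Rightarrow> 'a \<Rightarrow> 'a tvec" where
  "coord_vec M C i x f =
     (if smooth_near M x f
      then partial i (\<lambda>u. f (inv_into (fst C) (snd C) u)) (snd C x) else 0)"

text \<open>The value at \<open>y\<close> of the vector field on the chart domain whose coefficients with
  respect to the coordinate fields are constant and equal to those of \<open>v\<close>.\<close>

definition const_coeff_ext :: "'a mfd \<Rightarrow> 'a chart \<Rightarrow> 'a tvec \<Rightarrow> 'a \<Rightarrow> 'a tvec" where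
  "const_coeff_ext M C v y =
     (\<lambda>f. \<Sum>i<mdim M. v (\<lambda>z. snd C z i) * coord_vec M C i y f)"


section \<open>Differential forms\<close>

type_synonym 'a form = "'a \<Rightarrow> 'a tvec list \<Rightarrow> real"

text \<open>\<open>forms M V q\<close> is the space of smooth real \<open>q\<close>-forms on the open set \<open>V\<close>. A form is
  evaluated at a point and a list of \<open>q\<close> tangent vectors and is \<open>0\<close> on all other arguments;
  a \<open>0\<close>-form \<open>\<omega>\<close> is the function \<open>x \<mapsto> \<omega> x []\<close>.\<close>

definition forms :: "'a mfd \<Rightarrow> 'a set \<Rightarrow> nat \<Rightarrow> 'a form set" where
  "forms M V q =
     {\<omega>. (\<forall>x vs. \<not> (x \<in> V \<and> length vs = q \<and> set vs \<subseteq> tangent_space M x) \<longrightarrow> \<omega> x vs = 0) \<and>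
         (\<forall>x\<in>V. \<forall>vs. length vs = q \<and> set vs \<subseteq> tangent_space M x \<longrightarrow>
            (\<forall>i<q. \<forall>w\<in>tangent_space M x. \<forall>a b.
               \<omega> x (vs[i := (\<lambda>f. a * (vs ! i) f + b * w f)]) =
               a * \<omega> x vs + b * \<omega> x (vs[i := w])) \<and>
            (\<forall>i<q. \<forall>j<q. i \<noteq> j \<and> vs ! i = vs ! j \<longrightarrow> \<omega> x vs = 0)) \<and>
         (\<forall>(W, c)\<in>matlas M. \<forall>is. length is = q \<and> set is \<subseteq> {..<mdim M} \<longrightarrow>
            smooth_on M (V \<inter> W) (\<lambda>x. \<omega> x (map (\<lambda>i. coord_vec M (W, c) i x) is)))}"

definition restrict_form :: "'a set \<Rightarrow> 'a form \<Rightarrow> 'a form" where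
  "restrict_form V \<omega> = (\<lambda>x vs. if x \<in> V then \<omega> x vs else 0)"

definition omit :: "nat \<Rightarrow> 'b list \<Rightarrow> 'b list" where
  "omit j xs = take j xs @ drop (Suc j) xs"

text \<open>The exterior derivative of a \<open>q\<close>-form on \<open>V\<close>, by the invariant formula
  \<open>d\<omega>(X\<^sub>0,\<dots>,X\<^sub>q) = \<Sum>\<^sub>j (-1)\<^sup>j X\<^sub>j(\<omega>(\<dots>,X\<^sub>j omitted,\<dots>))\<close> for commuting vector fields. The tangent
  vectors at \<open>x\<close> are extended to fields with constant coefficients in a chart around \<open>x\<close>, so
  that it is the usual \<open>\<Sum>\<^sub>i \<partial>\<omega>\<^sub>I/\<partial>c\<^sub>i dc\<^sub>i \<and> dc\<^sub>I\<close>, which does not depend on the chart.\<close>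

definition ext_d :: "'a mfd \<Rightarrow> 'a set \<Rightarrow> nat \<Rightarrow> 'a form \<Rightarrow> 'a form" where
  "ext_d M V q \<omega> x vs =
     (if x \<in> V \<and> length vs = Suc q \<and> set vs \<subseteq> tangent_space M x
      then let C = (SOME C. C \<in> matlas M \<and> x \<in> fst C) in
        \<Sum>j\<le>q. (-1) ^ j *
          (vs ! j) (\<lambda>y. \<omega> y (omit j (map (\<lambda>v. const_coeff_ext M C v y) vs)))
      else 0)"


section \<open>Smooth circle-valued functions\<close>

text \<open>Sections of \<open>\<E>\<^bsub>S\<^sup>1\<^esub>\<close> over \<open>V\<close>, extended by \<open>1\<close> outside \<open>V\<close>.\<close>

definition circle_fns :: "'a mfd \<Rightarrow> 'a set \<Rightarrow> ('a \<Rightarrow> complex) set" where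
  "circle_fns M V =
     {g. (\<forall>x\<in>V. cmod (g x) = 1) \<and> (\<forall>x. x \<notin> V \<longrightarrow> g x = 1) \<and>
         smooth_on M V (\<lambda>x. Re (g x)) \<and> smooth_on M V (\<lambda>x. Im (g x))}"

text \<open>The real \<open>1\<close>-form \<open>(1 / 2\<pi>\<i>) dg/g\<close>. As \<open>\<bar>g\<bar> = 1\<close>, the number of which the real part is
  taken is real.\<close>

definition dlog_form :: "'a mfd \<Rightarrow> 'a set \<Rightarrow> ('a \<Rightarrow> complex) \<Rightarrow> 'a form" where
  "dlog_form M V g x vs =
     (if x \<in> V \<and> length vs = 1 \<and> set vs \<subseteq> tangent_space M x
      then Re (Complex ((vs ! 0) (\<lambda>y. Re (g y))) ((vs ! 0) (\<lambda>y. Im (g y)))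
               / g x / (2 * of_real pi * \<i>))
      else 0)"


section \<open>Coverings and Cech cochains\<close>

definition good_cover :: "'a mfd \<Rightarrow> 'i set \<Rightarrow> ('i \<Rightarrow> 'a set) \<Rightarrow> bool" where
  "good_cover M I U \<longleftrightarrow>
     (\<forall>i\<in>I. openin (mtop M) (U i)) \<and> (\<Union>i\<in>I. U i) = topspace (mtop M) \<and>
     (\<forall>J\<subseteq>I. finite J \<and> J \<noteq> {} \<and> (\<Inter>j\<in>J. U j) \<noteq> {} \<longrightarrow>
        contractible_space (subtopology (mtop M) (\<Inter>j\<in>J. U j)))"

text \<open>A \<open>p\<close>-cochain assigns to every \<open>(p+1)\<close>-tuple \<open>[i\<^sub>0,\<dots>,i\<^sub>p]\<close> of indices (repetitions
  allowed, no symmetry imposed) a section over \<open>U\<^bsub>i\<^sub>0\<^esub> \<inter> \<dots> \<inter> U\<^bsub>i\<^sub>p\<^esub>\<close>, and the neutral element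
  to all other lists. Over an empty intersection the only section is the neutral one.\<close>

definition simplices :: "'i set \<Rightarrow> nat \<Rightarrow> 'i list set" where
  "simplices I p = {\<sigma>. length \<sigma> = Suc p \<and> set \<sigma> \<subseteq> I}"

definition support :: "('i \<Rightarrow> 'a set) \<Rightarrow> 'i list \<Rightarrow> 'a set" where
  "support U \<sigma> = (\<Inter>i\<in>set \<sigma>. U i)"

type_synonym ('i, 'a) fcochain = "'i list \<Rightarrow> 'a form"
type_synonym ('i, 'a) ccochain = "'i list \<Rightarrow> 'a \<Rightarrow> complex"

text \<open>\<open>C\<^sup>p(\<U>, \<E>\<^sup>q)\<close>\<close>

definition form_cochains ::
    "'a mfd \<Rightarrow> 'i set \<Rightarrow> ('i \<Rightarrow> 'a set) \<Rightarrow> nat \<Rightarrow> nat \<Rightarrow> ('i, 'a) fcochain set" where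
  "form_cochains M I U p q =
     {A. (\<forall>\<sigma>\<in>simplices I p. A \<sigma> \<in> forms M (support U \<sigma>) q) \<and>
         (\<forall>\<sigma>. \<sigma> \<notin> simplices I p \<longrightarrow> A \<sigma> = 0)}"

text \<open>\<open>C\<^sup>p(\<U>, \<int>)\<close> as a subset of \<open>C\<^sup>p(\<U>, \<E>\<^sup>0)\<close>\<close>

definition int_cochains ::
    "'a mfd \<Rightarrow> 'i set \<Rightarrow> ('i \<Rightarrow> 'a set) \<Rightarrow> nat \<Rightarrow> ('i, 'a) fcochain set" where
  "int_cochains M I U p =
     {R \<in> form_cochains M I U p 0. \<forall>\<sigma>\<in>simplices I p. \<forall>x\<in>support U \<sigma>.
        R \<sigma> x [] \<in> \<int> \<and>
        (\<exists>V. openin (mtop M) V \<and> x \<in> V \<and> V \<subseteq> support U \<sigma> \<and> (\<forall>y\<in>V. R \<sigma> y [] = R \<sigma> x []))}"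

text \<open>\<open>C\<^sup>p(\<U>, \<E>\<^bsub>S\<^sup>1\<^esub>)\<close>\<close>

definition circle_cochains ::
    "'a mfd \<Rightarrow> 'i set \<Rightarrow> ('i \<Rightarrow> 'a set) \<Rightarrow> nat \<Rightarrow> ('i, 'a) ccochain set" where
  "circle_cochains M I U p =
     {g. (\<forall>\<sigma>\<in>simplices I p. g \<sigma> \<in> circle_fns M (support U \<sigma>)) \<and>
         (\<forall>\<sigma>. \<sigma> \<notin> simplices I p \<longrightarrow> g \<sigma> = 1)}"

text \<open>Operators on \<open>p\<close>-cochains: the Cech coboundary on cochains of forms and, written
  multiplicatively, on circle-valued cochains; \<open>d\<close> on cochains of \<open>q\<close>-forms; and
  \<open>g \<mapsto> (1 / 2\<pi>\<i>) dg/g\<close>.\<close>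

definition cech ::
    "'i set \<Rightarrow> ('i \<Rightarrow> 'a set) \<Rightarrow> nat \<Rightarrow> ('i, 'a) fcochain \<Rightarrow> ('i, 'a) fcochain" where
  "cech I U p A \<sigma> =
     (if \<sigma> \<in> simplices I (Suc p)
      then restrict_form (support U \<sigma>) (\<lambda>x vs. \<Sum>j\<le>Suc p. (-1) ^ j * A (omit j \<sigma>) x vs)
      else 0)"

definition cech_mult ::
    "'i set \<Rightarrow> ('i \<Rightarrow> 'a set) \<Rightarrow> nat \<Rightarrow> ('i, 'a) ccochain \<Rightarrow> ('i, 'a) ccochain" where
  "cech_mult I U p g \<sigma> =
     (\<lambda>x. if \<sigma> \<in> simplices I (Suc p) \<and> x \<in> support U \<sigma>
          then \<Prod>j\<le>Suc p. g (omit j \<sigma>) x powi ((-1) ^ j) else 1)"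

definition cochain_d ::
    "'a mfd \<Rightarrow> 'i set \<Rightarrow> ('i \<Rightarrow> 'a set) \<Rightarrow> nat \<Rightarrow> nat \<Rightarrow> ('i, 'a) fcochain \<Rightarrow> ('i, 'a) fcochain" where
  "cochain_d M I U p q A \<sigma> =
     (if \<sigma> \<in> simplices I p then ext_d M (support U \<sigma>) q (A \<sigma>) else 0)"

definition cochain_dlog ::
    "'a mfd \<Rightarrow> 'i set \<Rightarrow> ('i \<Rightarrow> 'a set) \<Rightarrow> nat \<Rightarrow> ('i, 'a) ccochain \<Rightarrow> ('i, 'a) fcochain" where
  "cochain_dlog M I U p g \<sigma> =
     (if \<sigma> \<in> simplices I p then dlog_form M (support U \<sigma>) (g \<sigma>) else 0)"

definition signed :: "nat \<Rightarrow> ('i, 'a) fcochain \<Rightarrow> ('i, 'a) fcochain" where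
  "signed m A = (\<lambda>\<sigma> x vs. (-1) ^ m * A \<sigma> x vs)"

text \<open>A global form as an element of \<open>C\<^sup>0(\<U>, \<E>\<^sup>q)\<close>\<close>

definition global_cochain ::
    "'i set \<Rightarrow> ('i \<Rightarrow> 'a set) \<Rightarrow> 'a form \<Rightarrow> ('i, 'a) fcochain" where
  "global_cochain I U \<phi> \<sigma> =
     (if \<sigma> \<in> simplices I 0 then restrict_form (support U \<sigma>) \<phi> else 0)"


section \<open>Smooth hypersparks\<close>

text \<open>Elements of \<open>\<Oplus>\<^bsub>p,q\<^esub> C\<^sup>p(\<U>, \<E>\<^sup>q)\<close> are written as functions of \<open>p\<close> and \<open>q\<close>.\<close>

type_synonym ('i, 'a) bicochain = "nat \<Rightarrow> nat \<Rightarrow> ('i, 'a) fcochain"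

definition total_cochains ::
    "'a mfd \<Rightarrow> 'i set \<Rightarrow> ('i \<Rightarrow> 'a set) \<Rightarrow> nat \<Rightarrow> ('i, 'a) bicochain set" where
  "total_cochains M I U k =
     {A. \<forall>p q. if p + q = k then A p q \<in> form_cochains M I U p q else A p q = 0}"

definition total_D ::
    "'a mfd \<Rightarrow> 'i set \<Rightarrow> ('i \<Rightarrow> 'a set) \<Rightarrow> ('i, 'a) bicochain \<Rightarrow> ('i, 'a) bicochain" where
  "total_D M I U A p q =
     (if p = 0 then 0 else signed q (cech I U (p - 1) (A (p - 1) q))) +
     (if q = 0 then 0 else cochain_d M I U p (q - 1) (A p (q - 1)))"

definition in_bidegree :: "nat \<Rightarrow> nat \<Rightarrow> ('i, 'a) fcochain \<Rightarrow> ('i, 'a) bicochain" where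
  "in_bidegree p q A = (\<lambda>p' q'. if p' = p \<and> q' = q then A else 0)"

definition hypersparks ::
    "'a mfd \<Rightarrow> 'i set \<Rightarrow> ('i \<Rightarrow> 'a set) \<Rightarrow> nat \<Rightarrow> ('i, 'a) bicochain set" where
  "hypersparks M I U k =
     {A \<in> total_cochains M I U k.
        \<exists>\<phi>\<in>forms M (topspace (mtop M)) (k + 1). \<exists>R\<in>int_cochains M I U (k + 1).
          total_D M I U A =
            in_bidegree 0 (k + 1) (global_cochain I U \<phi>) - in_bidegree (k + 1) 0 R}"

definition smooth_equiv ::
    "'a mfd \<Rightarrow> 'i set \<Rightarrow> ('i \<Rightarrow> 'a set) \<Rightarrow> nat \<Rightarrow> (('i, 'a) bicochain \<times> ('i, 'a) bicochain) set" where
  "smooth_equiv M I U k =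
     {(A, A'). A \<in> hypersparks M I U k \<and> A' \<in> hypersparks M I U k \<and>
        (\<exists>B\<in>(if k = 0 then {0} else total_cochains M I U (k - 1)).
         \<exists>S\<in>int_cochains M I U k. A - A' = total_D M I U B + in_bidegree k 0 S)}"

text \<open>The group of classes of a congruence \<open>r\<close>, with the product of classes taken
  elementwise as in \<^term>\<open>G Mod H\<close>.\<close>

definition class_group :: "('b, 'm) monoid_scheme \<Rightarrow> ('b \<times> 'b) set \<Rightarrow> 'b set monoid" where
  "class_group G r =
     \<lparr>carrier = carrier G // r, monoid.mult = set_mult G, one = r `` {\<one>\<^bsub>G\<^esub>}\<rparr>"

definition hyperspark_group ::
    "'a mfd \<Rightarrow> 'i set \<Rightarrow> ('i \<Rightarrow> 'a set) \<Rightarrow> nat \<Rightarrow> ('i, 'a) bicochain monoid" where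
  "hyperspark_group M I U k =
     \<lparr>carrier = hypersparks M I U k, monoid.mult = (\<lambda>A B. A + B), one = 0\<rparr>"

definition H_smooth ::
    "'a mfd \<Rightarrow> 'i set \<Rightarrow> ('i \<Rightarrow> 'a set) \<Rightarrow> nat \<Rightarrow> ('i, 'a) bicochain set monoid" where
  "H_smooth M I U k = class_group (hyperspark_group M I U k) (smooth_equiv M I U k)"


section \<open>Grundles\<close>

type_synonym ('i, 'a) grundle = "('i, 'a) bicochain \<times> ('i, 'a) ccochain"

text \<open>For \<open>k = 0\<close> the form part is \<open>0\<close> and \<open>g\<close> is a circle-valued \<open>0\<close>-cochain with
  \<open>\<delta>g = 1\<close>, i.e. a smooth function \<open>X \<rightarrow> S\<^sup>1\<close> given by its restrictions to the covering.\<close>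

definition grundles ::
    "'a mfd \<Rightarrow> 'i set \<Rightarrow> ('i \<Rightarrow> 'a set) \<Rightarrow> nat \<Rightarrow> ('i, 'a) grundle set" where
  "grundles M I U k =
     {(A, g).
        g \<in> circle_cochains M I U k \<and> cech_mult I U k g = 1 \<and>
        (\<forall>p q. if p + q = k \<and> (p, q) \<noteq> (k, 0)
               then A p q \<in> form_cochains M I U p q else A p q = 0) \<and>
        (k \<ge> 1 \<longrightarrow>
          (\<exists>\<phi>\<in>forms M (topspace (mtop M)) (k + 1).
             cochain_d M I U 0 k (A 0 k) = global_cochain I U \<phi>) \<and>
          (\<forall>p. 1 \<le> p \<and> p \<le> k - 1 \<longrightarrow>
             cochain_d M I U p (k - p) (A p (k - p)) +
             signed (k - p + 1) (cech I U (p - 1) (A (p - 1) (k - p + 1))) = 0) \<and>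
          cochain_dlog M I U k g - cech I U (k - 1) (A (k - 1) 1) = 0)}"

definition gauge_equiv ::
    "'a mfd \<Rightarrow> 'i set \<Rightarrow> ('i \<Rightarrow> 'a set) \<Rightarrow> nat \<Rightarrow> (('i, 'a) grundle \<times> ('i, 'a) grundle) set" where
  "gauge_equiv M I U k =
     {((A, g), (A', g')).
        (A, g) \<in> grundles M I U k \<and> (A', g') \<in> grundles M I U k \<and>
        (if k = 0 then (A, g) = (A', g')
         else
          (\<exists>h\<in>circle_cochains M I U (k - 1). \<exists>B.
             (\<forall>p q. if p + q = k - 1 \<and> q \<noteq> 0
                    then B p q \<in> form_cochains M I U p q else B p q = 0) \<and>
             (\<lambda>\<sigma> x. g \<sigma> x / g' \<sigma> x) = cech_mult I U (k - 1) h \<and>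
             (if k = 1 then A 0 1 - A' 0 1 = cochain_dlog M I U 0 h
              else
               A 0 k - A' 0 k = cochain_d M I U 0 (k - 1) (B 0 (k - 1)) \<and>
               (\<forall>p. 1 \<le> p \<and> p \<le> k - 2 \<longrightarrow>
                  A p (k - p) - A' p (k - p) =
                    cochain_d M I U p (k - p - 1) (B p (k - p - 1)) +
                    signed (k - p) (cech I U (p - 1) (B (p - 1) (k - p)))) \<and>
               A (k - 1) 1 - A' (k - 1) 1 =
                 cochain_dlog M I U (k - 1) h - cech I U (k - 2) (B (k - 2) 1))))}"

definition grundle_group ::
    "'a mfd \<Rightarrow> 'i set \<Rightarrow> ('i \<Rightarrow> 'a set) \<Rightarrow> nat \<Rightarrow> ('i, 'a) grundle monoid" where
  "grundle_group M I U k =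
     \<lparr>carrier = grundles M I U k,
      monoid.mult = (\<lambda>(A, g) (B, h). (A + B, \<lambda>\<sigma> x. g \<sigma> x * h \<sigma> x)), one = (0, 1)\<rparr>"

definition H_grundle ::
    "'a mfd \<Rightarrow> 'i set \<Rightarrow> ('i \<Rightarrow> 'a set) \<Rightarrow> nat \<Rightarrow> ('i, 'a) grundle set monoid" where
  "H_grundle M I U k = class_group (grundle_group M I U k) (gauge_equiv M I U k)"

definition hyperspark_to_grundle :: "nat \<Rightarrow> ('i, 'a) bicochain \<Rightarrow> ('i, 'a) grundle" where
  "hyperspark_to_grundle k A =
     (\<lambda>p q. if (p, q) = (k, 0) then 0 else A p q,
      \<lambda>\<sigma> x. exp (2 * of_real pi * \<i> * of_real (A k 0 \<sigma> x [])))"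

end

theory Submission
  imports Defs
begin

text \<open>
  A circle-valued function on a contractible set has a logarithm that is unique up to a constant
  integer. So on a good covering a grundle \<open>(A, g)\<close> of degree \<open>k\<close> is the same thing as a family
  \<open>(A\<^bsup>p,q\<^esup>)\<close> with \<open>p + q = k\<close> whose component \<open>A\<^bsup>k,0\<^esup>\<close> is known up to integer cochains only: choose
  \<open>A\<^bsup>k,0\<^esup>\<close> with \<open>g = e\<^bsup>2\<pi>\<i>A\<^esup>\<close>, simplex by simplex (\<open>circle_cochains_eq_cochain_exp\<close>). Because
  \<open>(1 / 2\<pi>\<i>) dg/g = dA\<^bsup>k,0\<^esup>\<close>, and because \<open>\<delta>g = 1\<close> says that \<open>\<delta>A\<^bsup>k,0\<^esup>\<close> is an integer cochain, the grundle
  conditions on \<open>(A, g)\<close> are the hyperspark equation for the family. Hence \<open>hyperspark_to_grundle\<close>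
  maps the hypersparks onto the grundles (\<open>hyperspark_to_grundle_surj\<close>).

  Gauge transformations \<open>(h, B)\<close> are treated in the same way: a logarithm of \<open>h\<close> supplies the
  component \<open>B\<^bsup>k-1,0\<^esup>\<close>, and the gauge relation turns into \<open>A - A' = DB + S\<close> with an integer cochain
  \<open>S\<close>. So two hypersparks are equivalent if and only if their grundles are
  (\<open>smooth_equiv_iff_gauge_equiv\<close>). The map of hypersparks to grundles is additive, the hypersparks
  form a group and those equivalent to \<open>0\<close> a subgroup, so both quotients are groups and the
  induced map is an isomorphism (\<open>class_group_iso\<close>). Neither \<open>D\<^sup>2 = 0\<close> nor exactness of Cech complexes
  enters.

  The analysis behind this is elementary. The chain rule shows that a function that is smooth
  in one chart is smooth; it is needed for the curvature form in degree \<open>0\<close>. A derivation \<open>v\<close>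
  satisfies \<open>v(e\<^bsup>2\<pi>\<i>f\<^esup>) = 2\<pi>\<i> e\<^bsup>2\<pi>\<i>f\<^esup> v(f)\<close> by Hadamard's lemma for power series
  (\<open>tangent_pser_at_0\<close>). Additivity of \<open>d\<close> follows from smoothness of forms on fields with constant
  coefficients (\<open>forms_smooth_const_coeff\<close>). Logarithms are constructed by continuation along the
  paths of a contraction (\<open>contractible_circle_logarithm\<close>) and are smooth since their
  exponentials are (\<open>smooth_on_angle\<close>).
\<close>

section \<open>Smooth functions on open subsets of Euclidean space\<close>

text \<open>\<open>D\<close> is the \<open>i\<close>-th partial derivative of \<open>f\<close> at \<open>u\<close>. In contrast to
  \<^const>\<open>partial\<close>, which has a value at every point, this includes existence of the derivative.\<close>

definition has_partial :: "nat \<Rightarrow> ((nat \<Rightarrow> real) \<Rightarrow> real) \<Rightarrow> real \<Rightarrow> (nat \<Rightarrow> real) \<Rightarrow> bool" where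
  "has_partial i f D u \<longleftrightarrow> ((\<lambda>t. f (u(i := t))) has_real_derivative D) (at (u i))"

lemma has_partial_imp_partial: "has_partial i f D u \<Longrightarrow> partial i f u = D"
  unfolding has_partial_def partial_def by (rule DERIV_imp_deriv)

lemma differentiable_imp_has_partial:
  "(\<lambda>t. f (u(i := t))) differentiable at (u i) \<Longrightarrow> has_partial i f (partial i f u) u"
  unfolding has_partial_def partial_def by (metis DERIV_imp_deriv real_differentiable_def)

lemma continuous_map_fun_upd:
  assumes "u \<in> topspace (Euclidean_space n)" "i < n"
  shows "continuous_map euclideanreal (Euclidean_space n) (\<lambda>t. u(i := t))"
  using assms unfolding Euclidean_space_def continuous_map_in_subtopology
  by (auto simp: continuous_map_componentwise_UNIV)

lemma eventually_fun_upd_in: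
  assumes "openin (Euclidean_space n) S" "u \<in> S" "i < n"
  shows "\<forall>\<^sub>F t in nhds (u i). u(i := t) \<in> S"
proof -
  have "u \<in> topspace (Euclidean_space n)"
    using assms openin_subset by blast
  then have "open {t. u(i := t) \<in> S}"
    using openin_continuous_map_preimage[OF continuous_map_fun_upd[OF _ assms(3)] assms(1)] by simp
  then show ?thesis
    using assms(2) eventually_nhds_in_open[of "{t. u(i := t) \<in> S}" "u i"] by simp
qed

lemma has_partial_cong:
  assumes "openin (Euclidean_space n) S" "u \<in> S" "i < n" "\<And>u. u \<in> S \<Longrightarrow> f u = g u"
  shows "has_partial i f D u \<longleftrightarrow> has_partial i g D u"
  unfolding has_partial_def
proof (rule DERIV_cong_ev[OF refl _ refl])
  show "\<forall>\<^sub>F t in nhds (u i). f (u(i := t)) = g (u(i := t))"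
    using eventually_fun_upd_in[OF assms(1-3)] by eventually_elim (use assms(4) in auto)
qed

lemma partial_cong:
  assumes "openin (Euclidean_space n) S" "u \<in> S" "i < n" "\<And>u. u \<in> S \<Longrightarrow> f u = g u"
  shows "partial i f u = partial i g u"
  unfolding partial_def
proof (rule deriv_cong_ev[OF _ refl])
  show "\<forall>\<^sub>F t in nhds (u i). f (u(i := t)) = g (u(i := t))"
    using eventually_fun_upd_in[OF assms(1-3)] by eventually_elim (use assms(4) in auto)
qed

lemma topspace_subtopology_openin: "openin X S \<Longrightarrow> topspace (subtopology X S) = S"
  by (rule topspace_subtopology_subset[OF openin_subset])

lemma Ck_on_Suc_iff:
  "Ck_on n S (Suc m) f \<longleftrightarrow>
     continuous_map (subtopology (Euclidean_space n) S) euclideanreal f \<and>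
     (\<forall>i<n. (\<forall>u\<in>S. has_partial i f (partial i f u) u) \<and> Ck_on n S m (partial i f))"
proof -
  have "(\<lambda>t. f (u(i := t))) differentiable at (u i) \<longleftrightarrow> has_partial i f (partial i f u) u" for i u
    using differentiable_imp_has_partial[of f u i]
    by (metis has_partial_def real_differentiable_def)
  then show ?thesis by simp
qed

declare Ck_on.simps(2) [simp del]

lemma Ck_on_partial: "Ck_on n S (Suc m) f \<Longrightarrow> i < n \<Longrightarrow> Ck_on n S m (partial i f)"
  by (simp add: Ck_on_Suc_iff)

lemma Ck_on_has_partial:
  "Ck_on n S (Suc m) f \<Longrightarrow> i < n \<Longrightarrow> u \<in> S \<Longrightarrow> has_partial i f (partial i f u) u"
  by (simp add: Ck_on_Suc_iff)

lemma Ck_on_continuous: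
  "Ck_on n S m f \<Longrightarrow> continuous_map (subtopology (Euclidean_space n) S) euclideanreal f"
  by (cases m) (auto simp: Ck_on_Suc_iff)

lemma Ck_on_cong:
  assumes S: "openin (Euclidean_space n) S" and "\<And>u. u \<in> S \<Longrightarrow> f u = g u"
    and "Ck_on n S m f"
  shows "Ck_on n S m g"
  using assms(2,3)
proof (induction m arbitrary: f g)
  case 0
  then show ?case
    using continuous_map_eq[of "subtopology (Euclidean_space n) S" euclideanreal f g]
    by (simp add: topspace_subtopology_openin[OF S])
next
  case (Suc m)
  have "continuous_map (subtopology (Euclidean_space n) S) euclideanreal g"
    using Suc.prems continuous_map_eq[of "subtopology (Euclidean_space n) S" euclideanreal f g]
    by (simp add: topspace_subtopology_openin[OF S] Ck_on_Suc_iff)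
  moreover have "Ck_on n S m (partial i g)" if "i < n" for i
    by (rule Suc.IH[OF partial_cong[OF S _ that Suc.prems(1)] Ck_on_partial[OF Suc.prems(2) that]])
  moreover have "has_partial i g (partial i g u) u" if "i < n" "u \<in> S" for i u
  proof -
    have "has_partial i f (partial i f u) u"
      using Suc.prems(2) that by (simp add: Ck_on_Suc_iff)
    then show ?thesis
      using has_partial_cong[OF S that(2,1), of f g] partial_cong[OF S that(2,1), of f g] Suc.prems(1)
      by simp
  qed
  ultimately show ?case
    unfolding Ck_on_Suc_iff by blast
qed

text \<open>The proposed partial derivatives need to agree with the actual ones on the open set only.\<close>

lemma Ck_on_SucI:
  assumes S: "openin (Euclidean_space n) S"
    and "continuous_map (subtopology (Euclidean_space n) S) euclideanreal f"
    and "\<And>i u. i < n \<Longrightarrow> u \<in> S \<Longrightarrow> has_partial i f (f' i u) u"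
    and "\<And>i. i < n \<Longrightarrow> Ck_on n S m (f' i)"
  shows "Ck_on n S (Suc m) f"
proof -
  have eq: "partial i f u = f' i u" if "i < n" "u \<in> S" for i u
    using assms(3)[OF that] by (rule has_partial_imp_partial)
  have "Ck_on n S m (partial i f)" if "i < n" for i
    by (rule Ck_on_cong[OF S _ assms(4)[OF that]]) (simp add: eq that)
  then show ?thesis
    unfolding Ck_on_Suc_iff using assms(2,3) eq by simp
qed

lemma Ck_on_SucD: "Ck_on n S (Suc m) f \<Longrightarrow> Ck_on n S m f"
  by (induction m arbitrary: f) (auto simp: Ck_on_Suc_iff)

lemma Ck_on_mono: "Ck_on n S m f \<Longrightarrow> T \<subseteq> S \<Longrightarrow> Ck_on n T m f"
  by (induction m arbitrary: f) (auto simp: Ck_on_Suc_iff intro: continuous_map_from_subtopology_mono)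

lemma continuous_map_locally:
  assumes "openin X S"
    and "\<And>u. u \<in> S \<Longrightarrow> \<exists>T. openin X T \<and> u \<in> T \<and> T \<subseteq> S \<and> continuous_map (subtopology X T) Y f"
  shows "continuous_map (subtopology X S) Y f"
  unfolding continuous_map
proof (intro conjI allI impI)
  have *: "topspace (subtopology X T) = T" if "openin X T" for T
    by (rule topspace_subtopology_subset[OF openin_subset[OF that]])
  show "f ` topspace (subtopology X S) \<subseteq> topspace Y"
  proof
    fix y assume "y \<in> f ` topspace (subtopology X S)"
    then obtain u where u: "y = f u" "u \<in> S"
      by (auto simp: *[OF assms(1)])
    from assms(2)[OF u(2)] obtain T where T: "openin X T" "u \<in> T" "continuous_map (subtopology X T) Y f"
      by auto
    then show "y \<in> topspace Y"
      using continuous_map_image_subset_topspace[OF T(3)] u *[OF T(1)] by auto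
  qed
  fix V assume V: "openin Y V"
  show "openin (subtopology X S) {x \<in> topspace (subtopology X S). f x \<in> V}"
    unfolding *[OF assms(1)] openin_open_subtopology[OF assms(1)]
  proof
    show "openin X {x \<in> S. f x \<in> V}"
    proof (subst openin_subopen, intro ballI)
      fix u assume u: "u \<in> {x \<in> S. f x \<in> V}"
      then obtain T where T: "openin X T" "u \<in> T" "T \<subseteq> S" "continuous_map (subtopology X T) Y f"
        using assms(2)[of u] by auto
      have "openin X {x \<in> T. f x \<in> V}"
        using openin_continuous_map_preimage[OF T(4) V]
        unfolding *[OF T(1)] openin_open_subtopology[OF T(1)] ..
      then show "\<exists>T. openin X T \<and> u \<in> T \<and> T \<subseteq> {x \<in> S. f x \<in> V}"
        using T u by (intro exI[of _ "{x \<in> T. f x \<in> V}"]) auto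
    qed
  qed auto
qed

lemma Ck_on_local:
  assumes "openin (Euclidean_space n) S"
    and "\<And>u. u \<in> S \<Longrightarrow> \<exists>T. openin (Euclidean_space n) T \<and> u \<in> T \<and> T \<subseteq> S \<and> Ck_on n T m f"
  shows "Ck_on n S m f"
  using assms(2)
proof (induction m arbitrary: f)
  case (0 f)
  then show ?case
    using continuous_map_locally[OF assms(1), of euclideanreal f] by simp
next
  case (Suc m f)
  have "continuous_map (subtopology (Euclidean_space n) S) euclideanreal f"
  proof (rule continuous_map_locally[OF assms(1)])
    fix u assume "u \<in> S"
    from Suc.prems[OF this] obtain T where
      T: "openin (Euclidean_space n) T" "u \<in> T" "T \<subseteq> S" "Ck_on n T (Suc m) f"
      by auto
    then show "\<exists>T. openin (Euclidean_space n) T \<and> u \<in> T \<and> T \<subseteq> S \<and>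
        continuous_map (subtopology (Euclidean_space n) T) euclideanreal f"
      using Ck_on_continuous[OF T(4)] by auto
  qed
  moreover have "has_partial i f (partial i f u) u" if "i < n" "u \<in> S" for i u
    using Suc.prems[OF that(2)] that(1) by (auto intro: Ck_on_has_partial)
  moreover have "Ck_on n S m (partial i f)" if "i < n" for i
  proof (rule Suc.IH)
    fix u assume "u \<in> S"
    from Suc.prems[OF this] Ck_on_partial[OF _ that]
    show "\<exists>T. openin (Euclidean_space n) T \<and> u \<in> T \<and> T \<subseteq> S \<and> Ck_on n T m (partial i f)"
      by auto
  qed
  ultimately show ?case
    by (simp add: Ck_on_Suc_iff)
qed

lemma Ck_on_const: "Ck_on n S m (\<lambda>_. c)"
proof (induction m arbitrary: c)
  case (Suc m)
  have "partial i (\<lambda>_. c) = (\<lambda>_. 0)" for i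
    by (auto simp: partial_def)
  then show ?case
    using Suc by (auto simp: Ck_on_Suc_iff has_partial_def)
qed auto

lemma Ck_on_add:
  assumes S: "openin (Euclidean_space n) S" and "Ck_on n S m f" "Ck_on n S m g"
  shows "Ck_on n S m (\<lambda>u. f u + g u)"
  using assms(2,3)
proof (induction m arbitrary: f g)
  case 0
  then show ?case by (auto intro: continuous_map_add)
next
  case (Suc m)
  then show ?case
    by (intro Ck_on_SucI[OF S, where f' = "\<lambda>i u. partial i f u + partial i g u"])
      (auto simp: Ck_on_Suc_iff has_partial_def intro!: continuous_map_add derivative_eq_intros)
qed

lemma Ck_on_mult:
  assumes S: "openin (Euclidean_space n) S" and "Ck_on n S m f" "Ck_on n S m g"
  shows "Ck_on n S m (\<lambda>u. f u * g u)"
  using assms(2,3)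
proof (induction m arbitrary: f g)
  case 0
  then show ?case by (auto intro: continuous_map_real_mult)
next
  case (Suc m)
  have *: "has_partial i (\<lambda>u. f u * g u) (partial i f u * g u + partial i g u * f u) u"
    if "i < n" "u \<in> S" for i u
    using DERIV_mult[of "\<lambda>t. f (u(i := t))" "partial i f u" "u i" UNIV "\<lambda>t. g (u(i := t))" "partial i g u"]
      Suc.prems that
    by (simp add: Ck_on_Suc_iff has_partial_def)
  show ?case
    using Suc.prems *
    by (intro Ck_on_SucI[OF S, where f' = "\<lambda>i u. partial i f u * g u + partial i g u * f u"]
         continuous_map_real_mult Ck_on_add[OF S] Suc.IH)
       (auto simp: Ck_on_Suc_iff intro: Ck_on_SucD[unfolded Ck_on_Suc_iff])
qed

text \<open>Coefficients of a real power series that converges everywhere, and its sum. Such functions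
  include the sine and the cosine, and are closed under differentiation and under passing from
  \<open>P(t)\<close> to \<open>(P(t) - P(0)) / t\<close>.\<close>

definition entire_coeffs :: "(nat \<Rightarrow> real) \<Rightarrow> bool" where
  "entire_coeffs a \<longleftrightarrow> (\<forall>x. summable (\<lambda>n. a n * x ^ n))"

definition pser :: "(nat \<Rightarrow> real) \<Rightarrow> real \<Rightarrow> real" where
  "pser a x = (\<Sum>n. a n * x ^ n)"

lemma entire_coeffs_diffs: "entire_coeffs a \<Longrightarrow> entire_coeffs (diffs a)"
  unfolding entire_coeffs_def by (auto intro: termdiff_converges_all)

lemma pser_DERIV: "entire_coeffs a \<Longrightarrow> (pser a has_real_derivative pser (diffs a) x) (at x)"
  unfolding entire_coeffs_def pser_def[abs_def] by (intro termdiffs_strong_converges_everywhere) auto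

lemma continuous_map_pser:
  "entire_coeffs a \<Longrightarrow> continuous_map X euclideanreal f \<Longrightarrow> continuous_map X euclideanreal (\<lambda>x. pser a (f x))"
  using continuous_map_compose[of X euclideanreal f euclideanreal "pser a"]
    DERIV_continuous_on[of UNIV "pser a"] pser_DERIV[of a]
  by (auto simp: o_def has_field_derivative_at_within)

lemma Ck_on_pser:
  assumes S: "openin (Euclidean_space n) S" and "Ck_on n S m f" "entire_coeffs a"
  shows "Ck_on n S m (\<lambda>u. pser a (f u))"
  using assms(2,3)
proof (induction m arbitrary: a)
  case 0
  then show ?case by (auto intro: continuous_map_pser)
next
  case (Suc m)
  have "has_partial i (\<lambda>u. pser a (f u)) (pser (diffs a) (f u) * partial i f u) u"
    if "i < n" "u \<in> S" for i u
    using DERIV_chain2[OF pser_DERIV[OF Suc.prems(2)], of "\<lambda>t. f (u(i := t))" "partial i f u" "u i" UNIV]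
      Suc.prems that
    by (simp add: Ck_on_Suc_iff has_partial_def)
  moreover have "Ck_on n S m (partial i f)" if "i < n" for i
    using Suc.prems that by (auto simp: Ck_on_Suc_iff)
  ultimately show ?case
    using Suc.prems
    by (intro Ck_on_SucI[OF S, where f' = "\<lambda>i u. pser (diffs a) (f u) * partial i f u"]
         continuous_map_pser Ck_on_mult[OF S] Suc.IH entire_coeffs_diffs)
       (auto simp: Ck_on_SucD Ck_on_continuous)
qed

subsection \<open>The chain rule\<close>

lemma Euclidean_box:
  assumes "openin (Euclidean_space n) T" "x \<in> T"
  obtains e where "e > 0" "\<And>y. (\<And>i. i < n \<Longrightarrow> \<bar>y i - x i\<bar> < e) \<Longrightarrow> (\<And>i. i \<ge> n \<Longrightarrow> y i = 0) \<Longrightarrow> y \<in> T"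
proof -
  obtain W where W: "openin (powertop_real UNIV) W" "T = W \<inter> {x. \<forall>i\<ge>n. x i = 0}"
    using assms unfolding Euclidean_space_def openin_subtopology by auto
  have "\<exists>B. x \<in> Pi\<^sub>E UNIV B \<and> (\<forall>i. openin euclideanreal (B i)) \<and>
      finite {i. B i \<noteq> topspace euclideanreal} \<and> Pi\<^sub>E UNIV B \<subseteq> W"
    by (rule product_topology_open_contains_basis[OF W(1)]) (use W(2) assms(2) in blast)
  then obtain B where B: "\<And>i. open (B i)" "x \<in> Pi\<^sub>E UNIV B" "Pi\<^sub>E UNIV B \<subseteq> W"
    by auto
  have "\<exists>e>0. \<forall>s. \<bar>s - x i\<bar> < e \<longrightarrow> s \<in> B i" for i
    using B(1)[of i] B(2) unfolding open_dist dist_real_def by (auto simp: PiE_iff)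
  then obtain e where e: "\<And>i. e i > 0" "\<And>i s. \<bar>s - x i\<bar> < e i \<Longrightarrow> s \<in> B i"
    by metis
  define e0 where "e0 = Min (insert 1 (e ` {..<n}))"
  have "e0 > 0" "\<And>i. i < n \<Longrightarrow> e0 \<le> e i"
    using e(1) by (auto simp: e0_def)
  moreover have "y \<in> T" if "\<And>i. i < n \<Longrightarrow> \<bar>y i - x i\<bar> < e0" "\<And>i. i \<ge> n \<Longrightarrow> y i = 0" for y
  proof -
    have "y i \<in> B i" for i
    proof (cases "i < n")
      case True
      then show ?thesis using that(1)[OF True] e(2) \<open>i < n \<Longrightarrow> e0 \<le> e i\<close> by fastforce
    next
      case False
      then have "x i = 0" "y i = 0" using W(2) assms(2) that(2) by auto
      then show ?thesis using e(1)[of i] e(2)[where s="y i"] by auto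
    qed
    then show ?thesis
      using B(3) W(2) that(2) by (auto simp: PiE_iff)
  qed
  ultimately show thesis
    using that by blast
qed

lemma mvt_signed:
  fixes f :: "real \<Rightarrow> real"
  assumes "\<And>s. \<bar>s - a\<bar> \<le> \<bar>b - a\<bar> \<Longrightarrow> (f has_real_derivative f' s) (at s)"
  shows "\<exists>s. \<bar>s - a\<bar> \<le> \<bar>b - a\<bar> \<and> f b - f a = f' s * (b - a)"
proof (cases a b rule: linorder_cases)
  case less
  obtain z where "a < z" "z < b" "f b - f a = (b - a) * f' z"
    using MVT2[OF less, of f f'] assms by (auto simp: abs_if split: if_splits)
  then show ?thesis by (intro exI[of _ z]) auto
next
  case greater
  obtain z where "b < z" "z < a" "f a - f b = (a - b) * f' z"
    using MVT2[OF greater, of f f'] assms by (auto simp: abs_if split: if_splits)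
  then show ?thesis by (intro exI[of _ z]) (auto simp: algebra_simps)
qed auto

text \<open>A \<open>C\<^sup>1\<close> function is differentiable in the sense of Frechet: the increment is split into
  increments along the coordinate axes, to each of which the mean value theorem applies.\<close>

lemma C1_linear_approx:
  assumes T: "openin (Euclidean_space n) T" and "x \<in> T" "Ck_on n T (Suc 0) f" "e > 0"
  obtains d where "d > 0"
    "\<And>y. (\<And>i. i < n \<Longrightarrow> \<bar>y i - x i\<bar> < d) \<Longrightarrow> (\<And>i. i \<ge> n \<Longrightarrow> y i = 0) \<Longrightarrow>
       \<bar>f y - f x - (\<Sum>j<n. partial j f x * (y j - x j))\<bar> \<le> e * (\<Sum>j<n. \<bar>y j - x j\<bar>)"
proof -
  define N where "N = {y \<in> T. \<forall>j<n. \<bar>partial j f y - partial j f x\<bar> < e}"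
  have xT: "\<And>i. i \<ge> n \<Longrightarrow> x i = 0"
    using openin_subset[OF T] assms(2) by (auto simp: topspace_Euclidean_space)
  have "openin (Euclidean_space n) {y \<in> T. \<bar>partial j f y - partial j f x\<bar> < e}" if "j < n" for j
  proof -
    have "continuous_map (subtopology (Euclidean_space n) T) euclideanreal (partial j f)"
      using assms(3) that by (auto simp: Ck_on_Suc_iff)
    from openin_continuous_map_preimage[OF this, of "ball (partial j f x) e"]
    have "openin (subtopology (Euclidean_space n) T) {y \<in> T. partial j f y \<in> ball (partial j f x) e}"
      by (simp add: topspace_subtopology_openin[OF T] del: topspace_subtopology)
    then show ?thesis
      using T by (simp add: openin_open_subtopology dist_real_def abs_minus_commute)
  qed
  then have "openin (Euclidean_space n) (T \<inter> (\<Inter>j\<in>{..<n}. {y \<in> T. \<bar>partial j f y - partial j f x\<bar> < e}))"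
    using T by (cases "n = 0") (auto intro!: openin_Int openin_INT2)
  also have "T \<inter> (\<Inter>j\<in>{..<n}. {y \<in> T. \<bar>partial j f y - partial j f x\<bar> < e}) = N"
    by (auto simp: N_def)
  finally have "openin (Euclidean_space n) N" .
  then obtain d where d: "d > 0"
    "\<And>y. (\<And>i. i < n \<Longrightarrow> \<bar>y i - x i\<bar> < d) \<Longrightarrow> (\<And>i. i \<ge> n \<Longrightarrow> y i = 0) \<Longrightarrow> y \<in> N"
    using Euclidean_box[of n N x] assms by (auto simp: N_def)
  have "\<bar>f y - f x - (\<Sum>j<n. partial j f x * (y j - x j))\<bar> \<le> e * (\<Sum>j<n. \<bar>y j - x j\<bar>)"
    if y: "\<And>i. i < n \<Longrightarrow> \<bar>y i - x i\<bar> < d" "\<And>i. i \<ge> n \<Longrightarrow> y i = 0" for y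
  proof -
    \<comment> \<open>the corners of the path from \<open>x\<close> to \<open>y\<close> that changes one coordinate after the other\<close>
    define z where "z j = (\<lambda>i. if i < j then y i else x i)" for j
    have step: "\<bar>f (z (Suc j)) - f (z j) - partial j f x * (y j - x j)\<bar> \<le> e * \<bar>y j - x j\<bar>" if "j < n" for j
    proof -
      have zN: "(z j)(j := s) \<in> N" if "\<bar>s - x j\<bar> \<le> \<bar>y j - x j\<bar>" for s
        using y that xT \<open>j < n\<close> d(1) order.strict_trans1[OF that y(1)[OF \<open>j < n\<close>]]
        by (intro d(2)) (auto simp: z_def)
      have "((\<lambda>t. f ((z j)(j := t))) has_real_derivative partial j f ((z j)(j := s))) (at s)"
        if "\<bar>s - x j\<bar> \<le> \<bar>y j - x j\<bar>" for s
        using zN[OF that] assms(3) \<open>j < n\<close> unfolding Ck_on_Suc_iff has_partial_def N_def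
        by fastforce
      from mvt_signed[of "x j" "y j", OF this] obtain s where
        s: "\<bar>s - x j\<bar> \<le> \<bar>y j - x j\<bar>"
          "f ((z j)(j := y j)) - f ((z j)(j := x j)) = partial j f ((z j)(j := s)) * (y j - x j)"
        by auto
      have "(z j)(j := y j) = z (Suc j)" "(z j)(j := x j) = z j"
        by (auto simp: z_def fun_eq_iff less_Suc_eq)
      then have "f (z (Suc j)) - f (z j) - partial j f x * (y j - x j)
          = (partial j f ((z j)(j := s)) - partial j f x) * (y j - x j)"
        using s by (simp add: algebra_simps)
      moreover have "\<bar>partial j f ((z j)(j := s)) - partial j f x\<bar> \<le> e"
        using zN[OF s(1)] \<open>j < n\<close> by (auto simp: N_def intro: less_imp_le)
      ultimately show ?thesis
        by (simp add: abs_mult mult_right_mono)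
    qed
    have "z n = y" "z 0 = x"
      using y xT by (auto simp: z_def fun_eq_iff)
    then have "f y - f x - (\<Sum>j<n. partial j f x * (y j - x j))
        = (\<Sum>j<n. f (z (Suc j)) - f (z j) - partial j f x * (y j - x j))"
      using sum_lessThan_telescope[of "\<lambda>j. f (z j)" n] by (simp add: sum_subtractf)
    also have "\<bar>\<dots>\<bar> \<le> (\<Sum>j<n. e * \<bar>y j - x j\<bar>)"
      by (intro order.trans[OF sum_abs] sum_mono step) auto
    finally show ?thesis by (simp add: sum_distrib_left)
  qed
  then show thesis using d(1) that by blast
qed

lemma chain_rule_curve:
  assumes T: "openin (Euclidean_space n) T" and f: "Ck_on n T (Suc 0) f" and "\<gamma> t0 \<in> T"
    and der: "\<And>j. j < n \<Longrightarrow> ((\<lambda>t. \<gamma> t j) has_real_derivative d j) (at t0)"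
    and zero: "\<forall>\<^sub>F t in nhds t0. \<forall>j\<ge>n. \<gamma> t j = 0"
  shows "((\<lambda>t. f (\<gamma> t)) has_real_derivative (\<Sum>j<n. partial j f (\<gamma> t0) * d j)) (at t0)"
proof -
  define R where "R t = f (\<gamma> t) - f (\<gamma> t0) - (\<Sum>j<n. partial j f (\<gamma> t0) * (\<gamma> t j - \<gamma> t0 j))" for t
  define K where "K = 1 + (\<Sum>j<n. \<bar>d j\<bar>)"
  have "K > 0" unfolding K_def by (simp add: add_pos_nonneg sum_nonneg)
  have quot: "((\<lambda>t. (\<gamma> t j - \<gamma> t0 j) / (t - t0)) \<longlongrightarrow> d j) (at t0)" if "j < n" for j
    using der[OF that] by (simp add: has_field_derivative_iff)
  have "((\<lambda>t. \<Sum>j<n. \<bar>(\<gamma> t j - \<gamma> t0 j) / (t - t0)\<bar>) \<longlongrightarrow> (\<Sum>j<n. \<bar>d j\<bar>)) (at t0)"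
    by (intro tendsto_sum tendsto_rabs quot) simp
  then have bound: "\<forall>\<^sub>F t in at t0. (\<Sum>j<n. \<bar>(\<gamma> t j - \<gamma> t0 j) / (t - t0)\<bar>) < K"
    by (rule order_tendstoD(2)) (simp add: K_def)
  have "((\<lambda>t. R t / (t - t0)) \<longlongrightarrow> 0) (at t0)"
  proof (rule tendstoI)
    fix e :: real assume "e > 0"
    obtain \<delta> where \<delta>: "\<delta> > 0"
      "\<And>y. (\<And>i. i < n \<Longrightarrow> \<bar>y i - \<gamma> t0 i\<bar> < \<delta>) \<Longrightarrow> (\<And>i. i \<ge> n \<Longrightarrow> y i = 0) \<Longrightarrow>
       \<bar>f y - f (\<gamma> t0) - (\<Sum>j<n. partial j f (\<gamma> t0) * (y j - \<gamma> t0 j))\<bar> \<le> (e / K) * (\<Sum>j<n. \<bar>y j - \<gamma> t0 j\<bar>)"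
      using C1_linear_approx[OF T assms(3) f, of "e / K"] \<open>e > 0\<close> \<open>K > 0\<close> by auto
    have "\<forall>\<^sub>F t in at t0. \<bar>\<gamma> t i - \<gamma> t0 i\<bar> < \<delta>" if "i < n" for i
    proof -
      have "((\<lambda>t. \<gamma> t i) \<longlongrightarrow> \<gamma> t0 i) (at t0)"
        using DERIV_isCont[OF der[OF that]] by (simp add: isCont_def)
      then show ?thesis
        using tendstoD[OF _ \<delta>(1)] by (fastforce simp: dist_real_def)
    qed
    then have "\<forall>\<^sub>F t in at t0. \<forall>i\<in>{..<n}. \<bar>\<gamma> t i - \<gamma> t0 i\<bar> < \<delta>"
      by (intro eventually_ball_finite) auto
    moreover have "\<forall>\<^sub>F t in at t0. \<forall>j\<ge>n. \<gamma> t j = 0"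
      using zero by (simp add: eventually_at_filter eventually_mono)
    moreover have "\<forall>\<^sub>F t in at t0. t \<noteq> t0"
      by (simp add: eventually_at_filter)
    ultimately show "\<forall>\<^sub>F t in at t0. dist (R t / (t - t0)) 0 < e"
      using bound
    proof eventually_elim
      case (elim t)
      have "\<bar>R t\<bar> \<le> (e / K) * (\<Sum>j<n. \<bar>\<gamma> t j - \<gamma> t0 j\<bar>)"
        unfolding R_def using elim by (intro \<delta>(2)) auto
      also have "\<dots> = (e / K) * (\<Sum>j<n. \<bar>(\<gamma> t j - \<gamma> t0 j) / (t - t0)\<bar>) * \<bar>t - t0\<bar>"
        using elim by (simp add: sum_distrib_right abs_divide)
      also have "\<dots> < (e / K) * K * \<bar>t - t0\<bar>"
        using elim \<open>e > 0\<close> \<open>K > 0\<close> by (intro mult_strict_right_mono mult_strict_left_mono) auto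
      finally show ?case
        using elim \<open>K > 0\<close> by (simp add: abs_divide divide_less_eq)
    qed
  qed
  moreover have "R t0 = 0" by (simp add: R_def)
  ultimately have "(R has_real_derivative 0) (at t0)"
    by (simp add: has_field_derivative_iff)
  moreover have "((\<lambda>t. f (\<gamma> t0) + (\<Sum>j<n. partial j f (\<gamma> t0) * (\<gamma> t j - \<gamma> t0 j)))
      has_real_derivative (\<Sum>j<n. partial j f (\<gamma> t0) * d j)) (at t0)"
    by (auto intro!: derivative_eq_intros der sum.cong)
  ultimately have "((\<lambda>t. R t + (f (\<gamma> t0) + (\<Sum>j<n. partial j f (\<gamma> t0) * (\<gamma> t j - \<gamma> t0 j))))
      has_real_derivative (0 + (\<Sum>j<n. partial j f (\<gamma> t0) * d j))) (at t0)"
    by (rule DERIV_add)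
  then show ?thesis by (simp add: R_def)
qed

lemma Ck_on_sum:
  assumes S: "openin (Euclidean_space n) S" and "\<And>j. j \<in> J \<Longrightarrow> Ck_on n S m (f j)"
  shows "Ck_on n S m (\<lambda>u. \<Sum>j\<in>J. f j u)"
  using assms(2) by (induction J rule: infinite_finite_induct) (auto intro!: Ck_on_add[OF S] simp: Ck_on_const)

lemma continuous_map_into_Euclidean:
  assumes "\<And>j. j < n' \<Longrightarrow> continuous_map X euclideanreal (\<lambda>u. \<phi> u j)" 
    "\<And>u. u \<in> topspace X \<Longrightarrow> \<phi> u \<in> topspace (Euclidean_space n')"
  shows "continuous_map X (Euclidean_space n') \<phi>"
proof -
  have "continuous_map X (Euclidean_space n') (\<lambda>u j. if j < n' then \<phi> u j else 0)"
    using assms(1) by (simp add: continuous_map_componentwise_Euclidean_space)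
  then show ?thesis
    by (rule continuous_map_eq) (use assms(2) in \<open>auto simp: topspace_Euclidean_space fun_eq_iff\<close>)
qed

lemma Ck_on_compose:
  assumes S: "openin (Euclidean_space n) S" and T: "openin (Euclidean_space n') T"
    and f: "Ck_on n' T m f" and phi: "\<And>j. j < n' \<Longrightarrow> Ck_on n S m (\<lambda>u. \<phi> u j)"
    and into: "\<And>u. u \<in> S \<Longrightarrow> \<phi> u \<in> T"
  shows "Ck_on n S m (\<lambda>u. f (\<phi> u))"
  using f phi
proof (induction m arbitrary: f)
  case (0 f)
  have "continuous_map (subtopology (Euclidean_space n) S) (subtopology (Euclidean_space n') T) \<phi>"
    unfolding continuous_map_in_subtopology
    using 0 into openin_subset[OF T]
    by (intro conjI continuous_map_into_Euclidean) (auto simp: topspace_subtopology_openin[OF S])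
  from continuous_map_compose[OF this, of euclideanreal f] 0(1) show ?case
    by (simp add: o_def)
next
  case (Suc m f)
  have "continuous_map (subtopology (Euclidean_space n) S) (subtopology (Euclidean_space n') T) \<phi>"
    unfolding continuous_map_in_subtopology
    using Suc.prems Ck_on_continuous into openin_subset[OF T]
    by (intro conjI continuous_map_into_Euclidean) (fastforce simp: topspace_subtopology_openin[OF S])+
  from continuous_map_compose[OF this, of euclideanreal f] Ck_on_continuous[OF Suc.prems(1)]
  have cont: "continuous_map (subtopology (Euclidean_space n) S) euclideanreal (\<lambda>u. f (\<phi> u))"
    by (simp add: o_def)
  have f1: "Ck_on n' T (Suc 0) f"
    using Suc.prems(1) Ck_on_continuous by (auto simp: Ck_on_Suc_iff)
  have "has_partial i (\<lambda>u. f (\<phi> u)) (\<Sum>j<n'. partial j f (\<phi> u) * partial i (\<lambda>u. \<phi> u j) u) u"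
    if "i < n" "u \<in> S" for i u
  proof -
    have "((\<lambda>t. f (\<phi> (u(i := t)))) has_real_derivative
       (\<Sum>j<n'. partial j f (\<phi> (u(i := u i))) * partial i (\<lambda>u. \<phi> u j) u)) (at (u i))"
    proof (rule chain_rule_curve[OF T f1])
      show "\<phi> (u(i := u i)) \<in> T" using into that by auto
      show "((\<lambda>t. \<phi> (u(i := t)) j) has_real_derivative partial i (\<lambda>u. \<phi> u j) u) (at (u i))" 
        if "j < n'" for j
        using Suc.prems(2)[OF that] \<open>i < n\<close> \<open>u \<in> S\<close> by (simp add: Ck_on_Suc_iff has_partial_def)
      show "\<forall>\<^sub>F t in nhds (u i). \<forall>j\<ge>n'. \<phi> (u(i := t)) j = 0"
        using eventually_fun_upd_in[OF S \<open>u \<in> S\<close> \<open>i < n\<close>]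
      proof eventually_elim
        case (elim t)
        then show ?case
          using into openin_subset[OF T] by (fastforce simp: topspace_Euclidean_space)
      qed
    qed
    then show ?thesis by (simp add: has_partial_def)
  qed
  moreover have "Ck_on n S m (\<lambda>u. \<Sum>j<n'. partial j f (\<phi> u) * partial i (\<lambda>u. \<phi> u j) u)" if "i < n" for i
  proof (intro Ck_on_sum[OF S] Ck_on_mult[OF S])
    fix j assume "j \<in> {..<n'}"
    then have j: "j < n'" by simp
    show "Ck_on n S m (\<lambda>u. partial j f (\<phi> u))"
      by (rule Suc.IH[OF Ck_on_partial[OF Suc.prems(1) j]]) (rule Ck_on_SucD[OF Suc.prems(2)])
    show "Ck_on n S m (partial i (\<lambda>u. \<phi> u j))"
      by (rule Ck_on_partial[OF Suc.prems(2)[OF j] that])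
  qed
  ultimately show ?case
    by (intro Ck_on_SucI[OF S cont]) blast+
qed

section \<open>Logarithms of circle-valued functions\<close>

text \<open>Two logarithms of a path that agree at \<open>1\<close> agree at \<open>0\<close>; \<open>\<phi>\<close> is their difference.\<close>

lemma exp_eq_1_on_interval_const:
  fixes \<phi> :: "real \<Rightarrow> complex"
  assumes "continuous_on {0..1} \<phi>" "\<And>t. t \<in> {0..1} \<Longrightarrow> exp (\<phi> t) = 1" "\<phi> 1 = 0"
  shows "\<phi> 0 = 0"
proof -
  have "\<phi> constant_on {0..1}"
  proof (rule continuous_discrete_range_constant[OF _ assms(1)])
    show "connected {0..1::real}" by simp
    fix t :: real assume t: "t \<in> {0..1}"
    have "2 * pi \<le> norm (\<phi> s - \<phi> t)" if s: "s \<in> {0..1}" "\<phi> s \<noteq> \<phi> t" for s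
    proof -
      have "exp (\<phi> s) = exp (\<phi> t)" using assms(2) t s by simp
      then obtain n :: int where n: "\<phi> s = \<phi> t + (of_int (2 * n) * pi) * \<i>"
        unfolding exp_eq by blast
      then have "n \<noteq> 0" using s by auto
      then have "1 \<le> \<bar>real_of_int n\<bar>"
        by linarith
      then show ?thesis using n by (simp add: norm_mult)
    qed
    then show "\<exists>e>0. \<forall>y. y \<in> {0..1} \<and> \<phi> y \<noteq> \<phi> t \<longrightarrow> e \<le> norm (\<phi> y - \<phi> t)"
      by (intro exI[of _ "2 * pi"]) auto
  qed
  then show ?thesis
    using assms(3) unfolding constant_on_def
    by (metis atLeastAtMost_iff order.refl zero_le_one)
qed

lemma near_1_Re_pos: "norm (z - 1 :: complex) < 1 \<Longrightarrow> 0 < Re z"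
  using abs_Re_le_cmod[of "z - 1"] by simp

lemma near_1_not_nonpos_Reals: "norm (z - 1 :: complex) < 1 \<Longrightarrow> z \<notin> \<real>\<^sub>\<le>\<^sub>0"
  using near_1_Re_pos[of z] by (auto simp: complex_nonpos_Reals_iff)

lemma continuous_map_then_continuous_on:
  "continuous_map X (top_of_set S) f \<Longrightarrow> continuous_on S \<phi> \<Longrightarrow>
     continuous_map X euclidean (\<lambda>x. \<phi> (f x))"
  using continuous_map_compose[of X "top_of_set S" f euclidean \<phi>] by (simp add: o_def)

text \<open>A contraction moves every point \<open>x\<close> along a path to the base point \<open>a\<close>; the logarithm of \<open>g\<close>
  at \<open>x\<close> is obtained by continuing the one at \<open>a\<close> along that path. By compactness of the unit
  interval, for \<open>x\<close> close to \<open>x0\<close> the values of \<open>g\<close> along the two paths have quotients close to \<open>1\<close>.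
  So the two continuations differ by the principal logarithm of the quotient, which proves
  continuity at \<open>x0\<close>.\<close>

lemma contractible_circle_logarithm:
  fixes g :: "'a \<Rightarrow> complex"
  assumes X: "contractible_space X" and g: "continuous_map X euclidean g"
    and norm: "\<And>x. x \<in> topspace X \<Longrightarrow> cmod (g x) = 1"
  obtains f where "continuous_map X euclideanreal f"
    "\<And>x. x \<in> topspace X \<Longrightarrow> g x = exp (2 * of_real pi * \<i> * of_real (f x))"
proof -
  let ?I = "top_of_set {0..1::real}"
  obtain a h where h: "continuous_map (prod_topology ?I X) X h"
      "\<And>x. h (0, x) = x" "\<And>x. h (1, x) = a"
    using X unfolding contractible_space_def homotopic_with_def by auto
  define G where "G p = g (h p)" for p
  have G: "continuous_map (prod_topology ?I X) euclidean G"
    using continuous_map_compose[OF h(1) g] by (simp add: G_def[abs_def] o_def)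
  have hX: "h (t, x) \<in> topspace X" if "t \<in> {0..1}" "x \<in> topspace X" for t x
    using continuous_map_image_subset_topspace[OF h(1)] that by auto
  have Gnorm: "cmod (G (t, x)) = 1" if "t \<in> {0..1}" "x \<in> topspace X" for t x
    using hX[OF that] norm by (simp add: G_def)
  have Gnz: "G (t, x) \<noteq> 0" if "t \<in> {0..1}" "x \<in> topspace X" for t x
    using Gnorm[OF that] by auto
  have G_slice: "continuous_on {0..1} (\<lambda>t. G (t, x))" if "x \<in> topspace X" for x
  proof -
    have "continuous_map ?I (prod_topology ?I X) (\<lambda>t. (t, x))"
      using that by (simp add: continuous_map_pairwise o_def)
    from continuous_map_compose[OF this G] show ?thesis by (simp add: o_def)
  qed
  have "\<exists>L. continuous_on {0..1} L \<and> (\<forall>t\<in>{0..1}. G (t, x) = exp (L t))" if "x \<in> topspace X" for x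
  proof -
    have "contractible {0..1::real}" by (simp add: convex_imp_contractible)
    with continuous_logarithm_on_contractible[OF G_slice[OF that]] Gnz[OF _ that]
    show ?thesis by metis
  qed
  then obtain L where L: "\<And>x. x \<in> topspace X \<Longrightarrow> continuous_on {0..1} (L x)"
      "\<And>x t. x \<in> topspace X \<Longrightarrow> t \<in> {0..1} \<Longrightarrow> G (t, x) = exp (L x t)"
    by metis
  define F where "F x t = L x t - L x 1" for x t
  have expF: "exp (F x t) = G (t, x) / g a" if "x \<in> topspace X" "t \<in> {0..1}" for x t
    using L(2)[OF that] L(2)[OF that(1), of 1] by (simp add: F_def exp_diff) (simp add: G_def h)
  define f where "f x = Im (F x 0 + Ln (g a)) / (2 * pi)" for x
  have lift: "g x = exp (2 * of_real pi * \<i> * of_real (f x))" if x: "x \<in> topspace X" for x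
  proof -
    have "g a \<noteq> 0" using Gnz[of 1 x] x by (simp add: G_def h)
    then have e: "g x = exp (F x 0 + Ln (g a))"
      using expF[OF x, of 0] by (simp add: exp_add G_def h)
    then have "Re (F x 0 + Ln (g a)) = 0"
      using norm[OF x] by (metis norm_exp_eq_Re exp_eq_one_iff)
    then have "F x 0 + Ln (g a) = \<i> * of_real (2 * pi * f x)"
      by (simp add: f_def complex_eq_iff)
    with e show ?thesis by (simp add: mult_ac)
  qed
  have "continuous_map (subtopology X (topspace X)) euclideanreal f"
  proof (rule continuous_map_locally)
    fix x0 assume x0: "x0 \<in> topspace X"
    define q where "q p = G p / G (fst p, x0)" for p
    have cq: "continuous_map (prod_topology ?I X) euclidean q"
    proof -
      have "continuous_map (prod_topology ?I X) (prod_topology ?I X) (\<lambda>p. (fst p, x0))"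
        using x0 by (simp add: continuous_map_pairwise o_def continuous_map_fst)
      from continuous_map_compose[OF this G]
      have "continuous_map (prod_topology ?I X) euclidean (\<lambda>p. G (fst p, x0))" by (simp add: o_def)
      with G have "continuous_map (prod_topology ?I X) (prod_topology euclidean euclidean) (\<lambda>p. (G p, G (fst p, x0)))"
        by (subst continuous_map_pairwise) (simp add: o_def)
      then have c: "continuous_map (prod_topology ?I X) euclidean (\<lambda>p. (G p, G (fst p, x0)))"
        by simp
      have "G (fst p, x0) \<noteq> 0" if "p \<in> topspace (prod_topology ?I X)" for p
        using Gnz x0 that by auto
      then have 1: "continuous_map (prod_topology ?I X) (top_of_set (UNIV \<times> - {0})) (\<lambda>p. (G p, G (fst p, x0)))"
        using c by (auto simp: continuous_map_in_subtopology)
      have 2: "continuous_on (UNIV \<times> - {0}) (\<lambda>w :: complex \<times> complex. fst w / snd w)"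
        by (auto intro!: continuous_intros)
      show ?thesis
        using continuous_map_then_continuous_on[OF 1 2] unfolding q_def fst_conv snd_conv .
    qed
    have o: "openin (prod_topology ?I X) {p \<in> topspace (prod_topology ?I X). q p \<in> ball 1 1}"
      by (rule openin_continuous_map_preimage[OF cq]) auto
    have s: "{0..1} \<times> {x0} \<subseteq> {p \<in> topspace (prod_topology ?I X). q p \<in> ball 1 1}"
      using x0 Gnz by (auto simp: q_def)
    have c: "compactin ?I {0..1}" "compactin X {x0}"
      using x0 by (auto simp: compactin_subtopology)
    obtain A N where AN: "openin ?I A" "openin X N" "{0..1} \<subseteq> A" "{x0} \<subseteq> N"
        "A \<times> N \<subseteq> {p \<in> topspace (prod_topology ?I X). q p \<in> ball 1 1}"
      by (rule Wallace_theorem_prod_topology[OF c o s])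
    have NX: "N \<subseteq> topspace X" by (rule openin_subset[OF AN(2)])
    have q1: "norm (q (t, x) - 1) < 1" if "t \<in> {0..1}" "x \<in> N" for t x
    proof -
      have "(t, x) \<in> A \<times> N" using AN(3) that by auto
      then have "q (t, x) \<in> ball 1 1" using AN(5) by blast
      then show ?thesis by (simp add: dist_norm norm_minus_commute)
    qed
    have Feq: "F x 0 = F x0 0 + Ln (q (0, x))" if x: "x \<in> N" for x
    proof -
      have xX: "x \<in> topspace X" using NX x by auto
      define \<phi> where "\<phi> t = F x t - F x0 t - Ln (q (t, x))" for t
      have "continuous_on {0..1} (\<lambda>t. q (t, x))"
        unfolding q_def using G_slice[OF xX] G_slice[OF x0] Gnz[OF _ x0]
        by (auto intro!: continuous_on_divide)
      then have "continuous_on {0..1} (\<lambda>t. Ln (q (t, x)))"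
        using q1[OF _ x] near_1_not_nonpos_Reals by (intro continuous_on_Ln') auto
      then have "continuous_on {0..1} \<phi>"
        unfolding \<phi>_def F_def using L(1)[OF xX] L(1)[OF x0]
        by (intro continuous_on_diff continuous_on_const)
      moreover have "exp (\<phi> t) = 1" if t: "t \<in> {0..1}" for t
      proof -
        have "q (t, x) \<noteq> 0" using q1[OF t x] by auto
        moreover have "g a \<noteq> 0" using Gnz[of 1 x] xX by (simp add: G_def h)
        moreover have "exp (\<phi> t) = exp (F x t) / exp (F x0 t) / exp (Ln (q (t, x)))"
          unfolding \<phi>_def exp_diff ..
        ultimately show ?thesis
          using Gnz[OF t x0] Gnz[OF t xX]
          by (simp add: expF[OF xX t] expF[OF x0 t] q_def)
      qed
      moreover have "\<phi> 1 = 0"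
        using Gnz[of 1 x0] x0 by (simp add: \<phi>_def F_def q_def G_def h)
      ultimately have "\<phi> 0 = 0" by (rule exp_eq_1_on_interval_const)
      then show ?thesis by (simp add: \<phi>_def algebra_simps)
    qed
    have "continuous_map (subtopology X N) (top_of_set (ball 1 1)) (\<lambda>x. q (0, x))"
    proof -
      have "continuous_map X (prod_topology ?I X) (\<lambda>x. (0, x))"
        by (simp add: continuous_map_pairwise o_def)
      from continuous_map_compose[OF this cq]
      have "continuous_map X euclidean (\<lambda>x. q (0, x))" by (simp add: o_def)
      then have "continuous_map (subtopology X N) euclidean (\<lambda>x. q (0, x))"
        by (rule continuous_map_from_subtopology)
      then show ?thesis
        using q1[of 0] by (auto simp: continuous_map_in_subtopology dist_norm norm_minus_commute)
    qed
    moreover have "continuous_on (ball 1 1) (\<lambda>z. Im (F x0 0 + Ln z + Ln (g a)) / (2 * pi))"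
      using near_1_not_nonpos_Reals
      by (auto intro!: continuous_intros simp: dist_norm norm_minus_commute)
    ultimately have "continuous_map (subtopology X N) euclideanreal
        (\<lambda>x. Im (F x0 0 + Ln (q (0, x)) + Ln (g a)) / (2 * pi))"
      by (rule continuous_map_then_continuous_on)
    then have "continuous_map (subtopology X N) euclideanreal f"
      by (rule continuous_map_eq) (simp add: f_def Feq)
    then show "\<exists>T. openin X T \<and> x0 \<in> T \<and> T \<subseteq> topspace X \<and> continuous_map (subtopology X T) euclideanreal f"
      using AN NX by auto
  qed simp
  then have "continuous_map X euclideanreal f" by simp
  with lift that show thesis by blast
qed

text \<open>A continuous angle function of a differentiable curve on the circle is differentiable.\<close>

lemma DERIV_angle:
  fixes F :: "real \<Rightarrow> real"
  assumes "isCont F t" "((\<lambda>s. cos (F s)) has_real_derivative a) (at t)"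
    "((\<lambda>s. sin (F s)) has_real_derivative b) (at t)"
  shows "(F has_real_derivative (cos (F t) * b - sin (F t) * a)) (at t)"
proof -
  have "((\<lambda>s. sin (F s) * cos (F t) - cos (F s) * sin (F t)) has_real_derivative
      b * cos (F t) - a * sin (F t)) (at t)"
    by (intro DERIV_diff DERIV_cmult_right assms)
  then have d: "((\<lambda>s. sin (F s - F t)) has_real_derivative b * cos (F t) - a * sin (F t)) (at t)"
    by (simp add: sin_diff mult.commute)
  have "((\<lambda>s. arcsin (sin (F s - F t))) has_real_derivative
      inverse (sqrt (1 - (sin (F t - F t))\<^sup>2)) * (b * cos (F t) - a * sin (F t))) (at t)"
    by (rule DERIV_chain2[OF DERIV_arcsin d]) auto
  then have d2: "((\<lambda>s. F t + arcsin (sin (F s - F t))) has_real_derivative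
      0 + (b * cos (F t) - a * sin (F t))) (at t)"
    by (intro DERIV_add DERIV_const) simp
  have "\<forall>\<^sub>F s in nhds t. dist (F s) (F t) < pi / 2"
    using assms(1) pi_half_gt_zero
    by (intro tendstoD) (auto simp: isCont_def tendsto_at_iff_tendsto_nhds)
  then have "\<forall>\<^sub>F s in nhds t. F t + arcsin (sin (F s - F t)) = F s"
    by eventually_elim (subst arcsin_sin, auto simp: dist_real_def abs_if split: if_splits)
  then show ?thesis
    using d2 DERIV_cong_ev[OF refl] by (fastforce simp: algebra_simps)
qed

text \<open>A continuous function has the regularity of its sine and cosine, since
  \<open>df = cos f d(sin f) - sin f d(cos f)\<close>.\<close>

lemma Ck_on_angle:
  assumes S: "openin (Euclidean_space n) S"
    and f: "continuous_map (subtopology (Euclidean_space n) S) euclideanreal f"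
    and C: "Ck_on n S (Suc m) (\<lambda>u. cos (f u))" and Sn: "Ck_on n S (Suc m) (\<lambda>u. sin (f u))"
  shows "Ck_on n S (Suc m) f"
proof (rule Ck_on_SucI[OF S f])
  let ?f' = "\<lambda>i u. cos (f u) * partial i (\<lambda>u. sin (f u)) u + (-1) * (sin (f u) * partial i (\<lambda>u. cos (f u)) u)"
  show "has_partial i f (?f' i u) u" if iu: "i < n" "u \<in> S" for i u
  proof -
    have "isCont (\<lambda>t. f (u(i := t))) (u i)"
    proof -
      have "u \<in> topspace (Euclidean_space n)" using S iu openin_subset by blast
      from continuous_map_fun_upd[OF this iu(1)]
      have "continuous_map (subtopology euclideanreal {t. u(i := t) \<in> S}) (subtopology (Euclidean_space n) S) (\<lambda>t. u(i := t))"
        by (auto simp: continuous_map_in_subtopology intro: continuous_map_from_subtopology)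
      from continuous_map_compose[OF this f]
      have c: "continuous_on {t. u(i := t) \<in> S} (\<lambda>t. f (u(i := t)))" by (simp add: o_def)
      obtain T where T: "open T" "u i \<in> T" "T \<subseteq> {t. u(i := t) \<in> S}"
        using eventually_fun_upd_in[OF S iu(2,1)] unfolding eventually_nhds by blast
      show ?thesis
        using continuous_on_subset[OF c T(3)] T continuous_on_eq_continuous_at by blast
    qed
    from DERIV_angle[OF this, of "partial i (\<lambda>u. cos (f u)) u" "partial i (\<lambda>u. sin (f u)) u"]
    show ?thesis
      using Ck_on_has_partial[OF C iu] Ck_on_has_partial[OF Sn iu]
      by (simp add: has_partial_def)
  qed
  show "Ck_on n S m (?f' i)" if "i < n" for i
    by (intro Ck_on_add[OF S] Ck_on_mult[OF S] Ck_on_const Ck_on_partial[OF C that]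
        Ck_on_partial[OF Sn that] Ck_on_SucD[OF C] Ck_on_SucD[OF Sn])
qed

section \<open>Smooth functions on a manifold\<close>

lemma Cinf_on_partial: "Cinf_on n S f \<Longrightarrow> i < n \<Longrightarrow> Cinf_on n S (partial i f)"
  using Ck_on_partial by (auto simp: Cinf_on_def)

lemma Cinf_on_has_partial: "Cinf_on n S f \<Longrightarrow> i < n \<Longrightarrow> u \<in> S \<Longrightarrow> has_partial i f (partial i f u) u"
  using Ck_on_has_partial[of n S 0 f i u] by (auto simp: Cinf_on_def simp del: Ck_on.simps(1))

text \<open>A fixed smooth manifold, whose coordinates lie in the Euclidean space \<open>E\<close>.\<close>

locale smooth_mfd =
  fixes M :: "'a mfd"
  assumes smooth_manifold: "smooth_manifold M"
begin

abbreviation "E \<equiv> Euclidean_space (mdim M)"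

lemma chart_open: "(W, c) \<in> matlas M \<Longrightarrow> openin (mtop M) W"
  using smooth_manifold unfolding smooth_manifold_def by blast

lemma chart_image_open_dom: "(W, c) \<in> matlas M \<Longrightarrow> openin E (c ` W)"
  using smooth_manifold unfolding smooth_manifold_def by blast

lemma chart_homeomorphic:
  "(W, c) \<in> matlas M \<Longrightarrow>
     homeomorphic_map (subtopology (mtop M) W) (subtopology E (c ` W)) c"
  using smooth_manifold unfolding smooth_manifold_def by blast

lemma chart_transition:
  "(W, c) \<in> matlas M \<Longrightarrow> (W', c') \<in> matlas M \<Longrightarrow> i < mdim M \<Longrightarrow>
     Cinf_on (mdim M) (c ` (W \<inter> W')) (\<lambda>u. c' (inv_into W c u) i)"
  using smooth_manifold unfolding smooth_manifold_def by blast

lemma chart_ex: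
  assumes "x \<in> topspace (mtop M)"
  obtains W c where "(W, c) \<in> matlas M" "x \<in> W"
  using smooth_manifold assms unfolding smooth_manifold_def by blast

lemma chart_inj: "(W, c) \<in> matlas M \<Longrightarrow> inj_on c W"
  using homeomorphic_imp_injective_map[OF chart_homeomorphic] topspace_subtopology_openin[OF chart_open]
  by metis

lemma chart_inv [simp]: "(W, c) \<in> matlas M \<Longrightarrow> x \<in> W \<Longrightarrow> inv_into W c (c x) = x"
  by (simp add: chart_inj)

lemma chart_image_open:
  assumes "(W, c) \<in> matlas M" "openin (mtop M) V"
  shows "openin E (c ` (V \<inter> W))"
proof -
  have "openin (subtopology (mtop M) W) (V \<inter> W)"
    using assms chart_open by (auto simp: openin_open_subtopology)
  then have "openin (subtopology E (c ` W)) (c ` (V \<inter> W))"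
    using homeomorphic_imp_open_map[OF chart_homeomorphic[OF assms(1)]] unfolding open_map_def by blast
  then show ?thesis
    using openin_open_subtopology[OF chart_image_open_dom[OF assms(1)]] by blast
qed

lemma smooth_onD:
  "smooth_on M V f \<Longrightarrow> (W, c) \<in> matlas M \<Longrightarrow> Cinf_on (mdim M) (c ` (V \<inter> W)) (\<lambda>u. f (inv_into W c u))"
  unfolding smooth_on_def by blast

lemma smooth_onI:
  "(\<And>W c m. (W, c) \<in> matlas M \<Longrightarrow> Ck_on (mdim M) (c ` (V \<inter> W)) m (\<lambda>u. f (inv_into W c u))) \<Longrightarrow>
     smooth_on M V f"
  unfolding smooth_on_def Cinf_on_def by blast

lemma smooth_on_Ck:
  "smooth_on M V f \<Longrightarrow> (W, c) \<in> matlas M \<Longrightarrow> Ck_on (mdim M) (c ` (V \<inter> W)) m (\<lambda>u. f (inv_into W c u))"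
  unfolding smooth_on_def Cinf_on_def by blast

lemma smooth_on_const: "smooth_on M V (\<lambda>_. c)"
  by (rule smooth_onI) (rule Ck_on_const)

lemma smooth_on_add:
  "openin (mtop M) V \<Longrightarrow> smooth_on M V f \<Longrightarrow> smooth_on M V g \<Longrightarrow> smooth_on M V (\<lambda>x. f x + g x)"
  by (rule smooth_onI) (intro Ck_on_add chart_image_open smooth_on_Ck)

lemma smooth_on_mult:
  "openin (mtop M) V \<Longrightarrow> smooth_on M V f \<Longrightarrow> smooth_on M V g \<Longrightarrow> smooth_on M V (\<lambda>x. f x * g x)"
  by (rule smooth_onI) (intro Ck_on_mult chart_image_open smooth_on_Ck)

lemma smooth_on_pser:
  "openin (mtop M) V \<Longrightarrow> smooth_on M V f \<Longrightarrow> entire_coeffs a \<Longrightarrow> smooth_on M V (\<lambda>x. pser a (f x))"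
  by (rule smooth_onI) (intro Ck_on_pser chart_image_open smooth_on_Ck)

lemma smooth_on_cmult: "openin (mtop M) V \<Longrightarrow> smooth_on M V f \<Longrightarrow> smooth_on M V (\<lambda>x. a * f x)"
  by (rule smooth_on_mult) (auto intro: smooth_on_const)

lemma smooth_on_sum:
  "openin (mtop M) V \<Longrightarrow> (\<And>j. j \<in> J \<Longrightarrow> smooth_on M V (f j)) \<Longrightarrow> smooth_on M V (\<lambda>x. \<Sum>j\<in>J. f j x)"
  by (induction J rule: infinite_finite_induct) (auto intro: smooth_on_add smooth_on_const)

lemma smooth_on_subset: "smooth_on M V f \<Longrightarrow> V' \<subseteq> V \<Longrightarrow> smooth_on M V' f"
  by (rule smooth_onI) (erule (1) Ck_on_mono[OF smooth_on_Ck], blast)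

lemma smooth_on_cong:
  assumes "openin (mtop M) V" "\<And>x. x \<in> V \<Longrightarrow> f x = g x" "smooth_on M V f"
  shows "smooth_on M V g"
proof (rule smooth_onI)
  fix W c m assume W: "(W, c) \<in> matlas M"
  show "Ck_on (mdim M) (c ` (V \<inter> W)) m (\<lambda>u. g (inv_into W c u))"
    by (rule Ck_on_cong[OF chart_image_open[OF W assms(1)] _ smooth_on_Ck[OF assms(3) W]])
       (use assms(2) W in auto)
qed

lemma smooth_on_local:
  assumes "openin (mtop M) V"
    and "\<And>x. x \<in> V \<Longrightarrow> \<exists>N. openin (mtop M) N \<and> x \<in> N \<and> smooth_on M N f"
  shows "smooth_on M V f"
proof (rule smooth_onI)
  fix W c m assume W: "(W, c) \<in> matlas M"
  show "Ck_on (mdim M) (c ` (V \<inter> W)) m (\<lambda>u. f (inv_into W c u))"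
  proof (rule Ck_on_local[OF chart_image_open[OF W assms(1)]])
    fix u assume "u \<in> c ` (V \<inter> W)"
    then obtain x where x: "x \<in> V" "x \<in> W" "u = c x" by auto
    obtain N where N: "openin (mtop M) N" "x \<in> N" "smooth_on M N f"
      using assms(2)[OF x(1)] by auto
    have "openin (mtop M) (N \<inter> V)" using N assms(1) by auto
    then have "openin E (c ` (N \<inter> V \<inter> W))" by (rule chart_image_open[OF W])
    moreover have "Ck_on (mdim M) (c ` (N \<inter> V \<inter> W)) m (\<lambda>u. f (inv_into W c u))"
      by (rule Ck_on_mono[OF smooth_on_Ck[OF N(3) W]]) auto
    ultimately show "\<exists>T. openin E T \<and> u \<in> T \<and> T \<subseteq> c ` (V \<inter> W) \<and> Ck_on (mdim M) T m (\<lambda>u. f (inv_into W c u))"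
      using x N by (intro exI[of _ "c ` (N \<inter> V \<inter> W)"]) auto
  qed
qed

lemma chart_continuous:
  assumes W: "(W, c) \<in> matlas M" and V: "openin (mtop M) V" 
  shows "continuous_map (subtopology (mtop M) (V \<inter> W)) (subtopology E (c ` (V \<inter> W))) c"
proof -
  have "continuous_map (subtopology (mtop M) W) E c"
    using homeomorphic_imp_continuous_map[OF chart_homeomorphic[OF W]]
    by (simp add: continuous_map_in_subtopology)
  then have "continuous_map (subtopology (mtop M) (V \<inter> W)) E c"
    by (rule continuous_map_from_subtopology_mono) auto
  then show ?thesis
    by (auto simp: continuous_map_in_subtopology)
qed

lemma chart_inv_continuous:
  assumes W: "(W, c) \<in> matlas M" and V: "openin (mtop M) V" 
  shows "continuous_map (subtopology E (c ` (V \<inter> W))) (subtopology (mtop M) V) (inv_into W c)"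
proof -
  obtain g where g: "continuous_map (subtopology E (c ` W)) (subtopology (mtop M) W) g"
    "\<And>x. x \<in> W \<Longrightarrow> g (c x) = x"
    using chart_homeomorphic[OF W] topspace_subtopology_openin[OF chart_open[OF W]]
    unfolding homeomorphic_map_maps homeomorphic_maps_def by metis
  have "continuous_map (subtopology E (c ` W)) (mtop M) g"
    using g(1) by (simp add: continuous_map_in_subtopology)
  then have "continuous_map (subtopology E (c ` (V \<inter> W))) (mtop M) g"
    by (rule continuous_map_from_subtopology_mono) auto
  then have "continuous_map (subtopology E (c ` (V \<inter> W))) (mtop M) (inv_into W c)"
    by (rule continuous_map_eq) (use g(2) W in auto)
  then show ?thesis
    using W by (auto simp: continuous_map_in_subtopology)
qed

lemma smooth_on_continuous:
  assumes "openin (mtop M) V" "smooth_on M V f"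
  shows "continuous_map (subtopology (mtop M) V) euclideanreal f"
proof (rule continuous_map_locally[OF assms(1)])
  fix x assume x: "x \<in> V"
  then obtain W c where W: "(W, c) \<in> matlas M" "x \<in> W"
    using chart_ex assms(1) openin_subset by (metis subsetD)
  from continuous_map_compose[OF chart_continuous[OF W(1) assms(1)]
      Ck_on_continuous[OF smooth_on_Ck[OF assms(2) W(1), of 0]]]
  have "continuous_map (subtopology (mtop M) (V \<inter> W)) euclideanreal f"
    by (rule continuous_map_eq) (use W(1) in auto)
  moreover have "openin (mtop M) (V \<inter> W)" using assms(1) chart_open[OF W(1)] by auto
  ultimately show "\<exists>T. openin (mtop M) T \<and> x \<in> T \<and> T \<subseteq> V \<and> continuous_map (subtopology (mtop M) T) euclideanreal f"
    using x W by auto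
qed

text \<open>By the chain rule a function that is smooth in one chart is smooth.\<close>

lemma smooth_on_chart_comp:
  assumes W: "(W, c) \<in> matlas M" and V: "openin (mtop M) V" "V \<subseteq> W"
    and F: "Cinf_on (mdim M) (c ` V) F"
  shows "smooth_on M V (\<lambda>x. F (c x))"
proof (rule smooth_onI)
  fix W' c' m assume W': "(W', c') \<in> matlas M"
  show "Ck_on (mdim M) (c' ` (V \<inter> W')) m (\<lambda>u. F (c (inv_into W' c' u)))"
  proof (rule Ck_on_compose[OF chart_image_open[OF W' V(1)], where f = F and \<phi> = "\<lambda>u. c (inv_into W' c' u)"])
    show "openin E (c ` V)"
      using chart_image_open[OF W V(1)] V(2) by (simp add: Int_absorb2)
    show "Ck_on (mdim M) (c ` V) m F" using F by (simp add: Cinf_on_def)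
    show "Ck_on (mdim M) (c' ` (V \<inter> W')) m (\<lambda>u. c (inv_into W' c' u) j)" if "j < mdim M" for j
      by (rule Ck_on_mono[OF chart_transition[OF W' W that, unfolded Cinf_on_def, rule_format]])
        (use V(2) in auto)
    show "c (inv_into W' c' u) \<in> c ` V" if "u \<in> c' ` (V \<inter> W')" for u
      using that W' by auto
  qed
qed

lemma smooth_nearI: "openin (mtop M) V \<Longrightarrow> x \<in> V \<Longrightarrow> smooth_on M V f \<Longrightarrow> smooth_near M x f"
  unfolding smooth_near_def by blast

lemma smooth_near2:
  assumes "smooth_near M x f" "smooth_near M x g"
  obtains V where "openin (mtop M) V" "x \<in> V" "smooth_on M V f" "smooth_on M V g"
proof -
  obtain V V' where "openin (mtop M) V" "x \<in> V" "smooth_on M V f" "openin (mtop M) V'" "x \<in> V'" "smooth_on M V' g"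
    using assms unfolding smooth_near_def by blast
  then show thesis
    using that[of "V \<inter> V'"] smooth_on_subset[of _ _ "V \<inter> V'"] by auto
qed

lemma smooth_near_const: "x \<in> topspace (mtop M) \<Longrightarrow> smooth_near M x (\<lambda>_. c)"
  by (rule smooth_nearI[of "topspace (mtop M)"]) (auto intro: smooth_on_const)

lemma smooth_near_add: "smooth_near M x f \<Longrightarrow> smooth_near M x g \<Longrightarrow> smooth_near M x (\<lambda>y. f y + g y)"
  by (erule (1) smooth_near2) (intro smooth_nearI smooth_on_add)

lemma smooth_near_mult: "smooth_near M x f \<Longrightarrow> smooth_near M x g \<Longrightarrow> smooth_near M x (\<lambda>y. f y * g y)"
  by (erule (1) smooth_near2) (intro smooth_nearI smooth_on_mult)

lemma smooth_near_cmult: "smooth_near M x f \<Longrightarrow> smooth_near M x (\<lambda>y. a * f y)"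
  unfolding smooth_near_def using smooth_on_cmult by blast

lemma smooth_near_pser: "smooth_near M x f \<Longrightarrow> entire_coeffs a \<Longrightarrow> smooth_near M x (\<lambda>y. pser a (f y))"
  unfolding smooth_near_def using smooth_on_pser by blast

subsection \<open>Tangent vectors\<close>

lemma tangent_spaceI:
  assumes "\<And>f. \<not> smooth_near M x f \<Longrightarrow> v f = 0"
    and "\<And>f g V. smooth_near M x f \<Longrightarrow> smooth_near M x g \<Longrightarrow> openin (mtop M) V \<Longrightarrow> x \<in> V \<Longrightarrow>
           \<forall>y\<in>V. f y = g y \<Longrightarrow> v f = v g"
    and "\<And>f g a b. smooth_near M x f \<Longrightarrow> smooth_near M x g \<Longrightarrow>
           v (\<lambda>y. a * f y + b * g y) = a * v f + b * v g"
    and "\<And>f g. smooth_near M x f \<Longrightarrow> smooth_near M x g \<Longrightarrow> v (\<lambda>y. f y * g y) = f x * v g + g x * v f"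
  shows "v \<in> tangent_space M x"
  unfolding tangent_space_def
proof (intro CollectI conjI allI impI)
  show "v f = v g" if "smooth_near M x f \<and> smooth_near M x g \<and> openin (mtop M) V \<and> x \<in> V \<and> (\<forall>y\<in>V. f y = g y)"
    for f g V using that by (elim conjE) (rule assms(2))
qed (use assms(1,3,4) in auto)

lemma tangent_not_smooth: "v \<in> tangent_space M x \<Longrightarrow> \<not> smooth_near M x f \<Longrightarrow> v f = 0"
  by (simp add: tangent_space_def)

lemma tangent_cong:
  assumes "v \<in> tangent_space M x" "smooth_near M x f" "openin (mtop M) V" "x \<in> V" "\<And>y. y \<in> V \<Longrightarrow> f y = g y"
  shows "v f = v g"
proof -
  obtain V' where V': "openin (mtop M) V'" "x \<in> V'" "smooth_on M V' f"
    using assms(2) unfolding smooth_near_def by blast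
  have "smooth_on M (V \<inter> V') g"
    by (rule smooth_on_cong[of _ f]) (use assms V' smooth_on_subset[OF V'(3)] in auto)
  then have "smooth_near M x g"
    by (rule smooth_nearI[rotated 2]) (use assms V' in auto)
  then show ?thesis
    using assms unfolding tangent_space_def by blast
qed

lemma tangent_lin:
  "v \<in> tangent_space M x \<Longrightarrow> smooth_near M x f \<Longrightarrow> smooth_near M x g \<Longrightarrow>
     v (\<lambda>y. a * f y + b * g y) = a * v f + b * v g"
  unfolding tangent_space_def by blast

lemma tangent_mult:
  "v \<in> tangent_space M x \<Longrightarrow> smooth_near M x f \<Longrightarrow> smooth_near M x g \<Longrightarrow>
     v (\<lambda>y. f y * g y) = f x * v g + g x * v f"
  unfolding tangent_space_def by blast

lemma tangent_add:
  "v \<in> tangent_space M x \<Longrightarrow> smooth_near M x f \<Longrightarrow> smooth_near M x g \<Longrightarrow>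
     v (\<lambda>y. f y + g y) = v f + v g"
  using tangent_lin[of v x f g 1 1] by simp

lemma tangent_cmult:
  "v \<in> tangent_space M x \<Longrightarrow> smooth_near M x f \<Longrightarrow> v (\<lambda>y. a * f y) = a * v f"
  using tangent_lin[of v x f f a 0] by simp

lemma tangent_const:
  assumes v: "v \<in> tangent_space M x" and x: "x \<in> topspace (mtop M)"
  shows "v (\<lambda>_. c) = 0"
  using tangent_mult[OF v smooth_near_const[OF x, of 1] smooth_near_const[OF x, of 1]]
    tangent_cmult[OF v smooth_near_const[OF x, of 1], of c] by simp

text \<open>Hadamard's lemma for power series: the quotient \<open>(P(t) - P(0)) / t\<close> is again an entire
  power series, which determines the value of a derivation on \<open>P(f)\<close> where \<open>f\<close> vanishes.\<close>

lemma tangent_pser_at_0: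
  assumes v: "v \<in> tangent_space M x" and x: "x \<in> topspace (mtop M)"
    and f: "smooth_near M x f" "f x = 0" and a: "entire_coeffs a"
  shows "v (\<lambda>y. pser a (f y)) = a 1 * v f"
proof -
  define b where "b n = a (Suc n)" for n
  have b: "entire_coeffs b"
    unfolding entire_coeffs_def
  proof
    fix t :: real
    show "summable (\<lambda>n. b n * t ^ n)"
    proof (cases "t = 0")
      case False
      have "summable (\<lambda>n. a (Suc n) * t ^ Suc n)"
        using a summable_Suc_iff[of "\<lambda>n. a n * t ^ n"] by (simp add: entire_coeffs_def)
      then have "summable (\<lambda>n. a (Suc n) * t ^ Suc n / t)"
        by (rule summable_divide)
      then show ?thesis using False by (simp add: b_def)
    qed simp
  qed
  have eq: "pser a t = a 0 + t * pser b t" for t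
  proof -
    have "summable (\<lambda>n. a n * t ^ n)" "summable (\<lambda>n. b n * t ^ n)"
      using a b by (auto simp: entire_coeffs_def)
    then show ?thesis
      using suminf_split_head[of "\<lambda>n. a n * t ^ n"] suminf_mult[of "\<lambda>n. b n * t ^ n" t]
      by (simp add: pser_def b_def mult_ac)
  qed
  have pb: "smooth_near M x (\<lambda>y. pser b (f y))" by (rule smooth_near_pser[OF f(1) b])
  have "v (\<lambda>y. pser a (f y)) = v (\<lambda>y. a 0 + f y * pser b (f y))"
    by (simp add: eq)
  also have "\<dots> = v (\<lambda>y. a 0) + v (\<lambda>y. f y * pser b (f y))"
    by (rule tangent_add[OF v smooth_near_const[OF x] smooth_near_mult[OF f(1) pb]])
  also have "\<dots> = pser b 0 * v f"
    using tangent_mult[OF v f(1) pb] tangent_const[OF v x] f(2) by simp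
  also have "pser b 0 = a 1"
    unfolding pser_def b_def by (subst suminf_finite[of "{0}"]) auto
  finally show ?thesis .
qed

lemma cos_pser: "cos t = pser cos_coeff t" and sin_pser: "sin t = pser sin_coeff t"
  by (auto simp: cos_def sin_def pser_def)

lemma entire_cos: "entire_coeffs cos_coeff" and entire_sin: "entire_coeffs sin_coeff"
  using summable_norm_cancel[OF summable_norm_cos[of "_::real"]]
    summable_norm_cancel[OF summable_norm_sin[of "_::real"]]
  by (simp_all add: entire_coeffs_def)

lemma smooth_near_cos: "smooth_near M x f \<Longrightarrow> smooth_near M x (\<lambda>y. cos (f y))"
  unfolding cos_pser by (rule smooth_near_pser[OF _ entire_cos])

lemma smooth_near_sin: "smooth_near M x f \<Longrightarrow> smooth_near M x (\<lambda>y. sin (f y))"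
  unfolding sin_pser by (rule smooth_near_pser[OF _ entire_sin])

lemma smooth_on_cos: "openin (mtop M) V \<Longrightarrow> smooth_on M V f \<Longrightarrow> smooth_on M V (\<lambda>y. cos (f y))"
  unfolding cos_pser by (rule smooth_on_pser[OF _ _ entire_cos])

lemma smooth_on_sin: "openin (mtop M) V \<Longrightarrow> smooth_on M V f \<Longrightarrow> smooth_on M V (\<lambda>y. sin (f y))"
  unfolding sin_pser by (rule smooth_on_pser[OF _ _ entire_sin])

lemma tangent_cos_sin:
  assumes v: "v \<in> tangent_space M x" and x: "x \<in> topspace (mtop M)" and f: "smooth_near M x f"
  shows "v (\<lambda>y. cos (f y)) = - sin (f x) * v f" "v (\<lambda>y. sin (f y)) = cos (f x) * v f"
proof -
  \<comment> \<open>\<open>h = f - f x\<close> vanishes at \<open>x\<close>\<close>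
  define h where "h y = 1 * f y + (- f x) * 1" for y
  have h: "smooth_near M x h" "h x = 0"
    unfolding h_def by (intro smooth_near_add smooth_near_cmult smooth_near_const[OF x] f) auto
  have vh: "v h = v f"
    unfolding h_def using tangent_lin[OF v f smooth_near_const[OF x, of 1], of 1 "- f x"]
      tangent_const[OF v x] by simp
  have vc: "v (\<lambda>y. cos (h y)) = 0" and vs: "v (\<lambda>y. sin (h y)) = v f"
    unfolding cos_pser sin_pser
    using tangent_pser_at_0[OF v x h entire_cos] tangent_pser_at_0[OF v x h entire_sin] vh
    by (auto simp: cos_coeff_def sin_coeff_def)
  have fh: "f y = f x + h y" for y
    by (simp add: h_def)
  have "(\<lambda>y. cos (f y)) = (\<lambda>y. cos (f x) * cos (h y) + (- sin (f x)) * sin (h y))"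
    by (subst fh) (simp add: cos_add)
  with tangent_lin[OF v smooth_near_cos[OF h(1)] smooth_near_sin[OF h(1)], of "cos (f x)" "- sin (f x)"]
  show "v (\<lambda>y. cos (f y)) = - sin (f x) * v f" by (simp add: vc vs)
  have "(\<lambda>y. sin (f y)) = (\<lambda>y. sin (f x) * cos (h y) + cos (f x) * sin (h y))"
    by (subst fh) (simp add: sin_add)
  with tangent_lin[OF v smooth_near_cos[OF h(1)] smooth_near_sin[OF h(1)]]
  show "v (\<lambda>y. sin (f y)) = cos (f x) * v f" by (simp add: vc vs)
qed

text \<open>Tangent vectors form a linear space, which contains the coordinate vectors.\<close>

lemma tangent_space_0: "(\<lambda>f. 0) \<in> tangent_space M x"
  unfolding tangent_space_def by simp

lemma tangent_space_lincomb:
  assumes "v \<in> tangent_space M x" "w \<in> tangent_space M x"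
  shows "(\<lambda>f. a * v f + b * w f) \<in> tangent_space M x"
proof (rule tangent_spaceI)
  fix f g V assume "smooth_near M x f" "openin (mtop M) V" "x \<in> V" "\<forall>y\<in>V. f y = g y"
  then show "a * v f + b * w f = a * v g + b * w g"
    using tangent_cong[OF assms(1), of f V g] tangent_cong[OF assms(2), of f V g] by simp
next
  fix f g c d assume fg: "smooth_near M x f" "smooth_near M x g"
  show "a * v (\<lambda>y. c * f y + d * g y) + b * w (\<lambda>y. c * f y + d * g y)
      = c * (a * v f + b * w f) + d * (a * v g + b * w g)"
    using tangent_lin[OF assms(1) fg] tangent_lin[OF assms(2) fg] by (simp add: algebra_simps)
  show "a * v (\<lambda>y. f y * g y) + b * w (\<lambda>y. f y * g y)
      = f x * (a * v g + b * w g) + g x * (a * v f + b * w f)"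
    using tangent_mult[OF assms(1) fg] tangent_mult[OF assms(2) fg] by (simp add: algebra_simps)
qed (simp add: tangent_not_smooth[OF assms(1)] tangent_not_smooth[OF assms(2)])

lemma tangent_space_sum:
  "(\<And>i. i \<in> J \<Longrightarrow> X i \<in> tangent_space M x) \<Longrightarrow> (\<lambda>f. \<Sum>i\<in>J. a i * X i f) \<in> tangent_space M x"
proof (induction J rule: infinite_finite_induct)
  case (insert i J)
  then show ?case
    using tangent_space_lincomb[of "X i" x "\<lambda>f. \<Sum>i\<in>J. a i * X i f" "a i" 1] by simp
qed (auto intro: tangent_space_0)

lemma coord_vec_has_partial:
  assumes W: "(W, c) \<in> matlas M" and "x \<in> W" "i < mdim M" "smooth_near M x f"
  shows "has_partial i (\<lambda>u. f (inv_into W c u)) (coord_vec M (W, c) i x f) (c x)"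
proof -
  obtain V where V: "openin (mtop M) V" "x \<in> V" "smooth_on M V f"
    using assms(4) unfolding smooth_near_def by blast
  have "has_partial i (\<lambda>u. f (inv_into W c u)) (partial i (\<lambda>u. f (inv_into W c u)) (c x)) (c x)"
    by (rule Cinf_on_has_partial[OF smooth_onD[OF V(3) W] assms(3)]) (use V assms in auto)
  then show ?thesis
    using assms(4) by (simp add: coord_vec_def)
qed

lemma coord_vec_tangent:
  assumes W: "(W, c) \<in> matlas M" and x: "x \<in> W" and i: "i < mdim M"
  shows "coord_vec M (W, c) i x \<in> tangent_space M x"
proof -
  let ?v = "coord_vec M (W, c) i x"
  note hp = coord_vec_has_partial[OF W x i]
  have eqI: "?v f = D" if "smooth_near M x f" "has_partial i (\<lambda>u. f (inv_into W c u)) D (c x)" for f D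
    using hp[OF that(1)] that(2) has_partial_imp_partial by metis
  show ?thesis
  proof (rule tangent_spaceI)
    show "?v f = ?v g" if "smooth_near M x f" "smooth_near M x g" "openin (mtop M) V" "x \<in> V" "\<forall>y\<in>V. f y = g y" for f g V
    proof (rule eqI[OF that(1)])
      have m: "c x \<in> c ` (V \<inter> W)" using x that by auto
      have e: "f (inv_into W c u) = g (inv_into W c u)" if "u \<in> c ` (V \<inter> W)" for u
        using that \<open>\<forall>y\<in>V. f y = g y\<close> W by auto
      show "has_partial i (\<lambda>u. f (inv_into W c u)) (?v g) (c x)"
        by (rule has_partial_cong[OF chart_image_open[OF W that(3)] m i e, THEN iffD2, OF _ hp[OF that(2)]])
    qed
    show "?v (\<lambda>y. a * f y + b * g y) = a * ?v f + b * ?v g"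
      if "smooth_near M x f" "smooth_near M x g" for f g a b
    proof (rule eqI)
      show "smooth_near M x (\<lambda>y. a * f y + b * g y)"
        by (intro smooth_near_add smooth_near_cmult that)
      show "has_partial i (\<lambda>u. a * f (inv_into W c u) + b * g (inv_into W c u)) (a * ?v f + b * ?v g) (c x)"
        using hp[OF that(1)] hp[OF that(2)] unfolding has_partial_def by (intro DERIV_add DERIV_cmult)
    qed
    show "?v (\<lambda>y. f y * g y) = f x * ?v g + g x * ?v f"
      if "smooth_near M x f" "smooth_near M x g" for f g
    proof (rule eqI)
      show "smooth_near M x (\<lambda>y. f y * g y)"
        by (intro smooth_near_mult that)
      show "has_partial i (\<lambda>u. f (inv_into W c u) * g (inv_into W c u)) (f x * ?v g + g x * ?v f) (c x)"
        using DERIV_mult[OF hp[OF that(1), unfolded has_partial_def] hp[OF that(2), unfolded has_partial_def]] x W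
        unfolding has_partial_def by (simp add: algebra_simps)
    qed
    show "?v f = 0" if "\<not> smooth_near M x f" for f
      using that by (simp add: coord_vec_def)
  qed
qed

lemma const_coeff_ext_tangent:
  "(W, c) \<in> matlas M \<Longrightarrow> x \<in> W \<Longrightarrow> const_coeff_ext M (W, c) v x \<in> tangent_space M x"
  unfolding const_coeff_ext_def by (intro tangent_space_sum coord_vec_tangent) auto

lemma coord_vec_smooth:
  assumes W: "(W, c) \<in> matlas M" and i: "i < mdim M" and V: "openin (mtop M) V" and f: "smooth_on M V f"
  shows "smooth_on M (V \<inter> W) (\<lambda>x. coord_vec M (W, c) i x f)"
proof (rule smooth_on_cong)
  show "openin (mtop M) (V \<inter> W)" using V chart_open[OF W] by auto
  then show "smooth_on M (V \<inter> W) (\<lambda>x. partial i (\<lambda>u. f (inv_into W c u)) (c x))"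
    by (rule smooth_on_chart_comp[OF W _ _ Cinf_on_partial[OF smooth_onD[OF f W] i]]) auto
  show "partial i (\<lambda>u. f (inv_into W c u)) (c x) = coord_vec M (W, c) i x f" if "x \<in> V \<inter> W" for x
    using smooth_nearI[OF V _ f] that by (simp add: coord_vec_def)
qed

subsection \<open>Smooth circle-valued functions\<close>

lemma smooth_on_angle:
  assumes V: "openin (mtop M) V" and f: "continuous_map (subtopology (mtop M) V) euclideanreal f"
    and C: "smooth_on M V (\<lambda>x. cos (f x))" and S: "smooth_on M V (\<lambda>x. sin (f x))"
  shows "smooth_on M V f"
proof (rule smooth_onI)
  fix W c m assume W: "(W, c) \<in> matlas M"
  have "continuous_map (subtopology E (c ` (V \<inter> W))) euclideanreal (\<lambda>u. f (inv_into W c u))"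
    using continuous_map_compose[OF chart_inv_continuous[OF W V] f] by (simp add: o_def)
  from Ck_on_angle[OF chart_image_open[OF W V] this smooth_on_Ck[OF C W] smooth_on_Ck[OF S W]]
  show "Ck_on (mdim M) (c ` (V \<inter> W)) m (\<lambda>u. f (inv_into W c u))"
    by (rule Ck_on_SucD)
qed

lemma exp_2pi: "exp (2 * of_real pi * \<i> * of_real t) = Complex (cos (2 * pi * t)) (sin (2 * pi * t))"
  by (simp add: complex_eq_iff Re_exp Im_exp mult_ac)

lemma smooth_circle_logarithm:
  assumes V: "openin (mtop M) V" "contractible_space (subtopology (mtop M) V)"
    and g: "g \<in> circle_fns M V"
  obtains f where "smooth_on M V f" "\<And>x. x \<in> V \<Longrightarrow> g x = exp (2 * of_real pi * \<i> * of_real (f x))"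
proof -
  note top = topspace_subtopology_openin[OF V(1)]
  have g': "smooth_on M V (\<lambda>x. Re (g x))" "smooth_on M V (\<lambda>x. Im (g x))" "\<And>x. x \<in> V \<Longrightarrow> cmod (g x) = 1"
    using g by (auto simp: circle_fns_def)
  have "continuous_map (subtopology (mtop M) V) (prod_topology euclideanreal euclideanreal) (\<lambda>x. (Re (g x), Im (g x)))"
    by (subst continuous_map_pairwise)
      (use smooth_on_continuous[OF V(1) g'(1)] smooth_on_continuous[OF V(1) g'(2)] in \<open>simp add: o_def\<close>)
  then have 1: "continuous_map (subtopology (mtop M) V) (top_of_set UNIV) (\<lambda>x. (Re (g x), Im (g x)))"
    by simp
  have 2: "continuous_on UNIV (\<lambda>w. complex_of_real (fst w) + \<i> * complex_of_real (snd w))"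
    by (intro continuous_intros)
  have "continuous_map (subtopology (mtop M) V) euclidean
      (\<lambda>x. complex_of_real (Re (g x)) + \<i> * complex_of_real (Im (g x)))"
    using continuous_map_then_continuous_on[OF 1 2] unfolding fst_conv snd_conv .
  then have cg: "continuous_map (subtopology (mtop M) V) euclidean g"
    by (simp add: complex_eq[symmetric])
  obtain f where f: "continuous_map (subtopology (mtop M) V) euclideanreal f"
    "\<And>x. x \<in> V \<Longrightarrow> g x = exp (2 * of_real pi * \<i> * of_real (f x))"
    using contractible_circle_logarithm[OF V(2) cg] g'(3) unfolding top by metis
  have "smooth_on M V (\<lambda>x. 2 * pi * f x)"
  proof (rule smooth_on_angle[OF V(1)])
    show "continuous_map (subtopology (mtop M) V) euclideanreal (\<lambda>x. 2 * pi * f x)"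
      using f(1) by (intro continuous_map_real_mult) auto
    show "smooth_on M V (\<lambda>x. cos (2 * pi * f x))"
      by (rule smooth_on_cong[OF V(1) _ g'(1)]) (simp add: f(2) exp_2pi)
    show "smooth_on M V (\<lambda>x. sin (2 * pi * f x))"
      by (rule smooth_on_cong[OF V(1) _ g'(2)]) (simp add: f(2) exp_2pi)
  qed
  from smooth_on_cmult[OF V(1) this, of "1 / (2 * pi)"] have "smooth_on M V f" by simp
  with f(2) that show thesis by blast
qed

end

section \<open>Differential forms\<close>

context smooth_mfd
begin

lemma forms_outside:
  "\<omega> \<in> forms M V q \<Longrightarrow> \<not> (x \<in> V \<and> length vs = q \<and> set vs \<subseteq> tangent_space M x) \<Longrightarrow> \<omega> x vs = 0"
  unfolding forms_def mem_Collect_eq by (elim conjE) blast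

lemma forms_linear:
  "\<omega> \<in> forms M V q \<Longrightarrow> x \<in> V \<Longrightarrow> length vs = q \<Longrightarrow> set vs \<subseteq> tangent_space M x \<Longrightarrow> i < q \<Longrightarrow>
     w \<in> tangent_space M x \<Longrightarrow>
     \<omega> x (vs[i := (\<lambda>f. a * (vs ! i) f + b * w f)]) = a * \<omega> x vs + b * \<omega> x (vs[i := w])"
  unfolding forms_def mem_Collect_eq by (elim conjE) blast

lemma forms_alternating:
  "\<omega> \<in> forms M V q \<Longrightarrow> x \<in> V \<Longrightarrow> length vs = q \<Longrightarrow> set vs \<subseteq> tangent_space M x \<Longrightarrow> i < q \<Longrightarrow> j < q \<Longrightarrow>
     i \<noteq> j \<Longrightarrow> vs ! i = vs ! j \<Longrightarrow> \<omega> x vs = 0"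
  unfolding forms_def mem_Collect_eq by (elim conjE) blast

lemma forms_smooth:
  "\<omega> \<in> forms M V q \<Longrightarrow> (W, c) \<in> matlas M \<Longrightarrow> length is = q \<Longrightarrow> set is \<subseteq> {..<mdim M} \<Longrightarrow>
     smooth_on M (V \<inter> W) (\<lambda>x. \<omega> x (map (\<lambda>i. coord_vec M (W, c) i x) is))"
  unfolding forms_def mem_Collect_eq by (elim conjE) blast

lemma formsI:
  assumes "\<And>x vs. \<not> (x \<in> V \<and> length vs = q \<and> set vs \<subseteq> tangent_space M x) \<Longrightarrow> \<omega> x vs = 0"
    and "\<And>x vs i w a b. x \<in> V \<Longrightarrow> length vs = q \<Longrightarrow> set vs \<subseteq> tangent_space M x \<Longrightarrow> i < q \<Longrightarrow>
     w \<in> tangent_space M x \<Longrightarrow>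
     \<omega> x (vs[i := (\<lambda>f. a * (vs ! i) f + b * w f)]) = a * \<omega> x vs + b * \<omega> x (vs[i := w])"
    and "\<And>x vs i j. x \<in> V \<Longrightarrow> length vs = q \<Longrightarrow> set vs \<subseteq> tangent_space M x \<Longrightarrow> i < q \<Longrightarrow> j < q \<Longrightarrow>
     i \<noteq> j \<Longrightarrow> vs ! i = vs ! j \<Longrightarrow> \<omega> x vs = 0"
    and "\<And>W c is. (W, c) \<in> matlas M \<Longrightarrow> length is = q \<Longrightarrow> set is \<subseteq> {..<mdim M} \<Longrightarrow>
     smooth_on M (V \<inter> W) (\<lambda>x. \<omega> x (map (\<lambda>i. coord_vec M (W, c) i x) is))"
  shows "\<omega> \<in> forms M V q"
  unfolding forms_def mem_Collect_eq
proof (intro conjI allI ballI impI)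
  fix x vs assume "\<not> (x \<in> V \<and> length vs = q \<and> set vs \<subseteq> tangent_space M x)"
  then show "\<omega> x vs = 0" by (rule assms(1))
next
  fix x vs i w a b
  assume "x \<in> V" "length vs = q \<and> set vs \<subseteq> tangent_space M x" "i < q" "w \<in> tangent_space M x"
  then show "\<omega> x (vs[i := (\<lambda>f. a * (vs ! i) f + b * w f)]) = a * \<omega> x vs + b * \<omega> x (vs[i := w])"
    by (intro assms(2)) auto
next
  fix x vs i j
  assume "x \<in> V" "length vs = q \<and> set vs \<subseteq> tangent_space M x" "i < q" "j < q" "i \<noteq> j \<and> vs ! i = vs ! j"
  then show "\<omega> x vs = 0"
    by (intro assms(3)[of x vs i j]) auto
next
  fix C assume "C \<in> matlas M"
  then show "case C of (W, c) \<Rightarrow> \<forall>is. length is = q \<and> set is \<subseteq> {..<mdim M} \<longrightarrow>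
      smooth_on M (V \<inter> W) (\<lambda>x. \<omega> x (map (\<lambda>i. coord_vec M (W, c) i x) is))"
    by (auto intro: assms(4))
qed

lemma forms_lincomb:
  assumes V: "openin (mtop M) V" and \<omega>: "\<omega> \<in> forms M V q" and \<eta>: "\<eta> \<in> forms M V q"
  shows "(\<lambda>x vs. a * \<omega> x vs + b * \<eta> x vs) \<in> forms M V q"
proof (rule formsI)
  fix W c "is" assume "(W, c) \<in> matlas M" "length is = q" "set is \<subseteq> {..<mdim M}"
  then show "smooth_on M (V \<inter> W) (\<lambda>x. a * \<omega> x (map (\<lambda>i. coord_vec M (W, c) i x) is) +
       b * \<eta> x (map (\<lambda>i. coord_vec M (W, c) i x) is))"
    using V chart_open by (intro smooth_on_add smooth_on_cmult forms_smooth[OF \<omega>] forms_smooth[OF \<eta>]) auto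
next
  fix x vs i w c d
  assume "x \<in> V" "length vs = q" "set vs \<subseteq> tangent_space M x" "i < q" "w \<in> tangent_space M x"
  note lin = forms_linear[OF \<omega> this, of c d] forms_linear[OF \<eta> this, of c d]
  show "a * \<omega> x (vs[i := (\<lambda>f. c * (vs ! i) f + d * w f)]) + b * \<eta> x (vs[i := (\<lambda>f. c * (vs ! i) f + d * w f)])
      = c * (a * \<omega> x vs + b * \<eta> x vs) + d * (a * \<omega> x (vs[i := w]) + b * \<eta> x (vs[i := w]))"
    unfolding lin by (simp add: algebra_simps)
qed (simp_all add: forms_outside[OF \<omega>] forms_outside[OF \<eta>]
       forms_alternating[OF \<omega>] forms_alternating[OF \<eta>])

lemma forms_0: "0 \<in> forms M V q"
  by (rule formsI) (simp_all add: smooth_on_const)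

lemma forms_add:
  "openin (mtop M) V \<Longrightarrow> \<omega> \<in> forms M V q \<Longrightarrow> \<eta> \<in> forms M V q \<Longrightarrow> \<omega> + \<eta> \<in> forms M V q"
  using forms_lincomb[of V \<omega> q \<eta> 1 1] by (simp add: plus_fun_def)

lemma forms_uminus: "openin (mtop M) V \<Longrightarrow> \<omega> \<in> forms M V q \<Longrightarrow> - \<omega> \<in> forms M V q"
  using forms_lincomb[of V \<omega> q \<omega> "-1" 0] by (simp add: fun_Compl_def)

lemma forms_deg0_iff:
  assumes V: "openin (mtop M) V"
  shows "\<omega> \<in> forms M V 0 \<longleftrightarrow> (\<forall>x vs. \<not> (x \<in> V \<and> vs = []) \<longrightarrow> \<omega> x vs = 0) \<and> smooth_on M V (\<lambda>x. \<omega> x [])"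
proof
  assume \<omega>: "\<omega> \<in> forms M V 0"
  have "smooth_on M V (\<lambda>x. \<omega> x [])"
  proof (rule smooth_on_local[OF V])
    fix x assume x: "x \<in> V"
    then obtain W c where W: "(W, c) \<in> matlas M" "x \<in> W"
      using chart_ex openin_subset[OF V] by blast
    then have "openin (mtop M) (V \<inter> W)" using V chart_open by auto
    then show "\<exists>N. openin (mtop M) N \<and> x \<in> N \<and> smooth_on M N (\<lambda>x. \<omega> x [])"
      using forms_smooth[OF \<omega> W(1), of "[]"] x W(2) by auto
  qed
  then show "(\<forall>x vs. \<not> (x \<in> V \<and> vs = []) \<longrightarrow> \<omega> x vs = 0) \<and> smooth_on M V (\<lambda>x. \<omega> x [])"
    using forms_outside[OF \<omega>] by auto
next
  assume "(\<forall>x vs. \<not> (x \<in> V \<and> vs = []) \<longrightarrow> \<omega> x vs = 0) \<and> smooth_on M V (\<lambda>x. \<omega> x [])"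
  then show "\<omega> \<in> forms M V 0"
    by (intro formsI) (auto intro: smooth_on_subset)
qed

lemma forms_deg0_smooth: "openin (mtop M) V \<Longrightarrow> \<omega> \<in> forms M V 0 \<Longrightarrow> smooth_on M V (\<lambda>x. \<omega> x [])"
  by (simp add: forms_deg0_iff)

lemma restrict_form_deg0:
  "openin (mtop M) V \<Longrightarrow> openin (mtop M) V' \<Longrightarrow> V' \<subseteq> V \<Longrightarrow> \<omega> \<in> forms M V 0 \<Longrightarrow> restrict_form V' \<omega> \<in> forms M V' 0"
  by (auto simp: forms_deg0_iff restrict_form_def
      intro: smooth_on_cong[of V' "\<lambda>x. \<omega> x []"] smooth_on_subset)

subsection \<open>The exterior derivative\<close>

lemma forms_linear_sum:
  assumes \<omega>: "\<omega> \<in> forms M V q" and x: "x \<in> V" and len: "Suc (length us + length ws) = q"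
    and sub: "set us \<subseteq> tangent_space M x" "set ws \<subseteq> tangent_space M x"
    and Y: "\<And>i. i \<in> J \<Longrightarrow> Y i \<in> tangent_space M x"
  shows "\<omega> x (us @ (\<lambda>f. \<Sum>i\<in>J. a i * Y i f) # ws) = (\<Sum>i\<in>J. a i * \<omega> x (us @ Y i # ws))"
  using Y
proof (induction J rule: infinite_finite_induct)
  case (infinite J)
  then show ?case
    using forms_linear[OF \<omega> x, of "us @ (\<lambda>f. 0) # ws" "length us" "\<lambda>f. 0" 0 0] len sub tangent_space_0
    by auto
next
  case empty
  then show ?case
    using forms_linear[OF \<omega> x, of "us @ (\<lambda>f. 0) # ws" "length us" "\<lambda>f. 0" 0 0] len sub tangent_space_0
    by auto
next
  case (insert i J)
  have "(\<lambda>f. \<Sum>i\<in>J. a i * Y i f) \<in> tangent_space M x"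
    using insert.prems by (intro tangent_space_sum) auto
  from forms_linear[OF \<omega> x _ _ _ this, of "us @ Y i # ws" "length us" "a i" 1]
  show ?case using insert len sub by auto
qed

text \<open>On the domain of a chart a form is smooth on vector fields with constant coefficients;
  a constant-coefficient field is expanded into coordinate fields one argument at a time.\<close>

lemma forms_smooth_const_coeff:
  assumes V: "openin (mtop M) V" and \<omega>: "\<omega> \<in> forms M V q" and W: "(W, c) \<in> matlas M"
    and "length is + length vs = q" "set is \<subseteq> {..<mdim M}"
  shows "smooth_on M (V \<inter> W) (\<lambda>y. \<omega> y (map (\<lambda>i. coord_vec M (W, c) i y) is @
           map (\<lambda>v. const_coeff_ext M (W, c) v y) vs))"
  using assms(4,5)
proof (induction vs arbitrary: "is")
  case Nil
  then show ?case using forms_smooth[OF \<omega> W] by simp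
next
  case (Cons v vs)
  have VW: "openin (mtop M) (V \<inter> W)" using V chart_open[OF W] by auto
  let ?c = "\<lambda>y i. coord_vec M (W, c) i y" and ?e = "\<lambda>y v. const_coeff_ext M (W, c) v y"
  have "smooth_on M (V \<inter> W) (\<lambda>y. \<Sum>i<mdim M. v (\<lambda>z. c z i) * \<omega> y (map (?c y) (is @ [i]) @ map (?e y) vs))"
    using Cons.prems by (intro smooth_on_sum[OF VW] smooth_on_cmult[OF VW] Cons.IH) auto
  then show ?case
  proof (rule smooth_on_cong[OF VW, rotated])
    fix y assume y: "y \<in> V \<inter> W"
    have "\<omega> y (map (?c y) is @ (\<lambda>f. \<Sum>i<mdim M. v (\<lambda>z. c z i) * ?c y i f) # map (?e y) vs)
       = (\<Sum>i<mdim M. v (\<lambda>z. c z i) * \<omega> y (map (?c y) is @ ?c y i # map (?e y) vs))"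
      using y Cons.prems
      by (intro forms_linear_sum[OF \<omega>]) (auto intro!: coord_vec_tangent const_coeff_ext_tangent W)
    then show "(\<Sum>i<mdim M. v (\<lambda>z. c z i) * \<omega> y (map (?c y) (is @ [i]) @ map (?e y) vs)) =
        \<omega> y (map (?c y) is @ map (?e y) (v # vs))"
      by (simp add: const_coeff_ext_def)
  qed
qed

lemma omit_map: "omit j (map f xs) = map f (omit j xs)"
  by (simp add: omit_def take_map drop_map)

lemma length_omit: "j < length xs \<Longrightarrow> length (omit j xs) = length xs - 1"
  by (simp add: omit_def)

text \<open>Linearity of \<open>d\<close> needs the forms to be smooth, since a tangent vector is linear on functions that
  are smooth near the point only.\<close>

lemma ext_d_lincomb:
  assumes V: "openin (mtop M) V" and \<omega>: "\<omega> \<in> forms M V q" and \<eta>: "\<eta> \<in> forms M V q"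
  shows "ext_d M V q (\<lambda>x vs. a * \<omega> x vs + b * \<eta> x vs) = (\<lambda>x vs. a * ext_d M V q \<omega> x vs + b * ext_d M V q \<eta> x vs)"
proof (intro ext)
  fix x vs
  show "ext_d M V q (\<lambda>x vs. a * \<omega> x vs + b * \<eta> x vs) x vs = a * ext_d M V q \<omega> x vs + b * ext_d M V q \<eta> x vs"
  proof (cases "x \<in> V \<and> length vs = Suc q \<and> set vs \<subseteq> tangent_space M x")
    case True
    define C where "C = (SOME C. C \<in> matlas M \<and> x \<in> fst C)"
    have "\<exists>C. C \<in> matlas M \<and> x \<in> fst C"
      using chart_ex True openin_subset[OF V] by (metis fst_conv subsetD)
    then have C: "C \<in> matlas M" "x \<in> fst C"
      unfolding C_def by (metis (mono_tags, lifting) someI_ex)+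
    obtain W c where WC: "C = (W, c)" by (cases C)
    then have W: "(W, c) \<in> matlas M" "x \<in> W" using C by auto
    have near: "smooth_near M x (\<lambda>y. \<theta> y (omit j (map (\<lambda>v. const_coeff_ext M C v y) vs)))"
      if "\<theta> \<in> forms M V q" "j \<le> q" for \<theta> j
    proof (rule smooth_nearI)
      show "openin (mtop M) (V \<inter> W)" "x \<in> V \<inter> W" using V chart_open W True by auto
      show "smooth_on M (V \<inter> W) (\<lambda>y. \<theta> y (omit j (map (\<lambda>v. const_coeff_ext M C v y) vs)))"
        using forms_smooth_const_coeff[OF V that(1) W(1), of "[]" "omit j vs"] True that(2)
        by (simp add: WC omit_map length_omit)
    qed
    have v: "vs ! j \<in> tangent_space M x" if "j \<le> q" for j
      using True that by (auto simp: subset_iff)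
    have "ext_d M V q (\<lambda>x vs. a * \<omega> x vs + b * \<eta> x vs) x vs =
       (\<Sum>j\<le>q. (-1) ^ j * (a * (vs ! j) (\<lambda>y. \<omega> y (omit j (map (\<lambda>v. const_coeff_ext M C v y) vs)))
                        + b * (vs ! j) (\<lambda>y. \<eta> y (omit j (map (\<lambda>v. const_coeff_ext M C v y) vs)))))"
      unfolding ext_d_def C_def[symmetric] Let_def
      using True by (auto intro!: sum.cong tangent_lin[OF v near[OF \<omega>] near[OF \<eta>]])
    also have "\<dots> = a * ext_d M V q \<omega> x vs + b * ext_d M V q \<eta> x vs"
      unfolding ext_d_def C_def[symmetric] Let_def
      using True by (simp add: sum_distrib_left sum.distrib algebra_simps)
    finally show ?thesis .
  next
    case False
    then show ?thesis unfolding ext_d_def if_not_P[OF False] by simp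
  qed
qed

lemma ext_d_add:
  "openin (mtop M) V \<Longrightarrow> \<omega> \<in> forms M V q \<Longrightarrow> \<eta> \<in> forms M V q \<Longrightarrow>
     ext_d M V q (\<omega> + \<eta>) = ext_d M V q \<omega> + ext_d M V q \<eta>"
  using ext_d_lincomb[of V \<omega> q \<eta> 1 1] by (simp add: plus_fun_def)

lemma ext_d_deg0:
  "ext_d M V 0 \<omega> x vs =
     (if x \<in> V \<and> length vs = 1 \<and> set vs \<subseteq> tangent_space M x then (vs ! 0) (\<lambda>y. \<omega> y []) else 0)"
  by (auto simp: ext_d_def omit_def Let_def length_Suc_conv)

subsection \<open>The logarithmic derivative\<close>

lemma circle_fnsD:
  assumes "g \<in> circle_fns M V"
  shows "x \<in> V \<Longrightarrow> cmod (g x) = 1" "x \<notin> V \<Longrightarrow> g x = 1" "smooth_on M V (\<lambda>x. Re (g x))" "smooth_on M V (\<lambda>x. Im (g x))"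
  using assms by (auto simp: circle_fns_def)

lemma inverse_circle: "cmod z = 1 \<Longrightarrow> inverse z = cnj z"
  by (simp add: inverse_complex_def cmod_def complex_eq_iff)

lemma dlog_form_eq:
  assumes "x \<in> V" "cmod (g x) = 1" "v \<in> tangent_space M x"
  shows "dlog_form M V g x [v] = (Re (g x) * v (\<lambda>y. Im (g y)) - Im (g x) * v (\<lambda>y. Re (g y))) / (2 * pi)"
proof -
  have "Complex a b / g x = Complex a b * cnj (g x)" for a b
    using inverse_circle[OF assms(2)] by (simp add: divide_inverse del: inverse_complex.simps)
  moreover have "Re (z / (2 * of_real pi * \<i>)) = Im z / (2 * pi)" for z
    by (simp add: Re_divide power2_eq_square field_simps)
  ultimately show ?thesis
    using assms by (simp add: dlog_form_def algebra_simps)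
qed

lemma dlog_form_outside: "\<not> (x \<in> V \<and> length vs = 1 \<and> set vs \<subseteq> tangent_space M x) \<Longrightarrow> dlog_form M V g x vs = 0"
  unfolding dlog_form_def by (rule if_not_P)

lemma length_1_tangent_cases:
  obtains v where "x \<in> V" "vs = [v]" "v \<in> tangent_space M x"
  | "\<not> (x \<in> V \<and> length vs = 1 \<and> set vs \<subseteq> tangent_space M x)"
  by (cases "x \<in> V \<and> length vs = 1 \<and> set vs \<subseteq> tangent_space M x") (auto simp: length_Suc_conv)

text \<open>The circle-valued function \<open>e\<^bsup>2\<pi>\<i>\<omega>\<^esup>\<close> of a \<open>0\<close>-form \<open>\<omega>\<close>. It equals \<open>1\<close> where \<open>\<omega>\<close> has the
  default value \<open>0\<close>.\<close>

definition circle_exp :: "'a form \<Rightarrow> 'a \<Rightarrow> complex" where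
  "circle_exp \<omega> x = exp (2 * of_real pi * \<i> * of_real (\<omega> x []))"

lemma circle_exp_eq: "circle_exp \<omega> x = Complex (cos (2 * pi * \<omega> x [])) (sin (2 * pi * \<omega> x []))"
  unfolding circle_exp_def by (rule exp_2pi)

lemma circle_exp_in_circle_fns:
  assumes V: "openin (mtop M) V" and \<omega>: "\<omega> \<in> forms M V 0"
  shows "circle_exp \<omega> \<in> circle_fns M V"
  using smooth_on_cos[OF V smooth_on_cmult[OF V forms_deg0_smooth[OF V \<omega>]], of "2 * pi"]
    smooth_on_sin[OF V smooth_on_cmult[OF V forms_deg0_smooth[OF V \<omega>]], of "2 * pi"]
  by (auto simp: circle_fns_def circle_exp_eq cmod_def forms_outside[OF \<omega>] one_complex.ctr)

lemma dlog_form_circle_exp: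
  assumes V: "openin (mtop M) V" and \<omega>: "\<omega> \<in> forms M V 0"
  shows "dlog_form M V (circle_exp \<omega>) = ext_d M V 0 \<omega>"
proof (intro ext)
  fix x vs
  show "dlog_form M V (circle_exp \<omega>) x vs = ext_d M V 0 \<omega> x vs"
  proof (cases rule: length_1_tangent_cases[of x V vs])
    case (1 v)
    have xt: "x \<in> topspace (mtop M)" using 1(1) openin_subset[OF V] by auto
    have near: "smooth_near M x (\<lambda>y. \<omega> y [])"
      by (rule smooth_nearI[OF V 1(1) forms_deg0_smooth[OF V \<omega>]])
    note cs = tangent_cos_sin[OF 1(3) xt smooth_near_cmult[OF near, of "2 * pi"]]
    let ?t = "2 * pi * \<omega> x []"
    have "Re (circle_exp \<omega> x) * v (\<lambda>y. Im (circle_exp \<omega> y)) - Im (circle_exp \<omega> x) * v (\<lambda>y. Re (circle_exp \<omega> y))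
      = ((cos ?t)\<^sup>2 + (sin ?t)\<^sup>2) * (2 * pi * v (\<lambda>y. \<omega> y []))"
      unfolding circle_exp_eq complex.sel cs tangent_cmult[OF 1(3) near] by algebra
    then show ?thesis
      using 1 circle_fnsD(1)[OF circle_exp_in_circle_fns[OF V \<omega>] 1(1)]
      by (simp add: dlog_form_eq ext_d_deg0)
  next
    case 2
    show ?thesis unfolding dlog_form_outside[OF 2] ext_d_deg0 if_not_P[OF 2] ..
  qed
qed

text \<open>The exponential sequence: a smooth circle-valued function on a contractible open set has a smooth
  logarithm.\<close>

lemma circle_fns_eq_circle_exp:
  assumes V: "openin (mtop M) V" "V \<noteq> {} \<Longrightarrow> contractible_space (subtopology (mtop M) V)"
    and g: "g \<in> circle_fns M V"
  obtains \<omega> where "\<omega> \<in> forms M V 0" "g = circle_exp \<omega>"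
proof (cases "V = {}")
  case True
  then have "g = circle_exp 0"
    using circle_fnsD(2)[OF g] by (auto simp: circle_exp_def)
  then show thesis using that forms_0 by blast
next
  case False
  obtain f where f: "smooth_on M V f" "\<And>x. x \<in> V \<Longrightarrow> g x = exp (2 * of_real pi * \<i> * of_real (f x))"
    using smooth_circle_logarithm[OF V(1) V(2)[OF False] g] by blast
  define \<omega> :: "'a form" where "\<omega> x vs = (if x \<in> V \<and> vs = [] then f x else 0)" for x vs
  have "smooth_on M V (\<lambda>x. \<omega> x [])"
    by (rule smooth_on_cong[OF V(1) _ f(1)]) (simp add: \<omega>_def)
  then have "\<omega> \<in> forms M V 0"
    by (auto simp: forms_deg0_iff[OF V(1)] \<omega>_def)
  moreover have "g = circle_exp \<omega>"
    using circle_fnsD(2)[OF g] f(2) by (auto simp: circle_exp_def \<omega>_def)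
  ultimately show thesis by (rule that)
qed

lemma dlog_form_in_forms:
  assumes V: "openin (mtop M) V" and g: "g \<in> circle_fns M V"
  shows "dlog_form M V g \<in> forms M V 1"
proof (rule formsI)
  fix x vs i w a b
  assume x: "x \<in> V" and "length vs = 1" "set vs \<subseteq> tangent_space M x" "i < (1::nat)" and w: "w \<in> tangent_space M x"
  then obtain v where v: "vs = [v]" "v \<in> tangent_space M x" "i = 0"
    by (cases vs) auto
  show "dlog_form M V g x (vs[i := \<lambda>f. a * (vs ! i) f + b * w f])
      = a * dlog_form M V g x vs + b * dlog_form M V g x (vs[i := w])"
    using x w v tangent_space_lincomb[OF v(2) w, of a b] circle_fnsD(1)[OF g x]
    by (simp add: dlog_form_eq field_simps)
next
  fix W c "is" assume W: "(W, c) \<in> matlas M" and "length is = 1" "set is \<subseteq> {..<mdim M}"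
  then obtain i where i: "is = [i]" "i < mdim M" by (cases "is") auto
  have VW: "openin (mtop M) (V \<inter> W)" using V chart_open[OF W] by auto
  let ?c = "\<lambda>x. coord_vec M (W, c) i x"
  have "smooth_on M (V \<inter> W) (\<lambda>x. (1 / (2 * pi)) * (Re (g x) * ?c x (\<lambda>y. Im (g y)) + (-1) * (Im (g x) * ?c x (\<lambda>y. Re (g y)))))"
    by (intro smooth_on_cmult[OF VW] smooth_on_add[OF VW] smooth_on_mult[OF VW]
        coord_vec_smooth[OF W i(2) V] circle_fnsD[OF g] smooth_on_subset[OF circle_fnsD(3)[OF g]]
        smooth_on_subset[OF circle_fnsD(4)[OF g]]) auto
  then show "smooth_on M (V \<inter> W) (\<lambda>x. dlog_form M V g x (map (\<lambda>i. coord_vec M (W, c) i x) is))"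
    by (rule smooth_on_cong[OF VW, rotated])
       (use W i circle_fnsD(1)[OF g] in \<open>simp add: dlog_form_eq coord_vec_tangent\<close>)
qed (auto simp: dlog_form_outside)

lemma dlog_form_cong:
  assumes V: "openin (mtop M) V" and g: "g \<in> circle_fns M V" and "V' \<subseteq> V" "openin (mtop M) V'" 
    and eq: "\<And>x. x \<in> V' \<Longrightarrow> g x = g' x"
  shows "dlog_form M V' g' = restrict_form V' (dlog_form M V g)"
proof (intro ext)
  fix x vs
  show "dlog_form M V' g' x vs = restrict_form V' (dlog_form M V g) x vs"
  proof (cases rule: length_1_tangent_cases[of x V' vs])
    case (1 v)
    then have x: "x \<in> V" using assms by auto
    have "v (\<lambda>y. Re (g y)) = v (\<lambda>y. Re (g' y))" "v (\<lambda>y. Im (g y)) = v (\<lambda>y. Im (g' y))"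
      using eq by (auto intro!: tangent_cong[OF 1(3) smooth_nearI[OF V x] assms(4) 1(1)] circle_fnsD[OF g])
    then show ?thesis
      using 1 x circle_fnsD(1)[OF g x] eq by (simp add: dlog_form_eq restrict_form_def)
  next
    case 2
    then show ?thesis
      by (auto simp: dlog_form_outside restrict_form_def dlog_form_def)
  qed
qed

end

section \<open>Quotients of commutative groups\<close>

text \<open>The group of classes of the congruence given by a subgroup is the quotient by that subgroup.\<close>

lemma class_group_eq_FactGroup:
  assumes "comm_group G" "subgroup N G"
    and r: "\<And>x y. (x, y) \<in> r \<longleftrightarrow> x \<in> carrier G \<and> y \<in> carrier G \<and> x \<otimes>\<^bsub>G\<^esub> inv\<^bsub>G\<^esub> y \<in> N"
  shows "\<And>x. x \<in> carrier G \<Longrightarrow> r `` {x} = N #>\<^bsub>G\<^esub> x" and "class_group G r = G Mod N"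
proof -
  interpret comm_group G by fact
  interpret N: subgroup N G by fact
  show *: "r `` {x} = N #>\<^bsub>G\<^esub> x" if x: "x \<in> carrier G" for x
  proof -
    have "x \<otimes>\<^bsub>G\<^esub> inv\<^bsub>G\<^esub> y \<in> N \<longleftrightarrow> y \<otimes>\<^bsub>G\<^esub> inv\<^bsub>G\<^esub> x \<in> N" if y: "y \<in> carrier G" for y
    proof -
      have "inv\<^bsub>G\<^esub> (x \<otimes>\<^bsub>G\<^esub> inv\<^bsub>G\<^esub> y) = y \<otimes>\<^bsub>G\<^esub> inv\<^bsub>G\<^esub> x" "inv\<^bsub>G\<^esub> (y \<otimes>\<^bsub>G\<^esub> inv\<^bsub>G\<^esub> x) = x \<otimes>\<^bsub>G\<^esub> inv\<^bsub>G\<^esub> y"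
        using x y by (simp_all add: inv_mult_group)
      then show ?thesis
        using N.m_inv_closed by metis
    qed
    moreover have "N #>\<^bsub>G\<^esub> x \<subseteq> carrier G"
      using x by (intro r_coset_subset_G N.subset)
    ultimately show ?thesis
      using r x N.rcos_module[OF is_group x] by (auto simp: subset_iff)
  qed
  show "class_group G r = G Mod N"
    using * coset_mult_one[OF N.subset]
    by (auto simp: class_group_def FactGroup_def quotient_def RCOSETS_def)
qed

text \<open>The target \<open>K\<close> is not assumed to be a group: the multiplicative surjection \<open>F\<close> makes it one.
  As \<open>F\<close> preserves and reflects the congruences, it induces an isomorphism of the quotients.\<close>

lemma class_group_iso:
  assumes G: "comm_group G" and N: "subgroup N G"
    and r: "\<And>x y. (x, y) \<in> r \<longleftrightarrow> x \<in> carrier G \<and> y \<in> carrier G \<and> x \<otimes>\<^bsub>G\<^esub> inv\<^bsub>G\<^esub> y \<in> N"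
    and surj: "F ` carrier G = carrier K"
    and mult: "\<And>x y. x \<in> carrier G \<Longrightarrow> y \<in> carrier G \<Longrightarrow> F (x \<otimes>\<^bsub>G\<^esub> y) = F x \<otimes>\<^bsub>K\<^esub> F y"
    and one: "F \<one>\<^bsub>G\<^esub> = \<one>\<^bsub>K\<^esub>"
    and s: "s \<subseteq> carrier K \<times> carrier K"
    and rs: "\<And>x y. x \<in> carrier G \<Longrightarrow> y \<in> carrier G \<Longrightarrow> (F x, F y) \<in> s \<longleftrightarrow> (x, y) \<in> r"
  shows "group (class_group G r)" "group (class_group K s)"
    "\<exists>\<Phi>\<in>iso (class_group G r) (class_group K s). \<forall>x\<in>carrier G. \<Phi> (r `` {x}) = s `` {F x}"
proof -
  interpret comm_group G by fact
  interpret N: subgroup N G by fact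
  have F_in: "F x \<in> carrier K" if "x \<in> carrier G" for x using surj that by auto
  have F_ex: "\<exists>x\<in>carrier G. y = F x" if "y \<in> carrier K" for y using surj that by auto
  have K: "comm_group K"
  proof (rule comm_groupI)
    fix y assume "y \<in> carrier K"
    then obtain a where a: "a \<in> carrier G" "y = F a" using F_ex by blast
    show "\<one>\<^bsub>K\<^esub> \<otimes>\<^bsub>K\<^esub> y = y" using mult[OF one_closed a(1)] a one by simp
    show "\<exists>z\<in>carrier K. z \<otimes>\<^bsub>K\<^esub> y = \<one>\<^bsub>K\<^esub>"
      using mult[OF inv_closed[OF a(1)] a(1)] a one F_in by (intro bexI[of _ "F (inv\<^bsub>G\<^esub> a)"]) auto
  next
    show "\<one>\<^bsub>K\<^esub> \<in> carrier K" using F_in[OF one_closed] one by simp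
  next
    fix y z assume "y \<in> carrier K" "z \<in> carrier K"
    then obtain a b where ab: "a \<in> carrier G" "y = F a" "b \<in> carrier G" "z = F b" using F_ex by blast
    show "y \<otimes>\<^bsub>K\<^esub> z \<in> carrier K" using mult[OF ab(1,3)] ab F_in by (metis m_closed)
    show "y \<otimes>\<^bsub>K\<^esub> z = z \<otimes>\<^bsub>K\<^esub> y" using mult[OF ab(1,3)] mult[OF ab(3,1)] ab m_comm by metis
    fix w assume "w \<in> carrier K"
    then obtain c where c: "c \<in> carrier G" "w = F c" using F_ex by blast
    show "y \<otimes>\<^bsub>K\<^esub> z \<otimes>\<^bsub>K\<^esub> w = y \<otimes>\<^bsub>K\<^esub> (z \<otimes>\<^bsub>K\<^esub> w)"
      using ab c by (simp add: mult[symmetric] m_assoc)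
  qed
  interpret K: comm_group K by (fact K)
  have hom: "F \<in> hom G K" using F_in mult by (auto simp: hom_def)
  interpret F: group_hom G K F
    by (intro group_hom.intro group_hom_axioms.intro is_group K.is_group hom)
  have N': "subgroup (F ` N) K" by (rule F.subgroup_img_is_subgroup[OF N])
  have rN: "(x, \<one>\<^bsub>G\<^esub>) \<in> r \<longleftrightarrow> x \<in> N" if "x \<in> carrier G" for x using r that by simp
  have FN: "F x \<in> F ` N \<longleftrightarrow> x \<in> N" if x: "x \<in> carrier G" for x
  proof
    assume "F x \<in> F ` N"
    then obtain n where n: "n \<in> N" "F x = F n" by auto
    then have nG: "n \<in> carrier G" using N.mem_carrier by auto
    have "(n, \<one>\<^bsub>G\<^esub>) \<in> r" using rN[OF nG] n by simp
    then have "(F x, F \<one>\<^bsub>G\<^esub>) \<in> s" using rs[OF nG one_closed] n(2) by simp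
    then show "x \<in> N" using rs[OF x one_closed] rN[OF x] by simp
  qed auto
  have s': "(y, z) \<in> s \<longleftrightarrow> y \<in> carrier K \<and> z \<in> carrier K \<and> y \<otimes>\<^bsub>K\<^esub> inv\<^bsub>K\<^esub> z \<in> F ` N" for y z
  proof (cases "y \<in> carrier K \<and> z \<in> carrier K")
    case True
    then have yz: "y \<in> carrier K" "z \<in> carrier K" by auto
    obtain a where a: "a \<in> carrier G" "y = F a" using F_ex[OF yz(1)] by auto
    obtain b where b: "b \<in> carrier G" "z = F b" using F_ex[OF yz(2)] by auto
    note ab = a b
    have "y \<otimes>\<^bsub>K\<^esub> inv\<^bsub>K\<^esub> z = F (a \<otimes>\<^bsub>G\<^esub> inv\<^bsub>G\<^esub> b)"
      using ab by simp
    then show ?thesis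
      using rs[OF ab(1,3)] r[of a b] ab FN[of "a \<otimes>\<^bsub>G\<^esub> inv\<^bsub>G\<^esub> b"] True by simp
  qed (use s in auto)
  note cG = class_group_eq_FactGroup[OF G N r] and cK = class_group_eq_FactGroup[OF K N' s']
  have norm: "N \<lhd> G" "F ` N \<lhd> K"
    using N N' by (simp_all add: subgroup_imp_normal K.subgroup_imp_normal)
  show "group (class_group G r)" "group (class_group K s)"
    unfolding cG(2) cK(2) using norm by (simp_all add: normal.factorgroup_is_group)
  define h where "h x = F ` N #>\<^bsub>K\<^esub> F x" for x
  have "(\<lambda>y. F ` N #>\<^bsub>K\<^esub> y) \<in> hom K (K Mod (F ` N))"
    by (rule normal.r_coset_hom_Mod[OF norm(2)])
  then have "h \<in> hom G (K Mod (F ` N))"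
    using Group.hom_compose[OF hom] by (simp add: h_def[abs_def] comp_def)
  then interpret h: group_hom G "K Mod (F ` N)" h
    by (intro group_hom.intro group_hom_axioms.intro is_group normal.factorgroup_is_group[OF norm(2)])
  have "kernel G (K Mod (F ` N)) h = N"
  proof -
    have "h x = F ` N \<longleftrightarrow> x \<in> N" if x: "x \<in> carrier G" for x
      using K.coset_join1[OF _ F_in[OF x] N'] K.coset_join2[OF F_in[OF x] N'] FN[OF x]
        subgroup.subset[OF N'] by (auto simp: h_def)
    then show ?thesis
      using N.subset by (auto simp: kernel_def FactGroup_def)
  qed
  moreover have "h ` carrier G = carrier (K Mod (F ` N))"
    by (auto simp: h_def FactGroup_def RCOSETS_def surj[symmetric])
  ultimately have iso: "(\<lambda>X. the_elem (h ` X)) \<in> iso (class_group G r) (class_group K s)"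
    using h.FactGroup_iso_set unfolding cG(2) cK(2) by simp
  have "the_elem (h ` (r `` {x})) = s `` {F x}" if x: "x \<in> carrier G" for x
  proof -
    have "h ` (N #>\<^bsub>G\<^esub> x) = {h x}"
    proof -
      have "h (n \<otimes>\<^bsub>G\<^esub> x) = h x" if "n \<in> N" for n
      proof -
        have n: "n \<in> carrier G" using that N.mem_carrier by auto
        have "h (n \<otimes>\<^bsub>G\<^esub> x) = (F ` N #>\<^bsub>K\<^esub> F n) #>\<^bsub>K\<^esub> F x"
          using n x by (simp add: h_def K.coset_mult_assoc subgroup.subset[OF N'])
        also have "F ` N #>\<^bsub>K\<^esub> F n = F ` N"
          using that n by (intro K.coset_join2[OF _ N']) auto
        finally show ?thesis by (simp add: h_def)
      qed
      then have "h y = h x" if "y \<in> N #>\<^bsub>G\<^esub> x" for y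
        using that by (auto simp: r_coset_def)
      moreover have "x \<in> N #>\<^bsub>G\<^esub> x" by (rule rcos_self[OF x N])
      ultimately show ?thesis by blast
    qed
    then show ?thesis by (simp add: cG(1)[OF x] cK(1)[OF F_in[OF x]] h_def)
  qed
  then show "\<exists>\<Phi>\<in>iso (class_group G r) (class_group K s). \<forall>x\<in>carrier G. \<Phi> (r `` {x}) = s `` {F x}"
    by (intro bexI[OF _ iso] ballI)
qed

section \<open>Cech cochains\<close>

lemma signed_0 [simp]: "signed 0 A = A"
  by (simp add: signed_def)

lemma signed_Suc_0 [simp]: "signed (Suc 0) A = - A"
  by (simp add: signed_def fun_eq_iff)

lemma signed_zero [simp]: "signed m 0 = 0"
  by (simp add: signed_def fun_eq_iff)

lemma signed_add: "signed m (A + B) = signed m A + signed m B"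
  by (simp add: signed_def fun_eq_iff algebra_simps)

lemma cech_zero [simp]: "cech I U p 0 = 0"
  by (simp add: cech_def restrict_form_def fun_eq_iff)

lemma cech_add: "cech I U p (A + B) = cech I U p A + cech I U p B"
  by (auto simp: cech_def restrict_form_def fun_eq_iff algebra_simps sum.distrib)

lemma global_cochain_add: "global_cochain I U (\<phi> + \<psi>) = global_cochain I U \<phi> + global_cochain I U \<psi>"
  by (auto simp: global_cochain_def restrict_form_def fun_eq_iff)

lemma omit_simplex: "\<sigma> \<in> simplices I (Suc p) \<Longrightarrow> j \<le> Suc p \<Longrightarrow> omit j \<sigma> \<in> simplices I p"
  by (auto simp: simplices_def omit_def dest: in_set_takeD in_set_dropD)

lemma support_omit: "support U \<sigma> \<subseteq> support U (omit j \<sigma>)"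
  by (auto simp: support_def omit_def dest: in_set_takeD in_set_dropD)

text \<open>A smooth manifold with a covering all of whose nonempty finite intersections are contractible.\<close>

locale good_cover_mfd = smooth_mfd M for M :: "'a mfd" +
  fixes I :: "'i set" and U :: "'i \<Rightarrow> 'a set"
  assumes cover: "good_cover M I U"
begin

lemma support_open: "\<sigma> \<in> simplices I p \<Longrightarrow> openin (mtop M) (support U \<sigma>)"
  unfolding support_def simplices_def
  by (intro openin_Inter) (use cover in \<open>auto simp: good_cover_def\<close>)

lemma support_contractible:
  "\<sigma> \<in> simplices I p \<Longrightarrow> support U \<sigma> \<noteq> {} \<Longrightarrow> contractible_space (subtopology (mtop M) (support U \<sigma>))"
proof -
  assume "\<sigma> \<in> simplices I p" "support U \<sigma> \<noteq> {}"
  then have "set \<sigma> \<subseteq> I" "finite (set \<sigma>) \<and> set \<sigma> \<noteq> {} \<and> (\<Inter>i\<in>set \<sigma>. U i) \<noteq> {}"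
    by (auto simp: simplices_def support_def)
  then show ?thesis
    using cover unfolding good_cover_def support_def by simp
qed

lemma form_cochainsD: "A \<in> form_cochains M I U p q \<Longrightarrow> \<sigma> \<in> simplices I p \<Longrightarrow> A \<sigma> \<in> forms M (support U \<sigma>) q"
  and form_cochains_off: "A \<in> form_cochains M I U p q \<Longrightarrow> \<sigma> \<notin> simplices I p \<Longrightarrow> A \<sigma> = 0"
  unfolding form_cochains_def by auto

lemma form_cochains_0 [simp]: "0 \<in> form_cochains M I U p q"
  by (simp add: form_cochains_def forms_0)

lemma form_cochains_add:
  "A \<in> form_cochains M I U p q \<Longrightarrow> B \<in> form_cochains M I U p q \<Longrightarrow> A + B \<in> form_cochains M I U p q"
  by (auto simp: form_cochains_def intro: forms_add support_open)

lemma form_cochains_uminus: "A \<in> form_cochains M I U p q \<Longrightarrow> - A \<in> form_cochains M I U p q"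
  by (auto simp: form_cochains_def intro: forms_uminus support_open)

lemma form_cochains_diff:
  "A \<in> form_cochains M I U p q \<Longrightarrow> B \<in> form_cochains M I U p q \<Longrightarrow> A - B \<in> form_cochains M I U p q"
  unfolding diff_conv_add_uminus by (intro form_cochains_add form_cochains_uminus)

lemma cochain_d_add:
  "A \<in> form_cochains M I U p q \<Longrightarrow> B \<in> form_cochains M I U p q \<Longrightarrow>
     cochain_d M I U p q (A + B) = cochain_d M I U p q A + cochain_d M I U p q B"
proof (rule ext)
  fix \<sigma> assume AB: "A \<in> form_cochains M I U p q" "B \<in> form_cochains M I U p q"
  show "cochain_d M I U p q (A + B) \<sigma> = (cochain_d M I U p q A + cochain_d M I U p q B) \<sigma>"
  proof (cases "\<sigma> \<in> simplices I p")
    case True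
    from ext_d_add[OF support_open[OF this] AB[THEN form_cochainsD[OF _ this]]] True
    show ?thesis by (simp add: cochain_d_def)
  qed (simp add: cochain_d_def)
qed

lemma cochain_d_zero [simp]: "cochain_d M I U p q 0 = 0"
  using cochain_d_add[OF form_cochains_0 form_cochains_0, of p q] by simp

lemma cech_deg0:
  assumes A: "A \<in> form_cochains M I U p 0"
  shows "cech I U p A \<in> form_cochains M I U (Suc p) 0"
proof -
  have "cech I U p A \<sigma> \<in> forms M (support U \<sigma>) 0" if \<sigma>: "\<sigma> \<in> simplices I (Suc p)" for \<sigma>
  proof -
    note V = support_open[OF \<sigma>]
    have face: "restrict_form (support U \<sigma>) (A (omit j \<sigma>)) \<in> forms M (support U \<sigma>) 0" if "j \<le> Suc p" for j
      using restrict_form_deg0[OF support_open[OF omit_simplex[OF \<sigma> that]] V support_omit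
          form_cochainsD[OF A omit_simplex[OF \<sigma> that]]] .
    have "smooth_on M (support U \<sigma>)
        (\<lambda>x. \<Sum>j\<le>Suc p. (-1) ^ j * restrict_form (support U \<sigma>) (A (omit j \<sigma>)) x [])"
      by (intro smooth_on_sum[OF V] smooth_on_cmult[OF V] forms_deg0_smooth[OF V] face) simp
    then have "smooth_on M (support U \<sigma>) (\<lambda>x. cech I U p A \<sigma> x [])"
      by (rule smooth_on_cong[OF V, rotated]) (use \<sigma> in \<open>simp add: cech_def restrict_form_def\<close>)
    moreover have "cech I U p A \<sigma> x vs = 0" if "\<not> (x \<in> support U \<sigma> \<and> vs = [])" for x vs
    proof (cases "x \<in> support U \<sigma>")
      case True
      then have "A (omit j \<sigma>) x vs = 0" if "j \<le> Suc p" for j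
        using forms_outside[OF form_cochainsD[OF A omit_simplex[OF \<sigma> that]], of x vs]
          \<open>\<not> (x \<in> support U \<sigma> \<and> vs = [])\<close> by auto
      then show ?thesis by (simp add: cech_def restrict_form_def)
    qed (simp add: cech_def restrict_form_def)
    ultimately show ?thesis by (simp add: forms_deg0_iff[OF V])
  qed
  then show ?thesis by (simp add: form_cochains_def cech_def)
qed

text \<open>Smooth integer-valued functions are locally constant.\<close>

lemma int_cochains_iff:
  "R \<in> int_cochains M I U p \<longleftrightarrow> R \<in> form_cochains M I U p 0 \<and>
     (\<forall>\<sigma>\<in>simplices I p. \<forall>x\<in>support U \<sigma>. R \<sigma> x [] \<in> \<int>)"
proof -
  have "\<exists>V. openin (mtop M) V \<and> x \<in> V \<and> V \<subseteq> support U \<sigma> \<and> (\<forall>y\<in>V. R \<sigma> y [] = R \<sigma> x [])"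
    if R: "R \<in> form_cochains M I U p 0" and int: "\<forall>x\<in>support U \<sigma>. R \<sigma> x [] \<in> \<int>"
      and \<sigma>: "\<sigma> \<in> simplices I p" and x: "x \<in> support U \<sigma>" for \<sigma> x
  proof -
    note V = support_open[OF \<sigma>]
    define N where "N = {y \<in> support U \<sigma>. R \<sigma> y [] \<in> ball (R \<sigma> x []) 1}"
    have "openin (subtopology (mtop M) (support U \<sigma>)) N"
      using openin_continuous_map_preimage[OF
          smooth_on_continuous[OF V forms_deg0_smooth[OF V form_cochainsD[OF R \<sigma>]]], of "ball (R \<sigma> x []) 1"]
      unfolding topspace_subtopology_openin[OF V] N_def by simp
    then have "openin (mtop M) N" using openin_open_subtopology[OF V] by blast
    moreover have "R \<sigma> y [] = R \<sigma> x []" if "y \<in> N" for y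
    proof -
      have "R \<sigma> y [] \<in> \<int>" "R \<sigma> x [] \<in> \<int>" "\<bar>R \<sigma> y [] - R \<sigma> x []\<bar> < 1"
        using that int x by (auto simp: N_def dist_real_def)
      then show ?thesis by (auto elim!: Ints_cases)
    qed
    moreover have "x \<in> N" "N \<subseteq> support U \<sigma>" using x by (auto simp: N_def)
    ultimately show ?thesis by blast
  qed
  then show ?thesis unfolding int_cochains_def by blast
qed

lemma int_cochains_0: "0 \<in> int_cochains M I U p"
  by (simp add: int_cochains_iff)

lemma int_cochains_add:
  "R \<in> int_cochains M I U p \<Longrightarrow> S \<in> int_cochains M I U p \<Longrightarrow> R + S \<in> int_cochains M I U p"
  by (simp add: int_cochains_iff form_cochains_add)

lemma int_cochains_uminus: "R \<in> int_cochains M I U p \<Longrightarrow> - R \<in> int_cochains M I U p"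
  by (simp add: int_cochains_iff form_cochains_uminus)

subsection \<open>The exponential of a cochain of functions\<close>

text \<open>The circle-valued cochain \<open>e\<^bsup>2\<pi>\<i>A\<^esup>\<close> of a cochain \<open>A\<close> of functions.\<close>

definition cochain_exp :: "('i, 'a) fcochain \<Rightarrow> ('i, 'a) ccochain" where
  "cochain_exp A \<sigma> = circle_exp (A \<sigma>)"

lemma circle_exp_zero: "circle_exp 0 = 1"
  by (simp add: circle_exp_def fun_eq_iff)

lemma circle_exp_eq_1_iff: "circle_exp \<omega> x = 1 \<longleftrightarrow> \<omega> x [] \<in> \<int>"
proof -
  have "circle_exp \<omega> x = 1 \<longleftrightarrow> (\<exists>n::int. \<omega> x [] = of_int n)"
    unfolding circle_exp_def exp_eq_1 by (auto simp: mult_ac)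
  then show ?thesis by (auto elim!: Ints_cases)
qed

lemma circle_exp_add: "circle_exp (\<omega> + \<eta>) x = circle_exp \<omega> x * circle_exp \<eta> x"
  by (simp add: circle_exp_def exp_add algebra_simps)

lemma circle_exp_diff: "circle_exp (\<omega> - \<eta>) x = circle_exp \<omega> x / circle_exp \<eta> x"
  by (simp add: circle_exp_def exp_diff algebra_simps)

lemma cochain_exp_in_circle_cochains:
  "A \<in> form_cochains M I U p 0 \<Longrightarrow> cochain_exp A \<in> circle_cochains M I U p"
  using circle_exp_in_circle_fns[OF support_open form_cochainsD, of _ p A] form_cochains_off[of A p 0]
  by (simp add: circle_cochains_def cochain_exp_def circle_exp_zero)

lemma cochain_dlog_exp:
  "A \<in> form_cochains M I U p 0 \<Longrightarrow> cochain_dlog M I U p (cochain_exp A) = cochain_d M I U p 0 A"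
  using dlog_form_circle_exp[OF support_open form_cochainsD, of _ p A]
  by (intro ext[where f = "cochain_dlog _ _ _ _ _"]) (simp add: cochain_dlog_def cochain_d_def cochain_exp_def)

text \<open>Every circle-valued cochain is the exponential of a cochain of functions, as the supports
  of the simplices are empty or contractible.\<close>

lemma circle_cochains_eq_cochain_exp:
  assumes g: "g \<in> circle_cochains M I U p"
  obtains A where "A \<in> form_cochains M I U p 0" "g = cochain_exp A"
proof -
  have "\<exists>\<omega>. \<omega> \<in> forms M (support U \<sigma>) 0 \<and> g \<sigma> = circle_exp \<omega>" if "\<sigma> \<in> simplices I p" for \<sigma>
  proof -
    have "g \<sigma> \<in> circle_fns M (support U \<sigma>)" using g that by (simp add: circle_cochains_def)
    from circle_fns_eq_circle_exp[OF support_open[OF that] support_contractible[OF that] this]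
    show ?thesis by blast
  qed
  then obtain A where A: "\<And>\<sigma>. \<sigma> \<in> simplices I p \<Longrightarrow> A \<sigma> \<in> forms M (support U \<sigma>) 0 \<and> g \<sigma> = circle_exp (A \<sigma>)"
    by metis
  show thesis
  proof (rule that)
    show "(\<lambda>\<sigma>. if \<sigma> \<in> simplices I p then A \<sigma> else 0) \<in> form_cochains M I U p 0"
      using A by (simp add: form_cochains_def)
    show "g = cochain_exp (\<lambda>\<sigma>. if \<sigma> \<in> simplices I p then A \<sigma> else 0)"
      using A g by (auto simp: fun_eq_iff[of g] cochain_exp_def circle_exp_zero circle_cochains_def)
  qed
qed

lemma cech_mult_exp: "cech_mult I U p (cochain_exp A) = cochain_exp (cech I U p A)"
proof (intro ext)
  fix \<sigma> x
  show "cech_mult I U p (cochain_exp A) \<sigma> x = cochain_exp (cech I U p A) \<sigma> x"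
  proof (cases "\<sigma> \<in> simplices I (Suc p) \<and> x \<in> support U \<sigma>")
    case True
    let ?a = "\<lambda>j. A (omit j \<sigma>) x []"
    have "circle_exp (A (omit j \<sigma>)) x powi ((-1) ^ j) = exp (2 * of_real pi * \<i> * of_real ((-1) ^ j * ?a j))" for j
      by (cases "even j") (simp_all add: circle_exp_def exp_minus)
    then have "cech_mult I U p (cochain_exp A) \<sigma> x = (\<Prod>j\<le>Suc p. exp (2 * of_real pi * \<i> * of_real ((-1) ^ j * ?a j)))"
      using True by (simp add: cech_mult_def cochain_exp_def)
    also have "\<dots> = exp (\<Sum>j\<le>Suc p. 2 * of_real pi * \<i> * of_real ((-1) ^ j * ?a j))"
      by (simp only: exp_sum finite_atMost)
    also have "(\<Sum>j\<le>Suc p. 2 * of_real pi * \<i> * of_real ((-1) ^ j * ?a j))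
        = 2 * of_real pi * \<i> * of_real (\<Sum>j\<le>Suc p. (-1) ^ j * ?a j)"
      by (simp only: of_real_sum sum_distrib_left)
    finally show ?thesis
      using True by (simp add: cochain_exp_def[of "cech I U p A"] circle_exp_def cech_def restrict_form_def del: sum.atMost_Suc)
  next
    case False
    then show ?thesis
      by (auto simp: cech_mult_def cochain_exp_def circle_exp_def cech_def restrict_form_def)
  qed
qed

lemma cochain_exp_eq_1_iff:
  assumes A: "A \<in> form_cochains M I U p 0"
  shows "cochain_exp A = 1 \<longleftrightarrow> A \<in> int_cochains M I U p"
proof -
  have "A \<sigma> x [] = 0" if "\<not> (\<sigma> \<in> simplices I p \<and> x \<in> support U \<sigma>)" for \<sigma> x
    using that form_cochains_off[OF A, of \<sigma>] forms_outside[OF form_cochainsD[OF A, of \<sigma>], of x "[]"] by force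
  then have "(\<forall>\<sigma> x. A \<sigma> x [] \<in> \<int>) \<longleftrightarrow> A \<in> int_cochains M I U p"
    using A unfolding int_cochains_iff by (metis Ints_0)
  then show ?thesis
    by (simp add: fun_eq_iff[of _ 1] cochain_exp_def circle_exp_eq_1_iff)
qed

lemma cochain_exp_diff: "cochain_exp (A - B) = (\<lambda>\<sigma> x. cochain_exp A \<sigma> x / cochain_exp B \<sigma> x)"
  by (simp add: cochain_exp_def circle_exp_diff fun_eq_iff)

lemma cochain_exp_add: "cochain_exp (A + B) = (\<lambda>\<sigma> x. cochain_exp A \<sigma> x * cochain_exp B \<sigma> x)"
  by (simp add: cochain_exp_def circle_exp_add fun_eq_iff)

lemma cochain_exp_eq_iff:
  assumes "A \<in> form_cochains M I U p 0" "B \<in> form_cochains M I U p 0"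
  shows "cochain_exp A = cochain_exp B \<longleftrightarrow> A - B \<in> int_cochains M I U p"
proof -
  have "cochain_exp B \<sigma> x \<noteq> 0" for \<sigma> x by (simp add: cochain_exp_def circle_exp_def)
  then have "cochain_exp A = cochain_exp B \<longleftrightarrow> cochain_exp (A - B) = 1"
    by (auto simp: cochain_exp_diff fun_eq_iff[of _ 1] fun_eq_iff[of "cochain_exp A"])
  then show ?thesis
    using cochain_exp_eq_1_iff[OF form_cochains_diff[OF assms]] by simp
qed

text \<open>The curvature of a grundle of degree \<open>0\<close>: a cocycle of degree \<open>0\<close> glues to a global circle-valued
  function, and its logarithmic derivative is a global \<open>1\<close>-form.\<close>

lemma circle_cocycle_dlog_global:
  assumes g: "g \<in> circle_cochains M I U 0" and \<delta>: "cech_mult I U 0 g = 1"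
  shows "\<exists>\<phi>\<in>forms M (topspace (mtop M)) 1. cochain_dlog M I U 0 g = global_cochain I U \<phi>"
proof -
  let ?X = "topspace (mtop M)"
  have Uo: "openin (mtop M) (U i)" if "i \<in> I" for i using cover that by (auto simp: good_cover_def)
  have gi: "g [i] \<in> circle_fns M (U i)" if "i \<in> I" for i
  proof -
    have "[i] \<in> simplices I 0" "support U [i] = U i" using that by (auto simp: simplices_def support_def)
    then show ?thesis using g unfolding circle_cochains_def by fastforce
  qed
  have agree: "g [i] x = g [j] x" if "i \<in> I" "j \<in> I" "x \<in> U i" "x \<in> U j" for i j x
  proof -
    have "cech_mult I U 0 g [i, j] x = 1" using \<delta> by (simp add: fun_eq_iff)
    moreover have "[i, j] \<in> simplices I 1" "x \<in> support U [i, j]"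
      using that by (auto simp: simplices_def support_def)
    moreover have "omit 0 [i, j] = [j]" "omit 1 [i, j] = [i]" by (auto simp: omit_def)
    ultimately have "g [j] x * inverse (g [i] x) = 1"
      by (simp add: cech_mult_def atMost_Suc mult.commute)
    moreover have "g [i] x \<noteq> 0" using circle_fnsD(1)[OF gi[OF that(1)] that(3)] by auto
    ultimately show ?thesis by (simp add: field_simps)
  qed
  define G where "G x = (if x \<in> ?X then g [SOME i. i \<in> I \<and> x \<in> U i] x else 1)" for x
  have G: "G x = g [i] x" if "i \<in> I" "x \<in> U i" for i x
  proof -
    have "x \<in> ?X" using openin_subset[OF Uo[OF that(1)]] that(2) by auto
    moreover have "(SOME i. i \<in> I \<and> x \<in> U i) \<in> I \<and> x \<in> U (SOME i. i \<in> I \<and> x \<in> U i)"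
      by (rule someI[of "\<lambda>i. i \<in> I \<and> x \<in> U i" i]) (use that in simp)
    ultimately show ?thesis using agree[OF _ that(1) _ that(2)] by (simp add: G_def)
  qed
  have ex: "\<exists>i\<in>I. x \<in> U i" if "x \<in> ?X" for x
  proof -
    have "(\<Union>i\<in>I. U i) = ?X" using cover by (simp add: good_cover_def)
    then show ?thesis using that by blast
  qed
  have "smooth_on M ?X (\<lambda>x. Re (G x))" "smooth_on M ?X (\<lambda>x. Im (G x))"
  proof (rule_tac [!] smooth_on_local)
    fix x assume "x \<in> ?X"
    then obtain i where i: "i \<in> I" "x \<in> U i" using ex by blast
    have "smooth_on M (U i) (\<lambda>x. Re (G x))"
      by (rule smooth_on_cong[OF Uo[OF i(1)] _ circle_fnsD(3)[OF gi[OF i(1)]]]) (simp add: G[OF i(1)])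
    then show "\<exists>N. openin (mtop M) N \<and> x \<in> N \<and> smooth_on M N (\<lambda>x. Re (G x))" using i Uo by blast
    have "smooth_on M (U i) (\<lambda>x. Im (G x))"
      by (rule smooth_on_cong[OF Uo[OF i(1)] _ circle_fnsD(4)[OF gi[OF i(1)]]]) (simp add: G[OF i(1)])
    then show "\<exists>N. openin (mtop M) N \<and> x \<in> N \<and> smooth_on M N (\<lambda>x. Im (G x))" using i Uo by blast
  qed simp_all
  moreover have "cmod (G x) = 1" if "x \<in> ?X" for x
    using ex[OF that] G circle_fnsD(1)[OF gi] by auto
  ultimately have GX: "G \<in> circle_fns M ?X"
    by (auto simp: circle_fns_def G_def)
  have "cochain_dlog M I U 0 g \<sigma> = global_cochain I U (dlog_form M ?X G) \<sigma>" for \<sigma>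
  proof (cases "\<sigma> \<in> simplices I 0")
    case True
    then obtain i where i: "\<sigma> = [i]" "i \<in> I" by (auto simp: simplices_def length_Suc_conv)
    have "dlog_form M (U i) (g [i]) = restrict_form (U i) (dlog_form M ?X G)"
      using openin_subset[OF Uo[OF i(2)]] by (intro dlog_form_cong[OF _ GX _ Uo[OF i(2)]]) (auto simp: G[OF i(2)])
    then show ?thesis using True i by (simp add: cochain_dlog_def global_cochain_def support_def)
  qed (simp add: cochain_dlog_def global_cochain_def)
  then show ?thesis
    using dlog_form_in_forms[OF _ GX] by (intro bexI[of _ "dlog_form M ?X G"]) auto
qed

end

section \<open>Hypersparks and grundles\<close>

context good_cover_mfd
begin

lemma total_cochainsD:
  "A \<in> total_cochains M I U k \<Longrightarrow> A p q \<in> form_cochains M I U p q"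
  "A \<in> total_cochains M I U k \<Longrightarrow> p + q \<noteq> k \<Longrightarrow> A p q = 0"
  unfolding total_cochains_def by (auto split: if_splits) (metis form_cochains_0)

lemma total_cochains_0: "0 \<in> total_cochains M I U k"
  by (simp add: total_cochains_def)

lemma total_cochains_add:
  "A \<in> total_cochains M I U k \<Longrightarrow> B \<in> total_cochains M I U k \<Longrightarrow> A + B \<in> total_cochains M I U k"
  by (simp add: total_cochains_def form_cochains_add)

lemma total_cochains_uminus: "A \<in> total_cochains M I U k \<Longrightarrow> - A \<in> total_cochains M I U k"
  by (simp add: total_cochains_def form_cochains_uminus)

lemma total_D_zero: "total_D M I U 0 = 0"
  by (simp add: total_D_def fun_eq_iff[of "total_D _ _ _ _"] fun_eq_iff[of "total_D _ _ _ _ _"])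

lemma total_D_add:
  assumes "A \<in> total_cochains M I U k" "B \<in> total_cochains M I U k"
  shows "total_D M I U (A + B) = total_D M I U A + total_D M I U B"
proof (intro ext[where f = "total_D M I U _"] ext[where f = "total_D M I U _ _"])
  fix p q
  show "total_D M I U (A + B) p q = (total_D M I U A + total_D M I U B) p q"
    using cochain_d_add[OF total_cochainsD(1)[OF assms(1)] total_cochainsD(1)[OF assms(2)], of p "q - 1"]
    by (cases "p = 0"; cases "q = 0") (simp_all add: total_D_def cech_add signed_add algebra_simps)
qed

lemma total_D_uminus:
  assumes "A \<in> total_cochains M I U k"
  shows "total_D M I U (- A) = - total_D M I U A"
  using total_D_add[OF assms total_cochains_uminus[OF assms]] total_D_zero
  by (simp add: eq_neg_iff_add_eq_0 add.commute)

lemma total_D_off: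
  assumes "A \<in> total_cochains M I U k" "p + q \<noteq> Suc k"
  shows "total_D M I U A p q = 0"
proof -
  have "p \<noteq> 0 \<Longrightarrow> A (p - 1) q = 0" "q \<noteq> 0 \<Longrightarrow> A p (q - 1) = 0"
    using assms(2) by (auto intro: total_cochainsD(2)[OF assms(1)])
  then show ?thesis by (cases "p = 0"; cases "q = 0") (simp_all add: total_D_def)
qed

subsection \<open>The operator shared by grundles and gauge transformations\<close>

text \<open>The forms of a grundle of degree \<open>k\<close>: families as in \<^const>\<open>total_cochains\<close> without the
  component of bidegree \<open>(k, 0)\<close>.\<close>

definition grundle_forms :: "nat \<Rightarrow> ('i, 'a) bicochain set" where
  "grundle_forms k = {A. \<forall>p q. if p + q = k \<and> (p, q) \<noteq> (k, 0) then A p q \<in> form_cochains M I U p q else A p q = 0}"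

text \<open>The total differential of a pair \<open>(A, g)\<close> in bidegrees \<open>(p, q)\<close> with \<open>q \<ge> 1\<close>: it is
  \<^const>\<open>total_D\<close> with \<open>(1 / 2\<pi>\<i>) dg/g\<close> in place of the derivative of the absent component.\<close>

definition grundle_D :: "nat \<Rightarrow> ('i, 'a) bicochain \<Rightarrow> ('i, 'a) ccochain \<Rightarrow> ('i, 'a) bicochain" where
  "grundle_D k A g p q =
     (if p = 0 then 0 else signed q (cech I U (p - 1) (A (p - 1) q))) +
     (if p = k \<and> q = 1 then cochain_dlog M I U k g else cochain_d M I U p (q - 1) (A p (q - 1)))"

text \<open>The components of a family of degree \<open>k\<close> in bidegrees other than \<open>(k, 0)\<close>.\<close>

definition form_part :: "nat \<Rightarrow> ('i, 'a) bicochain \<Rightarrow> ('i, 'a) bicochain" where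
  "form_part k A = (\<lambda>p q. if (p, q) = (k, 0) then 0 else A p q)"

lemma hyperspark_to_grundle_eq: "hyperspark_to_grundle k A = (form_part k A, cochain_exp (A k 0))"
  by (simp add: hyperspark_to_grundle_def form_part_def cochain_exp_def[abs_def] circle_exp_def[abs_def])

lemma form_part_in_grundle_forms: "A \<in> total_cochains M I U k \<Longrightarrow> form_part k A \<in> grundle_forms k"
  by (auto simp: grundle_forms_def form_part_def intro: total_cochainsD)

lemma grundle_D_form_part:
  assumes "A \<in> total_cochains M I U k" "q \<ge> 1"
  shows "grundle_D k (form_part k A) (cochain_exp (A k 0)) p q = total_D M I U A p q"
  using assms(2) cochain_dlog_exp[OF total_cochainsD(1)[OF assms(1)], of k]
  by (auto simp: grundle_D_def total_D_def form_part_def)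

text \<open>Every pair as in the definition of grundles comes from a family with a component \<open>A\<^bsup>k,0\<^esup>\<close> by
  exponentiation of that component.\<close>

lemma lift_pair:
  assumes A: "A \<in> grundle_forms k" and g: "g \<in> circle_cochains M I U k"
  obtains B where "B \<in> total_cochains M I U k" "form_part k B = A" "cochain_exp (B k 0) = g"
proof -
  obtain C where C: "C \<in> form_cochains M I U k 0" "g = cochain_exp C"
    using circle_cochains_eq_cochain_exp[OF g] by blast
  define B where "B p q = (if (p, q) = (k, 0) then C else A p q)" for p q
  have "B \<in> total_cochains M I U k"
    using A C by (auto simp: B_def total_cochains_def grundle_forms_def)
  moreover have "form_part k B = A"
    using A by (auto simp: form_part_def B_def grundle_forms_def fun_eq_iff[of _ A] fun_eq_iff[of _ "A _"])
  ultimately show thesis using that[of B] C by (simp add: B_def)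
qed

text \<open>The integer cochain of a hyperspark is determined: it is \<open>- \<delta>A\<^bsup>k,0\<^esup>\<close>. So the hyperspark equation splits
  into integrality of \<open>\<delta>A\<^bsup>k,0\<^esup>\<close> and conditions in the bidegrees \<open>(p, q)\<close> with \<open>q \<ge> 1\<close>.\<close>

lemma hypersparks_iff:
  "A \<in> hypersparks M I U k \<longleftrightarrow> A \<in> total_cochains M I U k \<and>
     cech I U k (A k 0) \<in> int_cochains M I U (Suc k) \<and>
     (\<exists>\<phi>\<in>forms M (topspace (mtop M)) (k + 1). \<forall>p q. p + q = Suc k \<and> q \<ge> 1 \<longrightarrow>
        total_D M I U A p q = in_bidegree 0 (k + 1) (global_cochain I U \<phi>) p q)"
  (is "_ \<longleftrightarrow> ?tot \<and> ?int \<and> (\<exists>\<phi>\<in>?F. ?D \<phi>)")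
proof
  assume "A \<in> hypersparks M I U k"
  then obtain \<phi> R where t: ?tot and \<phi>: "\<phi> \<in> ?F" and R: "R \<in> int_cochains M I U (k + 1)"
    and D: "total_D M I U A = in_bidegree 0 (k + 1) (global_cochain I U \<phi>) - in_bidegree (k + 1) 0 R"
    unfolding hypersparks_def by blast
  have "total_D M I U A (Suc k) 0 = - R" unfolding D by (simp add: in_bidegree_def)
  then have "cech I U k (A k 0) = - R" by (simp add: total_D_def)
  then have ?int using R int_cochains_uminus by simp
  moreover have "?D \<phi>" unfolding D by (simp add: in_bidegree_def)
  ultimately show "?tot \<and> ?int \<and> (\<exists>\<phi>\<in>?F. ?D \<phi>)" using t \<phi> by blast
next
  assume "?tot \<and> ?int \<and> (\<exists>\<phi>\<in>?F. ?D \<phi>)"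
  then obtain \<phi> where t: ?tot and int: ?int and \<phi>: "\<phi> \<in> ?F" "?D \<phi>" by blast
  define R where "R = - cech I U k (A k 0)"
  have "total_D M I U A p q = (in_bidegree 0 (k + 1) (global_cochain I U \<phi>) - in_bidegree (k + 1) 0 R) p q" for p q
  proof (cases "p + q = Suc k")
    case True
    show ?thesis
    proof (cases "q = 0")
      case True
      then show ?thesis using \<open>p + q = Suc k\<close> by (simp add: total_D_def in_bidegree_def R_def)
    next
      case False
      then show ?thesis using \<phi>(2) True by (simp add: in_bidegree_def)
    qed
  next
    case False
    then show ?thesis using total_D_off[OF t] by (auto simp: in_bidegree_def)
  qed
  then have "total_D M I U A = in_bidegree 0 (k + 1) (global_cochain I U \<phi>) - in_bidegree (k + 1) 0 R"
    by (intro ext[where f = "total_D M I U _"] ext[where f = "total_D M I U _ _"])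
  moreover have "R \<in> int_cochains M I U (k + 1)" using int_cochains_uminus[OF int] by (simp add: R_def)
  ultimately show "A \<in> hypersparks M I U k"
    unfolding hypersparks_def using t \<phi>(1) by blast
qed

text \<open>The conditions on a grundle in terms of \<^term>\<open>grundle_D k\<close>. In degree \<open>0\<close> the right-hand side asks for
  a curvature form while the definition does not; it exists by \<open>circle_cocycle_dlog_global\<close>.\<close>

lemma grundles_iff:
  "(A, g) \<in> grundles M I U k \<longleftrightarrow> A \<in> grundle_forms k \<and> g \<in> circle_cochains M I U k \<and> cech_mult I U k g = 1 \<and>
     (\<exists>\<phi>\<in>forms M (topspace (mtop M)) (k + 1). \<forall>p q. p + q = Suc k \<and> q \<ge> 1 \<longrightarrow>
        grundle_D k A g p q = in_bidegree 0 (k + 1) (global_cochain I U \<phi>) p q)"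
proof -
  let ?F = "forms M (topspace (mtop M)) (k + 1)"
  let ?D = "\<lambda>\<phi>. \<forall>p q. p + q = Suc k \<and> q \<ge> 1 \<longrightarrow>
        grundle_D k A g p q = in_bidegree 0 (k + 1) (global_cochain I U \<phi>) p q"
  let ?C = "k \<ge> 1 \<longrightarrow>
          (\<exists>\<phi>\<in>?F. cochain_d M I U 0 k (A 0 k) = global_cochain I U \<phi>) \<and>
          (\<forall>p. 1 \<le> p \<and> p \<le> k - 1 \<longrightarrow>
             cochain_d M I U p (k - p) (A p (k - p)) +
             signed (k - p + 1) (cech I U (p - 1) (A (p - 1) (k - p + 1))) = 0) \<and>
          cochain_dlog M I U k g - cech I U (k - 1) (A (k - 1) 1) = 0"
  have "?C \<longleftrightarrow> (\<exists>\<phi>\<in>?F. ?D \<phi>)" if gc: "g \<in> circle_cochains M I U k" "cech_mult I U k g = 1"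
  proof (cases "k = 0")
    case True
    obtain \<phi> where \<phi>: "\<phi> \<in> forms M (topspace (mtop M)) 1" "cochain_dlog M I U 0 g = global_cochain I U \<phi>"
      using circle_cocycle_dlog_global[of g] gc unfolding True by blast
    have "?D \<phi>"
    proof (intro allI impI)
      fix p q assume "p + q = Suc k \<and> 1 \<le> q"
      then have "p = 0" "q = 1" using True by auto
      then show "grundle_D k A g p q = in_bidegree 0 (k + 1) (global_cochain I U \<phi>) p q"
        using \<phi>(2) True by (simp add: grundle_D_def in_bidegree_def)
    qed
    then show ?thesis using True \<phi>(1) by auto
  next
    case False
    show ?thesis
    proof
      assume ?C
      with False obtain \<phi> where \<phi>: "\<phi> \<in> ?F" "cochain_d M I U 0 k (A 0 k) = global_cochain I U \<phi>"
        and mid: "\<And>p. 1 \<le> p \<Longrightarrow> p \<le> k - 1 \<Longrightarrow> cochain_d M I U p (k - p) (A p (k - p)) +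
             signed (k - p + 1) (cech I U (p - 1) (A (p - 1) (k - p + 1))) = 0"
        and top: "cochain_dlog M I U k g - cech I U (k - 1) (A (k - 1) 1) = 0"
        by auto
      have "?D \<phi>"
      proof (intro allI impI)
        fix p q assume pq: "p + q = Suc k \<and> 1 \<le> q"
        consider "p = 0" | "p = k" | "1 \<le> p" "p \<le> k - 1" using pq by linarith
        then show "grundle_D k A g p q = in_bidegree 0 (k + 1) (global_cochain I U \<phi>) p q"
        proof cases
          case 1
          then show ?thesis using pq False \<phi>(2) by (auto simp: grundle_D_def in_bidegree_def)
        next
          case 2
          then show ?thesis using pq False top by (auto simp: grundle_D_def in_bidegree_def)
        next
          case 3
          then have "q - 1 = k - p" "q = k - p + 1" "p \<noteq> k" using pq by auto
          then show ?thesis using 3 mid[OF 3] by (simp add: grundle_D_def in_bidegree_def add.commute)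
        qed
      qed
      then show "\<exists>\<phi>\<in>?F. ?D \<phi>" using \<phi>(1) by blast
    next
      assume "\<exists>\<phi>\<in>?F. ?D \<phi>"
      then obtain \<phi> where \<phi>: "\<phi> \<in> ?F"
        and D: "\<And>p q. p + q = Suc k \<Longrightarrow> q \<ge> 1 \<Longrightarrow>
          grundle_D k A g p q = in_bidegree 0 (k + 1) (global_cochain I U \<phi>) p q"
        by blast
      have "cochain_d M I U 0 k (A 0 k) = global_cochain I U \<phi>"
        using D[of 0 "Suc k"] False by (simp add: grundle_D_def in_bidegree_def)
      moreover have "cochain_d M I U p (k - p) (A p (k - p)) +
             signed (k - p + 1) (cech I U (p - 1) (A (p - 1) (k - p + 1))) = 0" if "1 \<le> p" "p \<le> k - 1" for p
      proof -
        have "p \<noteq> k" using that by linarith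
        then show ?thesis
          using D[of p "k - p + 1"] that by (simp add: grundle_D_def in_bidegree_def add.commute)
      qed
      moreover have "cochain_dlog M I U k g - cech I U (k - 1) (A (k - 1) 1) = 0"
        using D[of k 1] False by (simp add: grundle_D_def in_bidegree_def)
      ultimately show ?C using \<phi> by blast
    qed
  qed
  then show ?thesis
    unfolding grundles_def grundle_forms_def by auto
qed

text \<open>The three kinds of conditions on a gauge transformation, and the special form that they take in
  degree \<open>1\<close>, in terms of \<^term>\<open>grundle_D (k - 1)\<close>.\<close>

lemma gauge_equiv_iff:
  assumes k: "k \<noteq> 0" and "(A, g) \<in> grundles M I U k" "(A', g') \<in> grundles M I U k"
  shows "((A, g), (A', g')) \<in> gauge_equiv M I U k \<longleftrightarrow>
     (\<exists>h\<in>circle_cochains M I U (k - 1). \<exists>B\<in>grundle_forms (k - 1).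
        (\<lambda>\<sigma> x. g \<sigma> x / g' \<sigma> x) = cech_mult I U (k - 1) h \<and>
        (\<forall>p q. p + q = k \<and> q \<ge> 1 \<longrightarrow> A p q - A' p q = grundle_D (k - 1) B h p q))"
proof -
  let ?C = "\<lambda>h B. if k = 1 then A 0 1 - A' 0 1 = cochain_dlog M I U 0 h
              else
               A 0 k - A' 0 k = cochain_d M I U 0 (k - 1) (B 0 (k - 1)) \<and>
               (\<forall>p. 1 \<le> p \<and> p \<le> k - 2 \<longrightarrow>
                  A p (k - p) - A' p (k - p) =
                    cochain_d M I U p (k - p - 1) (B p (k - p - 1)) +
                    signed (k - p) (cech I U (p - 1) (B (p - 1) (k - p)))) \<and>
               A (k - 1) 1 - A' (k - 1) 1 =
                 cochain_dlog M I U (k - 1) h - cech I U (k - 2) (B (k - 2) 1)"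
  have eq: "?C h B \<longleftrightarrow> (\<forall>p q. p + q = k \<and> q \<ge> 1 \<longrightarrow> A p q - A' p q = grundle_D (k - 1) B h p q)" for h B
  proof (cases "k = 1")
    case True
    have "p + q = k \<and> q \<ge> 1 \<longleftrightarrow> p = 0 \<and> q = 1" for p q using True by auto
    then show ?thesis using True by (simp add: grundle_D_def)
  next
    case False
    show ?thesis
    proof
      assume "?C h B"
      with False have bot: "A 0 k - A' 0 k = cochain_d M I U 0 (k - 1) (B 0 (k - 1))"
        and mid: "\<And>p. 1 \<le> p \<Longrightarrow> p \<le> k - 2 \<Longrightarrow> A p (k - p) - A' p (k - p) =
                    cochain_d M I U p (k - p - 1) (B p (k - p - 1)) +
                    signed (k - p) (cech I U (p - 1) (B (p - 1) (k - p)))"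
        and top: "A (k - 1) 1 - A' (k - 1) 1 =
                 cochain_dlog M I U (k - 1) h - cech I U (k - 2) (B (k - 2) 1)" by auto
      show "\<forall>p q. p + q = k \<and> q \<ge> 1 \<longrightarrow> A p q - A' p q = grundle_D (k - 1) B h p q"
      proof (intro allI impI)
        fix p q assume pq: "p + q = k \<and> 1 \<le> q"
        consider "p = 0" | "p = k - 1" "p \<noteq> 0" | "1 \<le> p" "p \<le> k - 2" using pq by linarith
        then show "A p q - A' p q = grundle_D (k - 1) B h p q"
        proof cases
          case 1
          then show ?thesis using pq False k bot by (auto simp: grundle_D_def)
        next
          case 2
          then have "q = 1" "p - 1 = k - 2" using pq by auto
          then show ?thesis using 2 top by (simp add: grundle_D_def)
        next
          case 3
          then have "q = k - p" "p \<noteq> k - 1" using pq by auto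
          then show ?thesis using 3 mid[OF 3] by (simp add: grundle_D_def add.commute)
        qed
      qed
    next
      assume D: "\<forall>p q. p + q = k \<and> q \<ge> 1 \<longrightarrow> A p q - A' p q = grundle_D (k - 1) B h p q"
      have "A 0 k - A' 0 k = cochain_d M I U 0 (k - 1) (B 0 (k - 1))"
        using D[rule_format, of 0 k] False k by (simp add: grundle_D_def)
      moreover have "A p (k - p) - A' p (k - p) =
                    cochain_d M I U p (k - p - 1) (B p (k - p - 1)) +
                    signed (k - p) (cech I U (p - 1) (B (p - 1) (k - p)))" if "1 \<le> p" "p \<le> k - 2" for p
      proof -
        have "p \<noteq> k - 1" using that by linarith
        then show ?thesis
          using D[rule_format, of p "k - p"] that by (simp add: grundle_D_def add.commute)
      qed
      moreover have "A (k - 1) 1 - A' (k - 1) 1 =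
                 cochain_dlog M I U (k - 1) h - cech I U (k - 2) (B (k - 2) 1)"
      proof -
        have "k - 1 - 1 = k - 2" by simp
        then show ?thesis
          using D[rule_format, of "k - 1" 1] False k by (simp add: grundle_D_def)
      qed
      ultimately show "?C h B" using False by simp
    qed
  qed
  have dom: "(\<forall>p q. if p + q = k - 1 \<and> q \<noteq> 0 then B p q \<in> form_cochains M I U p q else B p q = 0)
      \<longleftrightarrow> B \<in> grundle_forms (k - 1)" for B
  proof -
    have "p + q = k - 1 \<and> q \<noteq> 0 \<longleftrightarrow> p + q = k - 1 \<and> (p, q) \<noteq> (k - 1, 0)" for p q by auto
    then show ?thesis unfolding grundle_forms_def by simp
  qed
  show ?thesis
    unfolding gauge_equiv_def mem_Collect_eq prod.case eq dom using assms by auto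
qed

subsection \<open>The isomorphism\<close>

lemma hyperspark_iff_grundle:
  assumes A: "A \<in> total_cochains M I U k"
  shows "A \<in> hypersparks M I U k \<longleftrightarrow> hyperspark_to_grundle k A \<in> grundles M I U k"
proof -
  note Ak = total_cochainsD(1)[OF A, of k 0]
  have "cech I U k (A k 0) \<in> int_cochains M I U (Suc k) \<longleftrightarrow> cech_mult I U k (cochain_exp (A k 0)) = 1"
    unfolding cech_mult_exp cochain_exp_eq_1_iff[OF cech_deg0[OF Ak]] ..
  then show ?thesis
    unfolding hyperspark_to_grundle_eq grundles_iff hypersparks_iff
    using A form_part_in_grundle_forms[OF A] cochain_exp_in_circle_cochains[OF Ak] grundle_D_form_part[OF A]
    by auto
qed

lemma hyperspark_to_grundle_surj:
  "hyperspark_to_grundle k ` hypersparks M I U k = grundles M I U k"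
proof
  show "hyperspark_to_grundle k ` hypersparks M I U k \<subseteq> grundles M I U k"
    using hyperspark_iff_grundle hypersparks_iff by blast
  show "grundles M I U k \<subseteq> hyperspark_to_grundle k ` hypersparks M I U k"
  proof
    fix y assume y: "y \<in> grundles M I U k"
    obtain A g where Ag: "y = (A, g)" by (cases y)
    then have "A \<in> grundle_forms k" "g \<in> circle_cochains M I U k" using y grundles_iff by auto
    then obtain B where B: "B \<in> total_cochains M I U k" "form_part k B = A" "cochain_exp (B k 0) = g"
      using lift_pair by blast
    then have "y = hyperspark_to_grundle k B" by (simp add: Ag hyperspark_to_grundle_eq)
    moreover have "B \<in> hypersparks M I U k"
      using hyperspark_iff_grundle[OF B(1)] y calculation by simp
    ultimately show "y \<in> hyperspark_to_grundle k ` hypersparks M I U k" by blast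
  qed
qed

text \<open>As for hypersparks, the integer cochain is determined by the component in bidegree \<open>(k, 0)\<close>.\<close>

lemma total_D_eq_iff:
  assumes k: "k \<noteq> 0" and X: "X \<in> total_cochains M I U k" and B: "B \<in> total_cochains M I U (k - 1)"
  shows "(\<exists>S\<in>int_cochains M I U k. X = total_D M I U B + in_bidegree k 0 S) \<longleftrightarrow>
     (\<forall>p q. p + q = k \<and> q \<ge> 1 \<longrightarrow> X p q = total_D M I U B p q) \<and>
     X k 0 - cech I U (k - 1) (B (k - 1) 0) \<in> int_cochains M I U k"
  (is "?L \<longleftrightarrow> ?D \<and> ?S")
proof
  assume ?L
  then obtain S where S: "S \<in> int_cochains M I U k" "X = total_D M I U B + in_bidegree k 0 S" by blast
  have "X k 0 - cech I U (k - 1) (B (k - 1) 0) = S"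
    unfolding S(2) using k by (simp add: total_D_def in_bidegree_def)
  moreover have ?D unfolding S(2) by (simp add: in_bidegree_def)
  ultimately show "?D \<and> ?S" using S(1) by simp
next
  assume DS: "?D \<and> ?S"
  define S where "S = X k 0 - cech I U (k - 1) (B (k - 1) 0)"
  have "X p q = (total_D M I U B + in_bidegree k 0 S) p q" for p q
  proof (cases "p + q = k")
    case True
    show ?thesis
    proof (cases "q = 0")
      case True
      then show ?thesis using \<open>p + q = k\<close> k by (simp add: total_D_def in_bidegree_def S_def)
    next
      case False
      then show ?thesis using DS True by (simp add: in_bidegree_def)
    qed
  next
    case False
    then have "total_D M I U B p q = 0" using total_D_off[OF B] k by simp
    then show ?thesis using total_cochainsD(2)[OF X False] False by (auto simp: in_bidegree_def)
  qed
  then have "X = total_D M I U B + in_bidegree k 0 S" 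
    by (intro ext[where f = X] ext[where f = "X _"])
  moreover have "S \<in> int_cochains M I U k" using DS by (simp add: S_def)
  ultimately show ?L by blast
qed

text \<open>Gauge transformations \<open>(h, B)\<close> lift to families with a component \<open>B\<^bsup>k-1,0\<^esup>\<close> such that
  \<open>h = e\<^bsup>2\<pi>\<i>B\<^esup>\<close>. Under this correspondence \<open>g/g' = \<delta>h\<close> says that \<open>A\<^bsup>k,0\<^esup> - A'\<^bsup>k,0\<^esup> - \<delta>B\<^bsup>k-1,0\<^esup>\<close> is an integer
  cochain.\<close>

lemma smooth_equiv_iff_gauge_equiv:
  assumes A: "A \<in> hypersparks M I U k" and A': "A' \<in> hypersparks M I U k"
  shows "(hyperspark_to_grundle k A, hyperspark_to_grundle k A') \<in> gauge_equiv M I U k \<longleftrightarrow>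
     (A, A') \<in> smooth_equiv M I U k"
proof -
  have t: "A \<in> total_cochains M I U k" "A' \<in> total_cochains M I U k"
    using A A' hypersparks_iff by auto
  note Ak = total_cochainsD(1)[OF t(1), of k 0] total_cochainsD(1)[OF t(2), of k 0]
  have X: "A - A' \<in> total_cochains M I U k"
    using total_cochains_add[OF t(1) total_cochains_uminus[OF t(2)]] by simp
  have grd: "hyperspark_to_grundle k A \<in> grundles M I U k" "hyperspark_to_grundle k A' \<in> grundles M I U k"
    using A A' hyperspark_to_grundle_surj by auto
  show ?thesis
  proof (cases "k = 0")
    case True
    have fp: "form_part k A = 0" if "A \<in> total_cochains M I U k" for A
      using total_cochainsD(2)[OF that] True
      by (intro ext[where f = "form_part k A"] ext[where f = "form_part k A _"]) (simp add: form_part_def)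
    have "A - A' = in_bidegree 0 0 ((A - A') 0 0)"
      using total_cochainsD(2)[OF X] True
      by (intro ext[where f = "A - A'"] ext[where f = "(A - A') _"]) (simp add: in_bidegree_def)
    then have "(\<exists>S\<in>int_cochains M I U 0. A - A' = in_bidegree 0 0 S) \<longleftrightarrow> (A - A') 0 0 \<in> int_cochains M I U 0"
      by (metis in_bidegree_def)
    then have "(A, A') \<in> smooth_equiv M I U k \<longleftrightarrow> A 0 0 - A' 0 0 \<in> int_cochains M I U 0"
      using True A A' by (simp add: smooth_equiv_def total_D_zero)
    moreover have "(hyperspark_to_grundle k A, hyperspark_to_grundle k A') \<in> gauge_equiv M I U k \<longleftrightarrow>
        cochain_exp (A 0 0) = cochain_exp (A' 0 0)"
      using True grd fp[OF t(1)] fp[OF t(2)] by (auto simp: gauge_equiv_def hyperspark_to_grundle_eq)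
    ultimately show ?thesis using cochain_exp_eq_iff[OF Ak] True by simp
  next
    case False
    let ?R = "\<lambda>h B. (\<lambda>\<sigma> x. cochain_exp (A k 0) \<sigma> x / cochain_exp (A' k 0) \<sigma> x) = cech_mult I U (k - 1) h \<and>
        (\<forall>p q. p + q = k \<and> q \<ge> 1 \<longrightarrow> form_part k A p q - form_part k A' p q = grundle_D (k - 1) B h p q)"
    have iff: "?R (cochain_exp (B (k - 1) 0)) (form_part (k - 1) B) \<longleftrightarrow>
        (\<exists>S\<in>int_cochains M I U k. A - A' = total_D M I U B + in_bidegree k 0 S)"
      if B: "B \<in> total_cochains M I U (k - 1)" for B
    proof -
      have "cech I U (k - 1) (B (k - 1) 0) \<in> form_cochains M I U k 0"
        using cech_deg0[OF total_cochainsD(1)[OF B, of "k - 1" 0]] False by simp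
      then have "(\<lambda>\<sigma> x. cochain_exp (A k 0) \<sigma> x / cochain_exp (A' k 0) \<sigma> x) = cech_mult I U (k - 1) (cochain_exp (B (k - 1) 0))
        \<longleftrightarrow> (A - A') k 0 - cech I U (k - 1) (B (k - 1) 0) \<in> int_cochains M I U k"
        unfolding cech_mult_exp cochain_exp_diff[symmetric]
        using cochain_exp_eq_iff[OF total_cochainsD(1)[OF X, of k 0]] by simp
      moreover have "form_part k A p q - form_part k A' p q = grundle_D (k - 1) (form_part (k - 1) B) (cochain_exp (B (k - 1) 0)) p q
        \<longleftrightarrow> (A - A') p q = total_D M I U B p q" if "q \<ge> 1" for p q
        using grundle_D_form_part[OF B that] that by (simp add: form_part_def)
      ultimately show ?thesis
        unfolding total_D_eq_iff[OF False X B] by auto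
    qed
    have "(hyperspark_to_grundle k A, hyperspark_to_grundle k A') \<in> gauge_equiv M I U k \<longleftrightarrow>
        (\<exists>h\<in>circle_cochains M I U (k - 1). \<exists>B\<in>grundle_forms (k - 1). ?R h B)"
      using gauge_equiv_iff[OF False] grd unfolding hyperspark_to_grundle_eq by blast
    also have "\<dots> \<longleftrightarrow> (\<exists>B\<in>total_cochains M I U (k - 1). ?R (cochain_exp (B (k - 1) 0)) (form_part (k - 1) B))"
    proof
      assume "\<exists>h\<in>circle_cochains M I U (k - 1). \<exists>B\<in>grundle_forms (k - 1). ?R h B"
      then obtain h B where hB: "h \<in> circle_cochains M I U (k - 1)" "B \<in> grundle_forms (k - 1)" "?R h B" by blast
      obtain C where C: "C \<in> total_cochains M I U (k - 1)" "form_part (k - 1) C = B" "cochain_exp (C (k - 1) 0) = h"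
        using lift_pair[OF hB(2,1)] by blast
      have "?R (cochain_exp (C (k - 1) 0)) (form_part (k - 1) C)"
        unfolding C(2,3) by (rule hB(3))
      then show "\<exists>B\<in>total_cochains M I U (k - 1). ?R (cochain_exp (B (k - 1) 0)) (form_part (k - 1) B)"
        using C(1) by blast
    next
      assume "\<exists>B\<in>total_cochains M I U (k - 1). ?R (cochain_exp (B (k - 1) 0)) (form_part (k - 1) B)"
      then obtain B where B: "B \<in> total_cochains M I U (k - 1)" "?R (cochain_exp (B (k - 1) 0)) (form_part (k - 1) B)"
        by blast
      show "\<exists>h\<in>circle_cochains M I U (k - 1). \<exists>B\<in>grundle_forms (k - 1). ?R h B"
      proof (rule bexI[where x = "cochain_exp (B (k - 1) 0)"], rule bexI[where x = "form_part (k - 1) B"])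
        show "?R (cochain_exp (B (k - 1) 0)) (form_part (k - 1) B)" by (rule B(2))
        show "form_part (k - 1) B \<in> grundle_forms (k - 1)" by (rule form_part_in_grundle_forms[OF B(1)])
        show "cochain_exp (B (k - 1) 0) \<in> circle_cochains M I U (k - 1)"
          by (rule cochain_exp_in_circle_cochains[OF total_cochainsD(1)[OF B(1)]])
      qed
    qed
    also have "\<dots> \<longleftrightarrow> (\<exists>B\<in>total_cochains M I U (k - 1).
        \<exists>S\<in>int_cochains M I U k. A - A' = total_D M I U B + in_bidegree k 0 S)"
      by (rule bex_cong[OF refl iff])
    also have "\<dots> \<longleftrightarrow> (A, A') \<in> smooth_equiv M I U k"
      using False A A' by (simp add: smooth_equiv_def)
    finally show ?thesis .
  qed
qed

lemma in_bidegree_add: "in_bidegree p q (A + B) = in_bidegree p q A + in_bidegree p q B"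
  by (simp add: in_bidegree_def fun_eq_iff)

lemma in_bidegree_uminus: "in_bidegree p q (- A) = - in_bidegree p q A"
  by (simp add: in_bidegree_def fun_eq_iff)

lemma global_cochain_zero: "global_cochain I U 0 = 0"
  by (simp add: global_cochain_def restrict_form_def fun_eq_iff)

lemma global_cochain_uminus: "global_cochain I U (- \<phi>) = - global_cochain I U \<phi>"
  by (simp add: global_cochain_def restrict_form_def fun_eq_iff)

lemma hypersparks_0: "0 \<in> hypersparks M I U k"
  using total_cochains_0 forms_0 int_cochains_0
  by (auto simp: hypersparks_iff total_D_zero in_bidegree_def global_cochain_zero intro!: bexI[of _ 0])

lemma hypersparks_add:
  assumes "A \<in> hypersparks M I U k" "B \<in> hypersparks M I U k"
  shows "A + B \<in> hypersparks M I U k"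
proof -
  obtain \<phi> R where A: "A \<in> total_cochains M I U k" "\<phi> \<in> forms M (topspace (mtop M)) (k + 1)" "R \<in> int_cochains M I U (k + 1)"
    "total_D M I U A = in_bidegree 0 (k + 1) (global_cochain I U \<phi>) - in_bidegree (k + 1) 0 R"
    using assms(1) unfolding hypersparks_def by blast
  obtain \<psi> S where B: "B \<in> total_cochains M I U k" "\<psi> \<in> forms M (topspace (mtop M)) (k + 1)" "S \<in> int_cochains M I U (k + 1)"
    "total_D M I U B = in_bidegree 0 (k + 1) (global_cochain I U \<psi>) - in_bidegree (k + 1) 0 S"
    using assms(2) unfolding hypersparks_def by blast
  have "total_D M I U (A + B) = in_bidegree 0 (k + 1) (global_cochain I U (\<phi> + \<psi>)) - in_bidegree (k + 1) 0 (R + S)"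
    unfolding total_D_add[OF A(1) B(1)] A(4) B(4) global_cochain_add in_bidegree_add by simp
  then show ?thesis
    unfolding hypersparks_def
    using total_cochains_add[OF A(1) B(1)] forms_add[OF openin_topspace A(2) B(2)] int_cochains_add[OF A(3) B(3)]
    by blast
qed

lemma hypersparks_uminus:
  assumes "A \<in> hypersparks M I U k"
  shows "- A \<in> hypersparks M I U k"
proof -
  obtain \<phi> R where A: "A \<in> total_cochains M I U k" "\<phi> \<in> forms M (topspace (mtop M)) (k + 1)" "R \<in> int_cochains M I U (k + 1)"
    "total_D M I U A = in_bidegree 0 (k + 1) (global_cochain I U \<phi>) - in_bidegree (k + 1) 0 R"
    using assms(1) unfolding hypersparks_def by blast
  have "total_D M I U (- A) = in_bidegree 0 (k + 1) (global_cochain I U (- \<phi>)) - in_bidegree (k + 1) 0 (- R)"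
    unfolding total_D_uminus[OF A(1)] A(4) global_cochain_uminus in_bidegree_uminus by simp
  then show ?thesis
    unfolding hypersparks_def
    using total_cochains_uminus[OF A(1)] forms_uminus[OF openin_topspace A(2)] int_cochains_uminus[OF A(3)]
    by blast
qed

lemma comm_group_hypersparks: "comm_group (hyperspark_group M I U k)"
proof (rule comm_groupI)
  fix A assume "A \<in> carrier (hyperspark_group M I U k)"
  then show "\<exists>B\<in>carrier (hyperspark_group M I U k). B \<otimes>\<^bsub>hyperspark_group M I U k\<^esub> A = \<one>\<^bsub>hyperspark_group M I U k\<^esub>"
    by (intro bexI[of _ "- A"]) (auto simp: hyperspark_group_def intro: hypersparks_uminus)
qed (simp_all add: hyperspark_group_def hypersparks_0 hypersparks_add add.assoc add.commute)

lemma hyperspark_group_inv: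
  assumes "A \<in> hypersparks M I U k"
  shows "inv\<^bsub>hyperspark_group M I U k\<^esub> A = - A"
proof -
  interpret comm_group "hyperspark_group M I U k" by (rule comm_group_hypersparks)
  show ?thesis
    by (rule inv_equality) (use assms hypersparks_uminus in \<open>simp_all add: hyperspark_group_def\<close>)
qed

text \<open>The hypersparks equivalent to \<open>0\<close>. In degree \<open>0\<close> there is no \<open>B\<close>, which is rendered by \<open>B = 0\<close>.\<close>

definition trivial_hypersparks :: "nat \<Rightarrow> ('i, 'a) bicochain set" where
  "trivial_hypersparks k = {A \<in> hypersparks M I U k.
     \<exists>B\<in>(if k = 0 then {0} else total_cochains M I U (k - 1)).
     \<exists>S\<in>int_cochains M I U k. A = total_D M I U B + in_bidegree k 0 S}"

lemma subgroup_trivial_hypersparks: "subgroup (trivial_hypersparks k) (hyperspark_group M I U k)"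
proof -
  interpret comm_group "hyperspark_group M I U k" by (rule comm_group_hypersparks)
  let ?B = "if k = 0 then {0} else total_cochains M I U (k - 1)"
  have B: "B \<in> total_cochains M I U (k - 1)" if "B \<in> ?B" for B
    using that total_cochains_0 by (auto split: if_splits)
  have Badd: "B + C \<in> ?B" if "B \<in> ?B" "C \<in> ?B" for B C
    using that total_cochains_add by (auto split: if_splits)
  have Bneg: "- B \<in> ?B" if "B \<in> ?B" for B
    using that total_cochains_uminus by (auto split: if_splits)
  show ?thesis
  proof (rule subgroupI)
    show "trivial_hypersparks k \<subseteq> carrier (hyperspark_group M I U k)"
      by (auto simp: trivial_hypersparks_def hyperspark_group_def)
    have "0 \<in> ?B" using total_cochains_0 by simp
    moreover have "0 = total_D M I U 0 + in_bidegree k 0 0"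
      by (simp add: total_D_zero in_bidegree_def fun_eq_iff)
    ultimately have "0 \<in> trivial_hypersparks k"
      unfolding trivial_hypersparks_def using hypersparks_0 int_cochains_0 by blast
    then show "trivial_hypersparks k \<noteq> {}" by blast
  next
    fix A assume A: "A \<in> trivial_hypersparks k"
    then obtain B S where BS: "A \<in> hypersparks M I U k" "B \<in> ?B" "S \<in> int_cochains M I U k"
        "A = total_D M I U B + in_bidegree k 0 S"
      unfolding trivial_hypersparks_def by blast
    have "- A = total_D M I U (- B) + in_bidegree k 0 (- S)"
      unfolding total_D_uminus[OF B[OF BS(2)]] BS(4) in_bidegree_uminus by simp
    then have "- A \<in> trivial_hypersparks k"
      unfolding trivial_hypersparks_def using hypersparks_uminus[OF BS(1)] Bneg[OF BS(2)] int_cochains_uminus[OF BS(3)]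
      by blast
    then show "inv\<^bsub>hyperspark_group M I U k\<^esub> A \<in> trivial_hypersparks k"
      by (simp add: hyperspark_group_inv[OF BS(1)])
  next
    fix A A' assume "A \<in> trivial_hypersparks k" "A' \<in> trivial_hypersparks k"
    then obtain B S B' S' where BS: "A \<in> hypersparks M I U k" "B \<in> ?B" "S \<in> int_cochains M I U k"
        "A = total_D M I U B + in_bidegree k 0 S"
      and BS': "A' \<in> hypersparks M I U k" "B' \<in> ?B" "S' \<in> int_cochains M I U k"
        "A' = total_D M I U B' + in_bidegree k 0 S'"
      unfolding trivial_hypersparks_def by blast
    have "A + A' = total_D M I U (B + B') + in_bidegree k 0 (S + S')"
      unfolding total_D_add[OF B[OF BS(2)] B[OF BS'(2)]] BS(4) BS'(4) in_bidegree_add by simp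
    then have "A + A' \<in> trivial_hypersparks k"
      unfolding trivial_hypersparks_def
      using hypersparks_add[OF BS(1) BS'(1)] Badd[OF BS(2) BS'(2)] int_cochains_add[OF BS(3) BS'(3)]
      by blast
    then show "A \<otimes>\<^bsub>hyperspark_group M I U k\<^esub> A' \<in> trivial_hypersparks k"
      by (simp add: hyperspark_group_def)
  qed
qed

lemma smooth_equiv_iff:
  "(A, A') \<in> smooth_equiv M I U k \<longleftrightarrow>
     A \<in> carrier (hyperspark_group M I U k) \<and> A' \<in> carrier (hyperspark_group M I U k) \<and>
     A \<otimes>\<^bsub>hyperspark_group M I U k\<^esub> inv\<^bsub>hyperspark_group M I U k\<^esub> A' \<in> trivial_hypersparks k"
proof (cases "A \<in> hypersparks M I U k \<and> A' \<in> hypersparks M I U k")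
  case True
  then have inv: "inv\<^bsub>hyperspark_group M I U k\<^esub> A' = - A'" by (simp add: hyperspark_group_inv)
  have "A - A' \<in> hypersparks M I U k"
    using hypersparks_add[of A k "- A'"] hypersparks_uminus True by simp
  then show ?thesis
    unfolding inv using True by (simp add: smooth_equiv_def trivial_hypersparks_def hyperspark_group_def)
qed (auto simp: smooth_equiv_def hyperspark_group_def)

lemma hyperspark_to_grundle_add:
  "hyperspark_to_grundle k (A + B) =
     hyperspark_to_grundle k A \<otimes>\<^bsub>grundle_group M I U k\<^esub> hyperspark_to_grundle k B"
  by (simp add: hyperspark_to_grundle_eq grundle_group_def cochain_exp_add form_part_def fun_eq_iff)

lemma hyperspark_to_grundle_0: "hyperspark_to_grundle k 0 = \<one>\<^bsub>grundle_group M I U k\<^esub>"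
  by (simp add: hyperspark_to_grundle_eq grundle_group_def form_part_def cochain_exp_def circle_exp_zero fun_eq_iff)

end

theorem mainTheorem5:
  fixes M :: "'a mfd" and I :: "'i set" and U :: "'i \<Rightarrow> 'a set" and k :: nat
  assumes "smooth_manifold M"
    and "good_cover M I U"
  shows "group (H_smooth M I U k) \<and> group (H_grundle M I U k) \<and>
    (\<forall>A\<in>hypersparks M I U k. hyperspark_to_grundle k A \<in> grundles M I U k) \<and>
    (\<exists>\<Phi>\<in>iso (H_smooth M I U k) (H_grundle M I U k).
      \<forall>A\<in>hypersparks M I U k.
        \<Phi> (smooth_equiv M I U k `` {A}) = gauge_equiv M I U k `` {hyperspark_to_grundle k A})"
proof -
  interpret good_cover_mfd M I U
    using assms by unfold_locales
  let ?G = "hyperspark_group M I U k" and ?K = "grundle_group M I U k" and ?F = "hyperspark_to_grundle k"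
  have carriers: "carrier ?G = hypersparks M I U k" "carrier ?K = grundles M I U k"
    by (simp_all add: hyperspark_group_def grundle_group_def)
  have surj: "?F ` carrier ?G = carrier ?K"
    unfolding carriers by (rule hyperspark_to_grundle_surj)
  have mult: "?F (A \<otimes>\<^bsub>?G\<^esub> B) = ?F A \<otimes>\<^bsub>?K\<^esub> ?F B" for A B
    using hyperspark_to_grundle_add by (simp add: hyperspark_group_def)
  have one: "?F \<one>\<^bsub>?G\<^esub> = \<one>\<^bsub>?K\<^esub>"
    using hyperspark_to_grundle_0 by (simp add: hyperspark_group_def)
  have s: "gauge_equiv M I U k \<subseteq> carrier ?K \<times> carrier ?K"
    unfolding carriers by (auto simp: gauge_equiv_def)
  have rs: "(?F A, ?F B) \<in> gauge_equiv M I U k \<longleftrightarrow> (A, B) \<in> smooth_equiv M I U k"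
    if "A \<in> carrier ?G" "B \<in> carrier ?G" for A B
    using that unfolding carriers by (rule smooth_equiv_iff_gauge_equiv)
  note iso = class_group_iso[OF comm_group_hypersparks subgroup_trivial_hypersparks smooth_equiv_iff
      surj mult one s rs]
  have "?F A \<in> grundles M I U k" if "A \<in> hypersparks M I U k" for A
    using that hyperspark_to_grundle_surj by blast
  then show ?thesis
    using iso unfolding H_smooth_def H_grundle_def carriers by (intro conjI ballI) simp_all
qed

end
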